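(* Let $\{Z_n=(X_n,u_n)\}_{n\ge0}$ be the Markov chain with transition probabilities $P(\alpha)$, where $\alpha$ is fixed with all $\alpha_{jq}\in(0,\pi/2)$ and the law of $Z_0$ does not depend on $\alpha$. Fix $i\in S$ and $p\in\{1,\dots,d(i)\}$. If $p<d(i)$, let $\{\tilde u(k)\}_{k\ge1}$ be i.i.d. random variables, independent of $\{Z_n\}$, with $$\mathbb P(\tilde u(k)=a)=\frac{\theta_{ia}(\alpha)}{\prod_{m=1}^{p}\sin^2(\alpha_{im})},\qquad a\in\{p,\dots,d(i)\};$$ if $p=d(i)$, let $\tilde u(k)=d(i)\,\mathbf 1\{u_k=d(i)-1\}+(d(i)-1)\,\mathbf 1\{u_k=d(i)\}$. Define the hitting time $$\nu(k)=\min\{n>0: Z_{k+n}=(i,\tilde u(k))\}.$$ Let $\hat\Gamma_N$ be any estimator converging almost surely to $C(\alpha)$ as $N\to\infty$ (e.g. $\hat\Gamma_N=\frac1N\sum_{n=1}^Nc(Z_n)$). Then $$\hat G_N(i,p)=\frac2N\sum_{k=1}^NK_{ip}(\alpha,k)\Big([c(i,u_k)-c(i,\tilde u(k))]+\sum_{n=k+1}^{k+\nu(k)}c(Z_n)-\nu(k)\,\hat\Gamma_N\Big)$$ (terms with $K_{ip}(\alpha,k)=0$ being zero) is a consistent estimator of the gradient component $\frac{\partial}{\partial\alpha_{ip}}\mathbb E_\alpha\big[\frac1N\sum_{n=1}^Nc(Z_n)\big]$, i.e. $$\hat G_N(i,p)-\frac{\partial}{\partial\alpha_{ip}}\mathbb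 E_\alpha\Big[\frac1N\sum_{n=1}^Nc(Z_n)\Big]\longrightarrow0\quad\text{in probability as }N\to\infty.$$
   Context: $S$ is a finite state space. For each $i\in S$ the action set is $\mathcal U_i=\{0,1,\dots,d(i)\}$ with $d(i)\ge1$. For $a\in\mathcal U_i$, $A_{ij}(a)=\mathbb P[X_{n+1}=j\mid X_n=i,u_n=a]$ are transition probabilities on $S$. The cost $c(i,a)$, $i\in S$, $a\in\mathcal U_i$, is a real (bounded) function. Spherical-coordinate randomized policy: the parameter is $\alpha=(\alpha_{ip})_{i\in S,\,1\le p\le d(i)}$, with $\alpha_{ip}\in[0,\pi/2]$, and in state $i$ action $a$ is chosen with probability $$\theta_{ia}(\alpha)=\begin{cases}\cos^2(\alpha_{i1}) & a=0,\\ \cos^2(\alpha_{i,a+1})\prod_{m=1}^a\sin^2(\alpha_{im}) & 1\le a\le d(i)-1,\\ \prod_{m=1}^{d(i)}\sin^2(\alpha_{im}) & a=d(i).\end{cases}$$ The chain $Z_n=(X_n,u_n)$ on $\{(i,a):i\in S,a\in\mathcal U_i\}$ has transition probabilities $P_{(i,a),(j,a')}(\alpha)=A_{ij}(a)\,\theta_{ja'}(\alpha)$. Standing assumption: for every $\alpha$ with all coordinates in $(0,\pi/2)$ this chain is irreducible and aperiodic; $\pi(\alpha)$ denotes its unique invariant distribution, and $C(\alpha)=\sum_{i,a}\pi_{i,a}(\alpha)c(i,a)$. $\mathbb E_\alpha$ denotes expectation under parameter $\alpha$. With $\delta_{iq}(k)=\mathbf 1\{Z_k=(i,q-1)\}$,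 $$K_{ip}(\alpha,k)=\begin{cases}-\tan(\alpha_{ip})\,\delta_{i,p}(k) & p=1,\dots,d(i)-1,\\ -\cos(\alpha_{i,d(i)})\sin(\alpha_{i,d(i)})\,[\delta_{i,d(i)}(k)-\delta_{i,d(i)+1}(k)] & p=d(i).\end{cases}$$ *)

theory Defs
  imports "HOL-Probability.Probability"
begin

text \<open>
  A parameter is a function \<open>\<alpha> :: 's \<Rightarrow> nat \<Rightarrow> real\<close>; only the coordinates
  \<open>\<alpha> i p\<close> with \<open>1 \<le> p \<le> d i\<close> are meaningful, and nothing below looks at the others.
\<close>

definition states :: "('s \<Rightarrow> nat) \<Rightarrow> ('s \<times> nat) set" where
  "states d = {(i, a). a \<le> d i}"

definition interior_param :: "('s \<Rightarrow> nat) \<Rightarrow> ('s \<Rightarrow> nat \<Rightarrow> real) \<Rightarrow> bool" where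
  "interior_param d \<alpha> \<longleftrightarrow> (\<forall>j. \<forall>q\<in>{1..d j}. \<alpha> j q \<in> {0<..<pi/2})"

definition \<theta> :: "('s \<Rightarrow> nat) \<Rightarrow> ('s \<Rightarrow> nat \<Rightarrow> real) \<Rightarrow> 's \<Rightarrow> nat \<Rightarrow> real" where
  "\<theta> d \<alpha> i a =
    (if a = 0 then (cos (\<alpha> i 1))\<^sup>2
     else if a < d i then (cos (\<alpha> i (a + 1)))\<^sup>2 * (\<Prod>m=1..a. (sin (\<alpha> i m))\<^sup>2)
     else if a = d i then (\<Prod>m=1..d i. (sin (\<alpha> i m))\<^sup>2)
     else 0)"

text \<open>\<open>A i a\<close> is the law of the next state when action \<open>a\<close> is taken in state \<open>i\<close>.\<close>

definition trans_prob ::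
  "('s \<Rightarrow> nat) \<Rightarrow> ('s \<Rightarrow> nat \<Rightarrow> 's pmf) \<Rightarrow> ('s \<Rightarrow> nat \<Rightarrow> real) \<Rightarrow> 's \<times> nat \<Rightarrow> 's \<times> nat \<Rightarrow> real" where
  "trans_prob d A \<alpha> z z' = pmf (A (fst z) (snd z)) (fst z') * \<theta> d \<alpha> (fst z') (snd z')"

primrec nstep :: "'e set \<Rightarrow> ('e \<Rightarrow> 'e \<Rightarrow> real) \<Rightarrow> nat \<Rightarrow> 'e \<Rightarrow> 'e \<Rightarrow> real" where
  "nstep E P 0 z z' = (if z = z' then 1 else 0)"
| "nstep E P (Suc n) z z' = (\<Sum>w\<in>E. P z w * nstep E P n w z')"

definition irreducible_chain :: "'e set \<Rightarrow> ('e \<Rightarrow> 'e \<Rightarrow> real) \<Rightarrow> bool" where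
  "irreducible_chain E P \<longleftrightarrow> (\<forall>z\<in>E. \<forall>z'\<in>E. \<exists>n>0. nstep E P n z z' > 0)"

definition aperiodic_chain :: "'e set \<Rightarrow> ('e \<Rightarrow> 'e \<Rightarrow> real) \<Rightarrow> bool" where
  "aperiodic_chain E P \<longleftrightarrow> (\<forall>z\<in>E. Gcd {n. n > 0 \<and> nstep E P n z z > 0} = 1)"

definition invariant_dist :: "'e set \<Rightarrow> ('e \<Rightarrow> 'e \<Rightarrow> real) \<Rightarrow> ('e \<Rightarrow> real) \<Rightarrow> bool" where
  "invariant_dist E P \<pi> \<longleftrightarrow>
    (\<forall>z\<in>E. \<pi> z \<ge> 0) \<and> (\<forall>z. z \<notin> E \<longrightarrow> \<pi> z = 0) \<and> (\<Sum>z\<in>E. \<pi> z) = 1 \<and>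
    (\<forall>z'\<in>E. (\<Sum>z\<in>E. \<pi> z * P z z') = \<pi> z')"

definition stationary :: "'e set \<Rightarrow> ('e \<Rightarrow> 'e \<Rightarrow> real) \<Rightarrow> 'e \<Rightarrow> real" where
  "stationary E P = (THE \<pi>. invariant_dist E P \<pi>)"

definition long_run_cost ::
  "('s \<Rightarrow> nat) \<Rightarrow> ('s \<Rightarrow> nat \<Rightarrow> 's pmf) \<Rightarrow> ('s \<times> nat \<Rightarrow> real) \<Rightarrow> ('s \<Rightarrow> nat \<Rightarrow> real) \<Rightarrow> real" where
  "long_run_cost d A c \<alpha> =
    (\<Sum>z\<in>states d. stationary (states d) (trans_prob d A \<alpha>) z * c z)"

definition markov_chain ::
  "'w measure \<Rightarrow> 'e set \<Rightarrow> ('e \<Rightarrow> 'e \<Rightarrow> real) \<Rightarrow> (nat \<Rightarrow> 'w \<Rightarrow> 'e) \<Rightarrow> bool" where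
  "markov_chain M E P Z \<longleftrightarrow>
    prob_space M \<and> (\<forall>n. Z n \<in> M \<rightarrow>\<^sub>M count_space E) \<and>
    (\<forall>n h. \<forall>z\<in>E. \<P>(\<omega> in M. \<forall>m\<le>n. Z m \<omega> = h m) > 0 \<longrightarrow>
      \<P>(\<omega> in M. Z (Suc n) \<omega> = z \<bar> \<forall>m\<le>n. Z m \<omega> = h m) = P (h n) z)"

text \<open>
  \<open>prob_space.indep_var\<close> requires both random variables to take values in the same type,
  hence independence of the generated \<open>\<sigma>\<close>-algebras.
\<close>

definition independent_rvs ::
  "'w measure \<Rightarrow> 'a measure \<Rightarrow> ('w \<Rightarrow> 'a) \<Rightarrow> 'b measure \<Rightarrow> ('w \<Rightarrow> 'b) \<Rightarrow> bool" where
  "independent_rvs M MX X MY Y \<longleftrightarrow>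
    X \<in> M \<rightarrow>\<^sub>M MX \<and> Y \<in> M \<rightarrow>\<^sub>M MY \<and>
    prob_space.indep_set M (sets (vimage_algebra (space M) X MX)) (sets (vimage_algebra (space M) Y MY))"

definition \<delta> :: "'s \<Rightarrow> nat \<Rightarrow> 's \<times> nat \<Rightarrow> real" where
  "\<delta> i q z = of_bool (z = (i, q - 1))"

definition K :: "('s \<Rightarrow> nat) \<Rightarrow> 's \<Rightarrow> nat \<Rightarrow> ('s \<Rightarrow> nat \<Rightarrow> real) \<Rightarrow> 's \<times> nat \<Rightarrow> real" where
  "K d i p \<alpha> z =
    (if p < d i then - tan (\<alpha> i p) * \<delta> i p z
     else - cos (\<alpha> i (d i)) * sin (\<alpha> i (d i)) * (\<delta> i (d i) z - \<delta> i (d i + 1) z))"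

text \<open>
  The value of \<open>\<nu>\<close> is unspecified if the target is never hit. Under an irreducible chain this
  has probability zero whenever \<open>(i, u k)\<close> is almost surely a state.
\<close>

definition \<nu> :: "'s \<Rightarrow> (nat \<Rightarrow> 'w \<Rightarrow> 's \<times> nat) \<Rightarrow> (nat \<Rightarrow> 'w \<Rightarrow> nat) \<Rightarrow> nat \<Rightarrow> 'w \<Rightarrow> nat" where
  "\<nu> i Z u k \<omega> = (LEAST n. n > 0 \<and> Z (k + n) \<omega> = (i, u k \<omega>))"

definition G_hat ::
  "('s \<Rightarrow> nat) \<Rightarrow> ('s \<times> nat \<Rightarrow> real) \<Rightarrow> ('s \<Rightarrow> nat \<Rightarrow> real) \<Rightarrow> 's \<Rightarrow> nat \<Rightarrow>
   (nat \<Rightarrow> 'w \<Rightarrow> 's \<times> nat) \<Rightarrow> (nat \<Rightarrow> 'w \<Rightarrow> nat) \<Rightarrow> (nat \<Rightarrow> 'w \<Rightarrow> real) \<Rightarrow> nat \<Rightarrow> 'w \<Rightarrow> real" where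
  "G_hat d c \<alpha> i p Z u \<Gamma> N \<omega> =
    2 / real N * (\<Sum>k=1..N. K d i p \<alpha> (Z k \<omega>) *
      ((c (i, snd (Z k \<omega>)) - c (i, u k \<omega>))
       + (\<Sum>n=k+1..k + \<nu> i Z u k \<omega>. c (Z n \<omega>))
       - real (\<nu> i Z u k \<omega>) * \<Gamma> N \<omega>))"

text \<open>\<open>M \<beta>\<close> plays the role of the probability measure under parameter \<open>\<beta>\<close>.\<close>

definition mean_cost ::
  "(('s \<Rightarrow> nat \<Rightarrow> real) \<Rightarrow> 'w measure) \<Rightarrow> (nat \<Rightarrow> 'w \<Rightarrow> 's \<times> nat) \<Rightarrow> ('s \<times> nat \<Rightarrow> real) \<Rightarrow>
   nat \<Rightarrow> ('s \<Rightarrow> nat \<Rightarrow> real) \<Rightarrow> real" where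
  "mean_cost M Z c N \<beta> = prob_space.expectation (M \<beta>) (\<lambda>\<omega>. 1 / real N * (\<Sum>n=1..N. c (Z n \<omega>)))"

definition set_coord ::
  "('s \<Rightarrow> nat \<Rightarrow> real) \<Rightarrow> 's \<Rightarrow> nat \<Rightarrow> real \<Rightarrow> ('s \<Rightarrow> nat \<Rightarrow> real)" where
  "set_coord \<alpha> i p x = \<alpha>(i := (\<alpha> i)(p := x))"

definition tendsto_zero_in_prob :: "'w measure \<Rightarrow> (nat \<Rightarrow> 'w \<Rightarrow> real) \<Rightarrow> bool" where
  "tendsto_zero_in_prob M X \<longleftrightarrow>
    (\<forall>N. X N \<in> borel_measurable M) \<and>
    (\<forall>\<epsilon>>0. (\<lambda>N. \<P>(\<omega> in M. \<bar>X N \<omega>\<bar> > \<epsilon>)) \<longlonglongrightarrow> 0)"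

end

theory Submission
  imports Defs
begin

text \<open>
  Let \<open>V\<close> solve the Poisson equation \<open>V - P V = c - C\<close>. Differentiating \<open>\<mu> P\<^sup>n c\<close> and averaging over \<open>n\<close>
  shows that the gradient converges to \<open>\<pi> P' V\<close>. On the other hand, \<open>V\<close> turns the cost accumulated up
  to the hitting time of \<open>(i, u k)\<close>, centred by \<open>C\<close>, into \<open>P V (Z k) - P V (i, u k)\<close> plus martingale
  increments, so that the \<open>k\<close>-th summand of the estimator has conditional mean
  \<open>K (V (Z k) - E V (i, u k))\<close>. The law of large numbers replaces the average of these by their
  stationary mean, which the explicit derivative of \<open>\<theta>\<close> identifies with half of \<open>\<pi> P' V\<close>.
  The sum of the martingale parts has \<open>L\<^sup>2\<close> norm \<open>O(sqrt N)\<close> because hitting times have geometric tails.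
\<close>

section \<open>Primitive stochastic matrices\<close>

text \<open>Two obstacles shape the argument. The windows from \<open>k\<close> to
  \<open>k + \<nu> k\<close> overlap and may reach past \<open>N\<close>, so the summands of the
  estimator are not martingale differences. Reordering the double sum by time repairs this: each
  time contributes one increment, with a weight known by then. Also, all windows share the centring
  \<open>\<Gamma> N\<close>, which merely converges; its error multiplies an average of hitting
  times, whose mean stays bounded.

  One minorisation serves both sides: an \<open>L\<close> for which all \<open>L\<close>-step
  probabilities are at least \<open>\<epsilon>\<close> yields geometric convergence of the iterates,
  hence \<open>V\<close>, and geometric tails of the hitting times. Differentiating at a finite
  horizon means that the stationary distribution itself is never differentiated.

  The factor 2 and the law of \<open>u k\<close> come from the parametrisation: raising
  \<alpha>(i,p) moves mass from action \<open>p - 1\<close> to the actions \<open>p..d i\<close>, in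
  proportion to their probabilities, at rate \<open>2 sin cos\<close> times the preceding squared
  sines. For \<open>p = d i\<close> only two actions are involved, and exchanging them uses visits
  to either one.\<close>

lemma add_closed_Gcd_1_cofinite:
  fixes S :: "nat set"
  assumes add: "\<And>a b. a \<in> S \<Longrightarrow> b \<in> S \<Longrightarrow> a + b \<in> S" and Gcd: "Gcd S = 1"
  shows "eventually (\<lambda>n. n \<in> S) sequentially"
proof -
  have mult: "q * a + b \<in> S" if "a \<in> S" "b \<in> S" for q a b
    using that by (induction q) (auto intro: add simp: add.assoc)
  \<comment> \<open>The positive differences of elements of \<open>S\<close>. Once the least of them
    is shown to be 1, there are two consecutive elements in \<open>S\<close>.\<close>
  define D where "D = {g. g > 0 \<and> (\<exists>a\<in>S. \<exists>b\<in>S. a = b + g)}"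
  obtain s where s: "s \<in> S" "s > 0"
    using Gcd by (metis Gcd_0_iff gr0I insertCI subsetI zero_neq_one)
  then have "s \<in> D" using add by (auto simp: D_def)
  define g where "g = (LEAST g. g \<in> D)"
  have "g \<in> D" unfolding g_def using \<open>s \<in> D\<close> by (rule LeastI)
  then obtain b where b: "b \<in> S" "b + g \<in> S" and g: "g > 0" by (auto simp: D_def)
  have "g dvd x" if x: "x \<in> S" for x
  proof (rule ccontr)
    assume "\<not> g dvd x"
    then have r: "x mod g > 0" by (simp add: dvd_eq_mod_eq_0)
    \<comment> \<open>Both elements contain \<open>x div g + 1\<close> copies of \<open>b\<close>.
      These cancel, so the difference is the remainder \<open>x mod g\<close>, which would undercut
      the least difference \<open>g\<close>.\<close>
    have 1: "(x div g) * b + (x + b) \<in> S" by (rule mult[OF b(1) add[OF x b(1)]])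
    have 2: "(x div g) * (b + g) + b \<in> S" by (rule mult[OF b(2) b(1)])
    have "(x div g) * b + (x + b) = (x div g) * (b + g) + b + x mod g"
      using div_mult_mod_eq[of x g] by (simp add: algebra_simps)
    with 1 2 r have "x mod g \<in> D" unfolding D_def by blast
    then have "g \<le> x mod g" unfolding g_def by (rule Least_le)
    then show False using mod_less_divisor[OF g, of x] by linarith
  qed
  then have "g dvd Gcd S" by (simp add: Gcd_greatest)
  with Gcd have g1: "g = 1" by simp
  show ?thesis
  proof (cases "b = 0")
    case True
    have "n \<in> S" if "n > 0" for n
      using mult[of 1 1 "n - 1"] b True g1 that mult[of 1 0 n] by simp
    then show ?thesis by (intro eventually_sequentiallyI[of 1]) auto
  next
    case False
    have "n \<in> S" if n: "n \<ge> b * b + b" for n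
    proof -
      let ?q = "n div b" and ?r = "n mod b"
      have "b + 1 \<le> ?q" using div_le_mono[OF n, of b] False by simp
      moreover have "?r < b" using False by simp
      ultimately have le: "?r + 1 \<le> ?q" by simp
      \<comment> \<open>\<open>n = q b + r\<close> is \<open>q - r\<close> copies of
        \<open>b\<close> plus \<open>r\<close> copies of \<open>b + 1\<close>; the lower bound on
        \<open>n\<close> ensures \<open>r < q\<close>. One copy of \<open>b\<close> is kept apart
        because \<open>0\<close> need not lie in \<open>S\<close>, so that \<open>mult\<close> has
        an element to start from.\<close>
      have "(?q - ?r - 1) * b + (?r * (b + 1) + b) \<in> S"
        by (rule mult[OF b(1) mult]) (use b g1 in auto)
      also have "(?q - ?r - 1) * b + (?r * (b + 1) + b) = n"
      proof -
        obtain e where e: "?q = e + ?r + 1" using le by (metis add.commute add.left_commute le_iff_add)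
        have "n = ?q * b + ?r" by simp
        then have "n = (e + ?r + 1) * b + ?r" using e by simp
        then show ?thesis by (simp add: e algebra_simps)
      qed
      finally show ?thesis .
    qed
    then show ?thesis by (intro eventually_sequentiallyI) auto
  qed
qed

section \<open>Transition operators and n-step probabilities\<close>

definition trans_op :: "'e set \<Rightarrow> ('e \<Rightarrow> 'e \<Rightarrow> real) \<Rightarrow> ('e \<Rightarrow> real) \<Rightarrow> 'e \<Rightarrow> real" where
  "trans_op E P f z = (\<Sum>w\<in>E. P z w * f w)"

lemma trans_op_cong: "(\<And>w. w \<in> E \<Longrightarrow> f w = g w) \<Longrightarrow> trans_op E P f z = trans_op E P g z"
  by (simp add: trans_op_def)

lemma trans_op_diff: "trans_op E P (\<lambda>w. f w - g w) z = trans_op E P f z - trans_op E P g z"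
  by (simp add: trans_op_def algebra_simps sum_subtractf)

lemma trans_op_sum: "trans_op E P (\<lambda>w. \<Sum>i\<in>I. f i w) z = (\<Sum>i\<in>I. trans_op E P (f i) z)"
  unfolding trans_op_def by (subst sum.swap) (simp add: sum_distrib_left)

lemma nstep_trans_op:
  assumes "finite E" "z \<in> E"
  shows "(\<Sum>w\<in>E. nstep E P n z w * f w) = (trans_op E P ^^ n) f z"
  using assms(2)
proof (induction n arbitrary: z)
  case 0
  then show ?case using assms(1) by (simp add: if_distrib[of "\<lambda>x. x * _"] cong: if_cong)
next
  case (Suc n)
  have "(\<Sum>w\<in>E. nstep E P (Suc n) z w * f w) = (\<Sum>v\<in>E. P z v * (\<Sum>w\<in>E. nstep E P n v w * f w))"
    by (simp add: sum_distrib_right sum_distrib_left mult.assoc) (rule sum.swap)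
  then show ?case using Suc.IH by (simp add: trans_op_def)
qed

text \<open>Decay by a factor \<open>x\<close> per block of \<open>L\<close> steps is decay at rate
  \<open>root L x\<close> per step; the constant \<open>1 / x\<close> pays for the incomplete last
  block.\<close>

lemma power_div_le_geometric:
  fixes x :: real and L :: nat
  assumes "0 < x" "x < 1" "L > 0"
  obtains C r where "C \<ge> 0" "0 < r" "r < 1" "\<And>n. x ^ (n div L) \<le> C * r ^ n"
proof
  define r where "r = root L x"
  show r: "0 < r" "r < 1" using assms by (auto simp: r_def)
  show "0 \<le> 1 / x" using assms by simp
  fix n
  have rL: "r ^ L = x" using assms by (simp add: r_def)
  have "x ^ (n div L) * x \<le> x ^ (n div L) * r ^ (n mod L)"
    using power_decreasing[of "n mod L" L r] r assms rL
    by (intro mult_left_mono) (auto simp: less_imp_le)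
  also have "\<dots> = r ^ (L * (n div L) + n mod L)"
    by (simp only: power_add power_mult rL)
  also have "\<dots> = r ^ n" by simp
  finally show "x ^ (n div L) \<le> 1 / x * r ^ n"
    using assms by (simp add: field_simps)
qed

lemma tendsto_zero_geometric_bound:
  fixes a :: "nat \<Rightarrow> real"
  assumes "\<And>n. \<bar>a n\<bar> \<le> C * r ^ n" "0 < r" "r < 1"
  shows "a \<longlonglongrightarrow> 0"
proof (rule Lim_null_comparison)
  show "(\<lambda>n. C * r ^ n) \<longlonglongrightarrow> 0"
    using assms by (intro tendsto_mult_right_zero LIMSEQ_realpow_zero) auto
qed (use assms in simp)

locale stochastic_matrix =
  fixes E :: "'e set" and P :: "'e \<Rightarrow> 'e \<Rightarrow> real"
  assumes finite_E [simp]: "finite E" and E_nonempty: "E \<noteq> {}"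
    and P_nonneg: "\<And>z w. z \<in> E \<Longrightarrow> w \<in> E \<Longrightarrow> P z w \<ge> 0"
    and P_sum: "\<And>z. z \<in> E \<Longrightarrow> (\<Sum>w\<in>E. P z w) = 1"
begin

abbreviation "T \<equiv> trans_op E P"

lemma T_const: "z \<in> E \<Longrightarrow> T (\<lambda>_. a) z = a"
  using P_sum by (simp add: trans_op_def sum_distrib_right[symmetric])

lemma T_mono: "(\<And>w. w \<in> E \<Longrightarrow> f w \<le> g w) \<Longrightarrow> z \<in> E \<Longrightarrow> T f z \<le> T g z"
  by (auto simp: trans_op_def intro!: sum_mono mult_left_mono P_nonneg)

lemma T_abs_le: "(\<And>w. w \<in> E \<Longrightarrow> \<bar>f w\<bar> \<le> a) \<Longrightarrow> z \<in> E \<Longrightarrow> \<bar>T f z\<bar> \<le> a"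
  using T_mono[of f "\<lambda>_. a" z] T_mono[of "\<lambda>_. - a" f z] by (force simp: T_const abs_le_iff)

lemma nstep_nonneg: "z \<in> E \<Longrightarrow> w \<in> E \<Longrightarrow> nstep E P n z w \<ge> 0"
  by (induction n arbitrary: z) (auto intro!: sum_nonneg mult_nonneg_nonneg P_nonneg)

lemma nstep_sum: "z \<in> E \<Longrightarrow> (\<Sum>w\<in>E. nstep E P n z w) = 1"
proof -
  have "(T ^^ n) (\<lambda>_. 1) z = 1" if "z \<in> E"
    using that
  proof (induction n arbitrary: z)
    case (Suc n)
    then have "T ((T ^^ n) (\<lambda>_. 1)) z = T (\<lambda>_. 1) z" by (intro trans_op_cong) auto
    then show ?case using Suc by (simp add: T_const)
  qed simp
  then show "z \<in> E \<Longrightarrow> ?thesis" using nstep_trans_op[of E z P n "\<lambda>_. 1"] by simp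
qed

lemma nstep_add:
  "z \<in> E \<Longrightarrow> nstep E P (m + n) z z' = (\<Sum>w\<in>E. nstep E P m z w * nstep E P n w z')"
proof (induction m arbitrary: z)
  case 0
  then show ?case by (simp add: if_distrib[of "\<lambda>x. x * _"] cong: if_cong)
next
  case (Suc m)
  then show ?case
    by (simp add: sum_distrib_right sum_distrib_left mult.assoc) (rule sum.swap)
qed

lemma nstep_add_ge:
  assumes "z \<in> E" "w \<in> E" "z' \<in> E"
  shows "nstep E P m z w * nstep E P n w z' \<le> nstep E P (m + n) z z'"
  unfolding nstep_add[OF assms(1)]
  by (rule member_le_sum) (auto simp: assms nstep_nonneg)

text \<open>The return times to \<open>w\<close> are closed under addition with gcd 1, hence contain
  all large numbers. Prefixing one path from \<open>z\<close> to \<open>w\<close> makes all large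
  lengths possible for the pair, and finiteness of \<open>E\<close> yields a common length.\<close>

lemma irreducible_aperiodic_imp_primitive:
  assumes irr: "irreducible_chain E P" and aper: "aperiodic_chain E P"
  shows "\<exists>L>0. \<forall>z\<in>E. \<forall>w\<in>E. nstep E P L z w > 0"
proof -
  have "eventually (\<lambda>n. nstep E P n z w > 0) sequentially" if z: "z \<in> E" and w: "w \<in> E" for z w
  proof -
    let ?S = "{n. n > 0 \<and> nstep E P n w w > 0}"
    have "a + b \<in> ?S" if "a \<in> ?S" "b \<in> ?S" for a b
    proof -
      have "0 < nstep E P a w w * nstep E P b w w" using that by (intro mult_pos_pos) auto
      also have "\<dots> \<le> nstep E P (a + b) w w" by (rule nstep_add_ge[OF w w w])
      finally show ?thesis using that by simp
    qed
    moreover have "Gcd ?S = 1" using aper w by (auto simp: aperiodic_chain_def)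
    ultimately have ev: "eventually (\<lambda>n. n \<in> ?S) sequentially" by (rule add_closed_Gcd_1_cofinite)
    obtain k where k: "nstep E P k z w > 0" using irr z w by (auto simp: irreducible_chain_def)
    from ev have "eventually (\<lambda>n. nstep E P (n + k) z w > 0) sequentially"
    proof eventually_elim
      case (elim n)
      then have "0 < nstep E P k z w * nstep E P n w w" using k by simp
      also have "\<dots> \<le> nstep E P (k + n) z w" by (rule nstep_add_ge[OF z w w])
      finally show ?case by (simp add: add.commute)
    qed
    then show ?thesis by (rule eventually_sequentially_seg[THEN iffD1])
  qed
  then have "eventually (\<lambda>n. n > 0 \<and> (\<forall>z\<in>E. \<forall>w\<in>E. nstep E P n z w > 0)) sequentially"
    by (intro eventually_conj eventually_gt_at_top eventually_ball_finite ballI) auto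
  then show ?thesis
    using eventually_happens'[OF sequentially_bot] by blast
qed

end

text \<open>Doeblin's condition in quantitative form. \<open>L\<close> and \<open>\<epsilon>\<close>
  are fixed once, since they determine both the mixing rate and the tails of the hitting
  times.\<close>

locale primitive_matrix = stochastic_matrix +
  fixes L :: nat and \<epsilon> :: real
  assumes L_pos: "L > 0" and eps_pos: "0 < \<epsilon>" and eps_lt_1: "\<epsilon> < 1"
    and nstep_L: "\<And>z w. z \<in> E \<Longrightarrow> w \<in> E \<Longrightarrow> \<epsilon> \<le> nstep E P L z w"

lemma (in stochastic_matrix) primitive_matrixI:
  assumes "irreducible_chain E P" "aperiodic_chain E P"
  obtains L \<epsilon> where "primitive_matrix E P L \<epsilon>"
proof -
  obtain L where L: "L > 0" "\<And>z w. z \<in> E \<Longrightarrow> w \<in> E \<Longrightarrow> nstep E P L z w > 0"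
    using irreducible_aperiodic_imp_primitive[OF assms] by blast
  define m where "m = Min ((\<lambda>(z, w). nstep E P L z w) ` (E \<times> E))"
  have m: "m > 0" using L E_nonempty by (auto simp: m_def)
  have le: "m \<le> nstep E P L z w" if "z \<in> E" "w \<in> E" for z w
    unfolding m_def using that by (intro Min_le) (auto intro!: image_eqI[of _ _ "(z, w)"])
  \<comment> \<open>The cap 1/2 enforces \<open>\<epsilon> < 1\<close>, so that the contraction
    factor \<open>1 - \<epsilon>\<close> is positive and has a usable root.\<close>
  have "primitive_matrix E P L (min m (1/2))"
    by unfold_locales (use L m le in \<open>auto simp: min_le_iff_disj\<close>)
  then show ?thesis by (rule that)
qed

section \<open>Contraction of the range of a function under the transition operator\<close>

context primitive_matrix
begin

definition "hi f = Max (f ` E)" for f :: "'a \<Rightarrow> real"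
definition "lo f = Min (f ` E)" for f :: "'a \<Rightarrow> real"

lemma hi_ge: "z \<in> E \<Longrightarrow> f z \<le> hi f" by (simp add: hi_def)
lemma lo_le: "z \<in> E \<Longrightarrow> lo f \<le> f z" by (simp add: lo_def)
lemma hi_le: "(\<And>z. z \<in> E \<Longrightarrow> f z \<le> a) \<Longrightarrow> hi f \<le> a" using E_nonempty by (auto simp: hi_def)
lemma lo_ge: "(\<And>z. z \<in> E \<Longrightarrow> a \<le> f z) \<Longrightarrow> a \<le> lo f" using E_nonempty by (auto simp: lo_def)
lemma lo_le_hi: "lo f \<le> hi f" using E_nonempty lo_le hi_ge by (meson ex_in_conv order_trans)

lemma hi_T: "hi (T f) \<le> hi f"
  using T_mono[of f "\<lambda>_. hi f"] by (intro hi_le) (auto simp: hi_ge T_const)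

lemma lo_T: "lo f \<le> lo (T f)"
  using T_mono[of "\<lambda>_. lo f" f] by (intro lo_ge) (auto simp: lo_le T_const)

lemma hi_funpow: "hi ((T ^^ n) f) \<le> hi f"
  by (induction n) (auto intro: order_trans[OF hi_T])

lemma lo_funpow: "lo f \<le> lo ((T ^^ n) f)"
  by (induction n) (auto intro: order_trans[OF _ lo_T])

text \<open>After \<open>L\<close> steps every starting point gives weight at least
  \<open>\<epsilon>\<close> to a minimiser of \<open>f\<close>. This pulls every value down by
  \<open>\<epsilon>\<close> times the oscillation, while the minimum cannot decrease.\<close>

lemma oscillation_contracts:
  "hi ((T ^^ L) f) - lo ((T ^^ L) f) \<le> (1 - \<epsilon>) * (hi f - lo f)"
proof -
  obtain w where w: "w \<in> E" "f w = lo f"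
  proof -
    have "lo f \<in> f ` E" unfolding lo_def using E_nonempty by (intro Min_in) auto
    then show ?thesis using that by auto
  qed
  have "(T ^^ L) f z \<le> hi f - \<epsilon> * (hi f - lo f)" if z: "z \<in> E" for z
  proof -
    have "\<epsilon> * (hi f - lo f) \<le> nstep E P L z w * (hi f - f w)"
      using nstep_L[OF z w(1)] w lo_le_hi by (intro mult_mono) (auto simp: nstep_nonneg z)
    also have "\<dots> \<le> (\<Sum>v\<in>E. nstep E P L z v * (hi f - f v))"
      by (rule member_le_sum) (auto simp: w z nstep_nonneg hi_ge intro!: mult_nonneg_nonneg)
    also have "\<dots> = hi f - (T ^^ L) f z"
      using nstep_sum[OF z, of L] nstep_trans_op[OF finite_E z, of P L f]
      by (simp add: algebra_simps sum_subtractf sum_distrib_left[symmetric])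
    finally show ?thesis by simp
  qed
  then have "hi ((T ^^ L) f) \<le> hi f - \<epsilon> * (hi f - lo f)" by (rule hi_le)
  with lo_funpow[of f L] show ?thesis by (simp add: algebra_simps)
qed

lemma oscillation_le: "hi ((T ^^ n) f) - lo ((T ^^ n) f) \<le> (1 - \<epsilon>) ^ (n div L) * (hi f - lo f)"
proof -
  have *: "hi ((T ^^ (L * m)) f) - lo ((T ^^ (L * m)) f) \<le> (1 - \<epsilon>) ^ m * (hi f - lo f)" for m
  proof (induction m)
    case (Suc m)
    have "hi ((T ^^ (L * Suc m)) f) - lo ((T ^^ (L * Suc m)) f)
        \<le> (1 - \<epsilon>) * (hi ((T ^^ (L * m)) f) - lo ((T ^^ (L * m)) f))"
      using oscillation_contracts[of "(T ^^ (L * m)) f"] by (simp add: funpow_add)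
    also have "\<dots> \<le> (1 - \<epsilon>) * ((1 - \<epsilon>) ^ m * (hi f - lo f))"
      using Suc eps_lt_1 by (intro mult_left_mono) auto
    finally show ?case by (simp add: mult.assoc)
  qed simp
  \<comment> \<open>Only full blocks contract; the \<open>n mod L\<close> leftover steps are applied
    last and cannot widen the range.\<close>
  have "(T ^^ n) f = (T ^^ (n mod L)) ((T ^^ (L * (n div L))) f)"
    by (metis comp_apply funpow_add mod_mult_div_eq)
  then show ?thesis
    using * [of "n div L"] hi_funpow[of "n mod L" "(T ^^ (L * (n div L))) f"]
      lo_funpow[of "(T ^^ (L * (n div L))) f" "n mod L"] by simp
qed

text \<open>The ranges of the iterates are nested intervals of geometrically shrinking length. Their
  common point \<open>l\<close> is the limit, which is why it does not depend on
  \<open>z\<close>.\<close>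

lemma geometric_convergence_exists:
  "\<exists>l C r. 0 < r \<and> r < 1 \<and> (\<forall>n. \<forall>z\<in>E. \<bar>(T ^^ n) f z - l\<bar> \<le> C * r ^ n)"
proof -
  obtain C r where r: "C \<ge> 0" "0 < r" "r < 1" "\<And>n. (1 - \<epsilon>) ^ (n div L) \<le> C * r ^ n"
    using power_div_le_geometric[of "1 - \<epsilon>" L] eps_pos eps_lt_1 L_pos by auto
  define C' where "C' = C * (hi f - lo f)"
  have bound: "hi ((T ^^ n) f) - lo ((T ^^ n) f) \<le> C' * r ^ n" for n
    using oscillation_le[of n f] mult_right_mono[OF r(4)[of n], of "hi f - lo f"] lo_le_hi[of f]
    by (simp add: C'_def algebra_simps)
  have "(\<lambda>n. lo ((T ^^ n) f) - hi ((T ^^ n) f)) \<longlonglongrightarrow> 0"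
    by (rule tendsto_zero_geometric_bound[OF _ r(2,3)])
      (use bound lo_le_hi in \<open>auto simp: abs_le_iff intro: order_trans\<close>)
  then obtain l where l: "\<And>n. lo ((T ^^ n) f) \<le> l" "\<And>n. l \<le> hi ((T ^^ n) f)"
    using nested_sequence_unique[of "\<lambda>n. lo ((T ^^ n) f)" "\<lambda>n. hi ((T ^^ n) f)"]
      lo_T hi_T lo_le_hi by auto
  have "\<bar>(T ^^ n) f z - l\<bar> \<le> C' * r ^ n" if "z \<in> E" for n z
    using bound[of n] l[of n] hi_ge[OF that, of "(T ^^ n) f"] lo_le[OF that, of "(T ^^ n) f"]
    by (simp add: abs_le_iff)
  then show ?thesis using r by blast
qed

section \<open>The stationary distribution and the Poisson equation\<close>

abbreviation "st \<equiv> stationary E P"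

definition mean :: "('a \<Rightarrow> real) \<Rightarrow> real" where
  "mean f = (\<Sum>z\<in>E. st z * f z)"

text \<open>Since \<open>stationary\<close> is a definite description, existence and uniqueness must
  precede any other fact about it. The limits of the n-step probabilities give an invariant
  \<open>p\<close>, because shifting the sequence of iterates by one step keeps its limit.
  Conversely, an invariant \<open>q\<close> satisfies \<open>q T^n f = q f\<close> for all
  \<open>n\<close>, and letting \<open>n\<close> grow forces \<open>q = p\<close>.\<close>

lemma stationary_invariant_and_limit:
  "invariant_dist E P st \<and> (\<forall>f. \<forall>z\<in>E. (\<lambda>n. (T ^^ n) f z) \<longlonglongrightarrow> mean f)"
proof -
  have "\<exists>l. \<forall>z\<in>E. (\<lambda>n. (T ^^ n) f z) \<longlonglongrightarrow> l" for f
  proof -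
    obtain l C r where r: "0 < r" "r < 1"
      and b: "\<And>n z. z \<in> E \<Longrightarrow> \<bar>(T ^^ n) f z - l\<bar> \<le> C * r ^ n"
      using geometric_convergence_exists by blast
    have "(\<lambda>n. (T ^^ n) f z - l) \<longlonglongrightarrow> 0" if "z \<in> E" for z
      by (rule tendsto_zero_geometric_bound[OF b[OF that] r])
    then show ?thesis using Lim_null by blast
  qed
  then obtain l where l: "\<And>f z. z \<in> E \<Longrightarrow> (\<lambda>n. (T ^^ n) f z) \<longlonglongrightarrow> l f" by metis
  obtain z0 where z0: "z0 \<in> E" using E_nonempty by auto
  define p where "p w = (if w \<in> E then l (\<lambda>v. of_bool (v = w)) else 0)" for w
  have nst: "nstep E P n z w = (T ^^ n) (\<lambda>v. of_bool (v = w)) z" if "z \<in> E" "w \<in> E" for n z w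
    using nstep_trans_op[OF finite_E that(1), of P n "\<lambda>v. of_bool (v = w)"] that(2)
    by (simp add: if_distrib cong: if_cong)
  have p: "(\<lambda>n. nstep E P n z w) \<longlonglongrightarrow> p w" if "z \<in> E" "w \<in> E" for z w
    using l[OF that(1), of "\<lambda>v. of_bool (v = w)"] that by (simp add: nst p_def)
  have pl: "(\<Sum>w\<in>E. p w * f w) = l f" for f
  proof (rule LIMSEQ_unique)
    show "(\<lambda>n. (T ^^ n) f z0) \<longlonglongrightarrow> (\<Sum>w\<in>E. p w * f w)"
      unfolding nstep_trans_op[OF finite_E z0, symmetric] by (intro tendsto_intros p z0)
  qed (rule l[OF z0])
  have lT: "l (T f) = l f" for f
  proof (rule LIMSEQ_unique)
    show "(\<lambda>n. (T ^^ Suc n) f z0) \<longlonglongrightarrow> l f" using l[OF z0, of f] by (rule LIMSEQ_Suc)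
    show "(\<lambda>n. (T ^^ Suc n) f z0) \<longlonglongrightarrow> l (T f)"
      using l[OF z0, of "T f"] by (simp add: funpow_swap1)
  qed
  have inv: "invariant_dist E P p"
    unfolding invariant_dist_def
  proof (intro conjI ballI allI impI)
    show "0 \<le> p z" if "z \<in> E" for z
      using p[OF z0 that] by (rule LIMSEQ_le_const) (auto simp: nstep_nonneg z0 that)
    show "p z = 0" if "z \<notin> E" for z using that by (simp add: p_def)
    have "(\<lambda>n. \<Sum>w\<in>E. nstep E P n z0 w) \<longlonglongrightarrow> (\<Sum>w\<in>E. p w)" by (intro tendsto_intros p z0)
    then show "(\<Sum>z\<in>E. p z) = 1" using z0 by (simp add: nstep_sum LIMSEQ_const_iff)
    fix w assume w: "w \<in> E"
    have "(\<Sum>z\<in>E. p z * P z w) = (\<Sum>z\<in>E. p z * T (\<lambda>v. of_bool (v = w)) z)"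
      using w by (simp add: trans_op_def if_distrib cong: if_cong)
    then show "(\<Sum>z\<in>E. p z * P z w) = p w" using w by (simp add: pl lT) (simp add: p_def)
  qed
  have uniq: "q = p" if q: "invariant_dist E P q" for q
  proof
    have qT: "(\<Sum>z\<in>E. q z * T f z) = (\<Sum>z\<in>E. q z * f z)" for f
    proof -
      have "(\<Sum>z\<in>E. q z * T f z) = (\<Sum>w\<in>E. (\<Sum>z\<in>E. q z * P z w) * f w)"
        by (simp add: trans_op_def sum_distrib_left sum_distrib_right mult.assoc) (rule sum.swap)
      then show ?thesis using q by (simp add: invariant_dist_def)
    qed
    have qTn: "(\<Sum>z\<in>E. q z * (T ^^ n) f z) = (\<Sum>z\<in>E. q z * f z)" for f n
      by (induction n) (simp_all add: qT)
    fix w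
    show "q w = p w"
    proof (cases "w \<in> E")
      case True
      let ?f = "\<lambda>v. of_bool (v = w) :: real"
      have "(\<lambda>n. \<Sum>z\<in>E. q z * (T ^^ n) ?f z) \<longlonglongrightarrow> (\<Sum>z\<in>E. q z * l ?f)"
        by (intro tendsto_intros l)
      then have "(\<Sum>z\<in>E. q z * ?f z) = (\<Sum>z\<in>E. q z) * l ?f"
        unfolding qTn by (simp add: LIMSEQ_const_iff sum_distrib_right)
      then show ?thesis
        using q True by (simp add: invariant_dist_def p_def if_distrib cong: if_cong)
    qed (use q in \<open>auto simp: invariant_dist_def p_def\<close>)
  qed
  have "st = p" unfolding stationary_def using inv uniq by (rule the_equality)
  then show ?thesis using inv l by (auto simp: mean_def pl)
qed

lemmas stationary_invariant = stationary_invariant_and_limit[THEN conjunct1]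

lemma funpow_T_LIMSEQ: "z \<in> E \<Longrightarrow> (\<lambda>n. (T ^^ n) f z) \<longlonglongrightarrow> mean f"
  using stationary_invariant_and_limit by blast

lemma geometric_convergence:
  "\<exists>C r. 0 < r \<and> r < 1 \<and> (\<forall>n. \<forall>z\<in>E. \<bar>(T ^^ n) f z - mean f\<bar> \<le> C * r ^ n)"
proof -
  obtain l C r where r: "0 < r" "r < 1"
    and b: "\<And>n z. z \<in> E \<Longrightarrow> \<bar>(T ^^ n) f z - l\<bar> \<le> C * r ^ n"
    using geometric_convergence_exists by blast
  obtain z where z: "z \<in> E" using E_nonempty by auto
  have "(\<lambda>n. (T ^^ n) f z - l) \<longlonglongrightarrow> 0"
    by (rule tendsto_zero_geometric_bound[OF b[OF z] r])
  then have "l = mean f" using funpow_T_LIMSEQ[OF z] Lim_null LIMSEQ_unique by blast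
  then show ?thesis using r b by blast
qed

text \<open>The solution is the series of the centred iterates, convergent by the geometric rate;
  applying \<open>T\<close> drops its first term.\<close>

lemma poisson_equation:
  "\<exists>V. \<forall>z\<in>E. V z - T V z = f z - mean f"
proof -
  obtain C r where r: "0 < r" "r < 1"
    and b: "\<And>n z. z \<in> E \<Longrightarrow> \<bar>(T ^^ n) f z - mean f\<bar> \<le> C * r ^ n"
    using geometric_convergence by blast
  define V where "V z = (\<Sum>n. (T ^^ n) f z - mean f)" for z
  have sm: "summable (\<lambda>n. (T ^^ n) f z - mean f)" if "z \<in> E" for z
    by (rule summable_comparison_test'[of "\<lambda>n. C * r ^ n"])
      (use r b that in \<open>auto intro!: summable_mult summable_geometric\<close>)
  have "V z - T V z = f z - mean f" if z: "z \<in> E" for z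
  proof -
    have "(\<lambda>n. \<Sum>w\<in>E. P z w * ((T ^^ n) f w - mean f)) sums (\<Sum>w\<in>E. P z w * V w)"
      unfolding V_def by (intro sums_sum sums_mult summable_sums sm)
    moreover have "(\<Sum>w\<in>E. P z w * ((T ^^ n) f w - mean f)) = (T ^^ Suc n) f z - mean f" for n
      using T_const[OF z, of "mean f"] by (simp add: trans_op_def algebra_simps sum_subtractf)
    ultimately have "T V z = (\<Sum>n. (T ^^ Suc n) f z - mean f)"
      by (simp add: trans_op_def sums_iff)
    moreover have "V z = (\<Sum>n. (T ^^ Suc n) f z - mean f) + (f z - mean f)"
      unfolding V_def by (subst suminf_split_head[OF sm[OF z]]) simp
    ultimately show ?thesis by simp
  qed
  then show ?thesis by blast
qed

text \<open>Subtracting the drift and a Poisson solution \<open>G\<close> for the limiting input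
  \<open>b'\<close> leaves a recursion driven only by the errors \<open>b n - b'\<close>. These are
  summable, and \<open>T\<close> does not increase the sup norm. This later turns derivatives at
  horizon \<open>N\<close> into a limit with error \<open>O(1/N)\<close>.\<close>

lemma forced_iteration_bound:
  assumes S0: "\<And>z. z \<in> E \<Longrightarrow> S 0 z = 0"
    and S_Suc: "\<And>n z. z \<in> E \<Longrightarrow> S (Suc n) z = T (S n) z + b n z"
    and b: "\<And>n z. z \<in> E \<Longrightarrow> \<bar>b n z - b' z\<bar> \<le> C * r ^ n" and r: "0 < r" "r < 1"
  shows "\<exists>B. \<forall>n. \<forall>z\<in>E. \<bar>S n z - real n * mean b'\<bar> \<le> B"
proof -
  obtain G where G: "\<And>z. z \<in> E \<Longrightarrow> G z - T G z = b' z - mean b'"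
    using poisson_equation by blast
  define D where "D n z = S n z - real n * mean b' - G z" for n z
  define A where "A = Max ((\<lambda>z. \<bar>G z\<bar>) ` E)"
  have A: "\<bar>G z\<bar> \<le> A" if "z \<in> E" for z using that by (simp add: A_def)
  obtain z0 where z0: "z0 \<in> E" using E_nonempty by auto
  have C: "C \<ge> 0" using b[OF z0, of 0] by simp
  have D_Suc: "D (Suc n) z = T (D n) z + (b n z - b' z)" if z: "z \<in> E" for n z
  proof -
    have "T (D n) z = T (S n) z - real n * mean b' - T G z"
      unfolding D_def trans_op_diff using z by (simp add: T_const)
    then show ?thesis using G[OF z] S_Suc[OF z, of n]
      unfolding D_def by (simp add: algebra_simps)
  qed
  have "\<bar>D n z\<bar> \<le> A + (\<Sum>k<n. C * r ^ k)" if "z \<in> E" for n z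
    using that
  proof (induction n arbitrary: z)
    case 0
    then show ?case using A S0 by (simp add: D_def)
  next
    case (Suc n)
    then show ?case
      using T_abs_le[of "D n" "A + (\<Sum>k<n. C * r ^ k)" z] b[of z n] by (simp add: D_Suc)
  qed
  moreover have "(\<Sum>k<n. C * r ^ k) \<le> C / (1 - r)" for n
  proof -
    have "(\<Sum>k<n. C * r ^ k) \<le> (\<Sum>k. C * r ^ k)"
      using r C by (intro sum_le_suminf summable_mult summable_geometric) auto
    also have "\<dots> = C / (1 - r)" using r by (simp add: suminf_mult suminf_geometric)
    finally show ?thesis .
  qed
  ultimately have D: "\<bar>D n z\<bar> \<le> A + C / (1 - r)" if "z \<in> E" for n z
    using that by (meson add_left_mono order_trans)
  have "\<bar>S n z - real n * mean b'\<bar> \<le> A + C / (1 - r) + A" if "z \<in> E" for n z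
    using D[OF that, of n] A[OF that] by (simp add: D_def abs_le_iff)
  then show ?thesis by blast
qed

end

section \<open>Finite Markov processes and convergence in probability\<close>

context prob_space
begin

lemma tendsto_zero_in_probD:
  assumes "tendsto_zero_in_prob M X"
  shows "X N \<in> borel_measurable M" "0 < \<epsilon> \<Longrightarrow> (\<lambda>N. prob {\<omega>\<in>space M. \<bar>X N \<omega>\<bar> > \<epsilon>}) \<longlonglongrightarrow> 0"
  using assms by (auto simp: tendsto_zero_in_prob_def)

lemma tendsto_zero_in_probI:
  assumes [measurable]: "\<And>N. X N \<in> borel_measurable M"
    and "\<And>\<epsilon> r. 0 < \<epsilon> \<Longrightarrow> 0 < r \<Longrightarrow> \<forall>\<^sub>F N in sequentially. prob {\<omega>\<in>space M. \<bar>X N \<omega>\<bar> > \<epsilon>} < r"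
  shows "tendsto_zero_in_prob M X"
  unfolding tendsto_zero_in_prob_def
  by (auto intro!: tendstoI assms simp: dist_real_def)

lemma tendsto_zero_in_prob_add:
  assumes X: "tendsto_zero_in_prob M X" and Y: "tendsto_zero_in_prob M Y"
  shows "tendsto_zero_in_prob M (\<lambda>N \<omega>. X N \<omega> + Y N \<omega>)"
proof (rule tendsto_zero_in_probI)
  note [measurable] = tendsto_zero_in_probD(1)[OF X] tendsto_zero_in_probD(1)[OF Y]
  show "(\<lambda>\<omega>. X N \<omega> + Y N \<omega>) \<in> borel_measurable M" for N by measurable
  fix \<epsilon> r :: real assume "0 < \<epsilon>" "0 < r"
  then have "(\<lambda>N. prob {\<omega>\<in>space M. \<bar>X N \<omega>\<bar> > \<epsilon>/2} + prob {\<omega>\<in>space M. \<bar>Y N \<omega>\<bar> > \<epsilon>/2}) \<longlonglongrightarrow> 0 + 0"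
    by (intro tendsto_add tendsto_zero_in_probD[OF X] tendsto_zero_in_probD[OF Y]) auto
  then have "\<forall>\<^sub>F N in sequentially.
      prob {\<omega>\<in>space M. \<bar>X N \<omega>\<bar> > \<epsilon>/2} + prob {\<omega>\<in>space M. \<bar>Y N \<omega>\<bar> > \<epsilon>/2} < r"
    using \<open>0 < r\<close> by (intro order_tendstoD(2)) auto
  then show "\<forall>\<^sub>F N in sequentially. prob {\<omega>\<in>space M. \<bar>X N \<omega> + Y N \<omega>\<bar> > \<epsilon>} < r"
  proof eventually_elim
    case (elim N)
    have "prob {\<omega>\<in>space M. \<bar>X N \<omega> + Y N \<omega>\<bar> > \<epsilon>}
        \<le> prob ({\<omega>\<in>space M. \<bar>X N \<omega>\<bar> > \<epsilon>/2} \<union> {\<omega>\<in>space M. \<bar>Y N \<omega>\<bar> > \<epsilon>/2})"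
      by (rule finite_measure_mono) auto
    also have "\<dots> \<le> prob {\<omega>\<in>space M. \<bar>X N \<omega>\<bar> > \<epsilon>/2} + prob {\<omega>\<in>space M. \<bar>Y N \<omega>\<bar> > \<epsilon>/2}"
      by (rule measure_Un_le) auto
    finally show ?case using elim by simp
  qed
qed

lemma tendsto_zero_in_prob_cong_AE:
  assumes X: "tendsto_zero_in_prob M X" and Y: "\<And>N. Y N \<in> borel_measurable M"
    and eq: "\<And>N. AE \<omega> in M. Y N \<omega> = X N \<omega>"
  shows "tendsto_zero_in_prob M Y"
  unfolding tendsto_zero_in_prob_def
proof (intro conjI allI impI Y)
  note [measurable] = tendsto_zero_in_probD(1)[OF X] Y
  fix \<epsilon> :: real assume "\<epsilon> > 0"
  have "prob {\<omega>\<in>space M. \<bar>Y N \<omega>\<bar> > \<epsilon>} = prob {\<omega>\<in>space M. \<bar>X N \<omega>\<bar> > \<epsilon>}" for N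
    using eq[of N] by (intro prob_eq_AE) auto
  then show "(\<lambda>N. prob {\<omega>\<in>space M. \<bar>Y N \<omega>\<bar> > \<epsilon>}) \<longlonglongrightarrow> 0"
    using tendsto_zero_in_probD(2)[OF X \<open>\<epsilon> > 0\<close>] by simp
qed

lemma tendsto_zero_in_prob_AE:
  assumes [measurable]: "\<And>N. X N \<in> borel_measurable M" and "AE \<omega> in M. (\<lambda>N. X N \<omega>) \<longlonglongrightarrow> 0"
  shows "tendsto_zero_in_prob M X"
  unfolding tendsto_zero_in_prob_def
proof (intro conjI allI impI assms(1))
  fix \<epsilon> :: real assume "\<epsilon> > 0"
  have "(\<lambda>N. expectation (indicator {\<omega>\<in>space M. \<bar>X N \<omega>\<bar> > \<epsilon>} :: 'a \<Rightarrow> real)) \<longlonglongrightarrow>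
      expectation (\<lambda>_. 0 :: real)"
  proof (rule integral_dominated_convergence[where w = "\<lambda>_. 1"])
    show "AE \<omega> in M. (\<lambda>N. indicator {\<omega>\<in>space M. \<bar>X N \<omega>\<bar> > \<epsilon>} \<omega> :: real) \<longlonglongrightarrow> 0"
      using assms(2)
    proof eventually_elim
      case (elim \<omega>)
      then have "\<forall>\<^sub>F N in sequentially. \<bar>X N \<omega>\<bar> < \<epsilon>"
        using \<open>\<epsilon> > 0\<close> by (intro order_tendstoD(2)[OF tendsto_rabs_zero])
      then show ?case
        by (intro tendsto_eventually) (auto elim!: eventually_mono simp: indicator_def)
    qed
  qed (auto simp: indicator_def)
  then show "(\<lambda>N. prob {\<omega>\<in>space M. \<bar>X N \<omega>\<bar> > \<epsilon>}) \<longlonglongrightarrow> 0" by simp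
qed

lemma tendsto_zero_in_prob_const: "a \<longlonglongrightarrow> 0 \<Longrightarrow> tendsto_zero_in_prob M (\<lambda>N _. a N)"
  by (rule tendsto_zero_in_prob_AE) auto

lemma prob_abs_gt_le:
  assumes "integrable M W" "X \<in> borel_measurable M" "AE \<omega> in M. \<bar>X \<omega>\<bar> \<le> W \<omega>" "\<epsilon> > 0"
  shows "prob {\<omega>\<in>space M. \<bar>X \<omega>\<bar> > \<epsilon>} \<le> expectation W / \<epsilon>"
proof -
  note [measurable] = assms(2) borel_measurable_integrable[OF assms(1)]
  have W: "AE \<omega> in M. 0 \<le> W \<omega>" using assms(3) by eventually_elim auto
  have "prob {\<omega>\<in>space M. \<bar>X \<omega>\<bar> > \<epsilon>} \<le> prob {\<omega>\<in>space M. \<epsilon> \<le> W \<omega>}"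
    by (rule finite_measure_mono_AE) (use assms(3) in auto)
  also have "\<dots> \<le> expectation W / \<epsilon>"
    using integral_Markov_inequality_measure[OF assms(1), of "{}" \<epsilon>] W assms(4) by simp
  finally show ?thesis .
qed

lemma tendsto_zero_in_prob_L1:
  assumes "\<And>N. X N \<in> borel_measurable M" "\<And>N. integrable M (W N)"
    and "\<And>N. AE \<omega> in M. \<bar>X N \<omega>\<bar> \<le> W N \<omega>" and W: "(\<lambda>N. expectation (W N)) \<longlonglongrightarrow> 0"
  shows "tendsto_zero_in_prob M X"
  unfolding tendsto_zero_in_prob_def
proof (intro conjI allI impI assms(1))
  fix \<epsilon> :: real assume "\<epsilon> > 0"
  show "(\<lambda>N. prob {\<omega>\<in>space M. \<bar>X N \<omega>\<bar> > \<epsilon>}) \<longlonglongrightarrow> 0"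
  proof (rule tendsto_sandwich[OF _ _ tendsto_const])
    show "(\<lambda>N. expectation (W N) / \<epsilon>) \<longlonglongrightarrow> 0" using W by (rule tendsto_divide_zero)
    show "\<forall>\<^sub>F N in sequentially. prob {\<omega>\<in>space M. \<bar>X N \<omega>\<bar> > \<epsilon>} \<le> expectation (W N) / \<epsilon>"
      by (intro always_eventually allI prob_abs_gt_le assms \<open>\<epsilon> > 0\<close>)
  qed simp
qed

lemma tendsto_zero_in_prob_L2:
  assumes [measurable]: "\<And>N. X N \<in> borel_measurable M" and "\<And>N. integrable M (\<lambda>\<omega>. (X N \<omega>)\<^sup>2)"
    and "(\<lambda>N. expectation (\<lambda>\<omega>. (X N \<omega>)\<^sup>2)) \<longlonglongrightarrow> 0"
  shows "tendsto_zero_in_prob M X"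
proof -
  have sq: "tendsto_zero_in_prob M (\<lambda>N \<omega>. (X N \<omega>)\<^sup>2)"
    by (rule tendsto_zero_in_prob_L1[where W = "\<lambda>N \<omega>. (X N \<omega>)\<^sup>2"]) (use assms in auto)
  show ?thesis
    unfolding tendsto_zero_in_prob_def
  proof (intro conjI allI impI assms(1))
    fix \<epsilon> :: real assume "\<epsilon> > 0"
    then have "\<bar>x\<^sup>2\<bar> > \<epsilon>\<^sup>2 \<longleftrightarrow> \<bar>x\<bar> > \<epsilon>" for x :: real
      using abs_le_square_iff[of x \<epsilon>] by (auto simp: not_less[symmetric])
    with tendsto_zero_in_probD(2)[OF sq, of "\<epsilon>\<^sup>2"] \<open>\<epsilon> > 0\<close>
    show "(\<lambda>N. prob {\<omega>\<in>space M. \<bar>X N \<omega>\<bar> > \<epsilon>}) \<longlonglongrightarrow> 0" by simp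
  qed
qed

lemma tendsto_zero_in_prob_mult_L1_bounded:
  assumes X: "tendsto_zero_in_prob M X" and W: "\<And>N. integrable M (W N)"
    and B: "\<And>N. expectation (\<lambda>\<omega>. \<bar>W N \<omega>\<bar>) \<le> B"
  shows "tendsto_zero_in_prob M (\<lambda>N \<omega>. X N \<omega> * W N \<omega>)"
proof (rule tendsto_zero_in_probI)
  note [measurable] = tendsto_zero_in_probD(1)[OF X] borel_measurable_integrable[OF W]
  show "(\<lambda>\<omega>. X N \<omega> * W N \<omega>) \<in> borel_measurable M" for N by measurable
  fix \<epsilon> r :: real assume "0 < \<epsilon>" "0 < r"
  \<comment> \<open>Chosen so that Markov's inequality bounds the probability of a large
    \<open>W N\<close> by \<open>\<bar>B\<bar> \<eta> / \<epsilon>\<close>, which is at most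
    \<open>r / 2\<close>; the summand 1 guards against \<open>B = 0\<close>.\<close>
  define \<eta> where "\<eta> = \<epsilon> * r / (2 * (\<bar>B\<bar> + 1))"
  have \<eta>: "\<eta> > 0" using \<open>0 < \<epsilon>\<close> \<open>0 < r\<close> by (simp add: \<eta>_def)
  have "\<forall>\<^sub>F N in sequentially. prob {\<omega>\<in>space M. \<bar>X N \<omega>\<bar> > \<eta>} < r / 2"
    using \<open>0 < r\<close> by (intro order_tendstoD(2)[OF tendsto_zero_in_probD(2)[OF X \<eta>]]) auto
  then show "\<forall>\<^sub>F N in sequentially. prob {\<omega>\<in>space M. \<bar>X N \<omega> * W N \<omega>\<bar> > \<epsilon>} < r"
  proof eventually_elim
    case (elim N)
    have "prob {\<omega>\<in>space M. \<bar>X N \<omega> * W N \<omega>\<bar> > \<epsilon>}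
        \<le> prob ({\<omega>\<in>space M. \<bar>X N \<omega>\<bar> > \<eta>} \<union> {\<omega>\<in>space M. \<bar>W N \<omega>\<bar> > \<epsilon> / \<eta>})"
    proof (rule finite_measure_mono)
      have "\<bar>x * w\<bar> \<le> \<epsilon>" if "\<bar>x\<bar> \<le> \<eta>" "\<bar>w\<bar> \<le> \<epsilon> / \<eta>" for x w :: real
        using mult_mono[OF that] \<eta> by (simp add: abs_mult)
      then show "{\<omega> \<in> space M. \<epsilon> < \<bar>X N \<omega> * W N \<omega>\<bar>}
          \<subseteq> {\<omega> \<in> space M. \<eta> < \<bar>X N \<omega>\<bar>} \<union> {\<omega> \<in> space M. \<epsilon> / \<eta> < \<bar>W N \<omega>\<bar>}"
        by (force simp: not_less[symmetric])
    qed auto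
    also have "\<dots> \<le> prob {\<omega>\<in>space M. \<bar>X N \<omega>\<bar> > \<eta>} + prob {\<omega>\<in>space M. \<bar>W N \<omega>\<bar> > \<epsilon> / \<eta>}"
      by (rule measure_Un_le) auto
    also have "prob {\<omega>\<in>space M. \<bar>W N \<omega>\<bar> > \<epsilon> / \<eta>} \<le> expectation (\<lambda>\<omega>. \<bar>W N \<omega>\<bar>) / (\<epsilon> / \<eta>)"
      by (rule prob_abs_gt_le) (use W \<eta> \<open>0 < \<epsilon>\<close> in auto)
    also have "\<dots> \<le> \<bar>B\<bar> / (\<epsilon> / \<eta>)"
      using B[of N] \<eta> \<open>0 < \<epsilon>\<close> by (intro divide_right_mono) auto
    also have "\<dots> = \<bar>B\<bar> * (\<eta> / \<epsilon>)" by simp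
    also have "\<eta> / \<epsilon> = r / (2 * (\<bar>B\<bar> + 1))" using \<open>0 < \<epsilon>\<close> by (simp add: \<eta>_def)
    also have "\<bar>B\<bar> * (r / (2 * (\<bar>B\<bar> + 1))) = \<bar>B\<bar> * r / (2 * (\<bar>B\<bar> + 1))" by simp
    also have "\<dots> \<le> r / 2" using \<open>0 < r\<close> by (simp add: divide_simps)
    finally show ?case using elim by simp
  qed
qed

end

section \<open>Finite Markov processes and martingale transforms\<close>

locale finite_markov_process = prob_space M + stochastic_matrix E Q
  for M :: "'w measure" and E :: "'e set" and Q +
  fixes Y :: "nat \<Rightarrow> 'w \<Rightarrow> 'e"
  assumes Y_measurable: "\<And>n. Y n \<in> M \<rightarrow>\<^sub>M count_space E"
    and markov: "\<And>n h y. y \<in> E \<Longrightarrow>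
      prob {\<omega>\<in>space M. (\<forall>m\<le>n. Y m \<omega> = h m) \<and> Y (Suc n) \<omega> = y} =
      prob {\<omega>\<in>space M. \<forall>m\<le>n. Y m \<omega> = h m} * Q (h n) y"
begin

lemma Y_in_E: "\<omega> \<in> space M \<Longrightarrow> Y n \<omega> \<in> E"
  using measurable_space[OF Y_measurable] by simp

lemma measurable_of_Y [measurable]: "(\<lambda>\<omega>. g (Y n \<omega>)) \<in> borel_measurable M"
  for g :: "'e \<Rightarrow> real"
  by (rule measurable_compose[OF Y_measurable]) simp

lemma pred_of_Y [measurable]: "Measurable.pred M (\<lambda>\<omega>. R (Y n \<omega>))"
  by (rule measurable_compose[OF Y_measurable]) simp

text \<open>Dependence on the path up to time \<open>n\<close> is stated pointwise instead of
  through a filtration. As there are only finitely many histories of length \<open>n\<close>, it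
  entails measurability, boundedness and integrability.\<close>

definition adapted :: "nat \<Rightarrow> ('w \<Rightarrow> real) \<Rightarrow> bool" where
  "adapted n X \<longleftrightarrow> (\<forall>\<omega>\<in>space M. \<forall>\<omega>'\<in>space M. (\<forall>m\<le>n. Y m \<omega> = Y m \<omega>') \<longrightarrow> X \<omega> = X \<omega>')"

lemma adaptedI:
  "(\<And>\<omega> \<omega>'. \<omega> \<in> space M \<Longrightarrow> \<omega>' \<in> space M \<Longrightarrow> (\<And>m. m \<le> n \<Longrightarrow> Y m \<omega> = Y m \<omega>') \<Longrightarrow> X \<omega> = X \<omega>')
    \<Longrightarrow> adapted n X"
  unfolding adapted_def by blast

lemma adaptedD:
  "adapted n X \<Longrightarrow> \<omega> \<in> space M \<Longrightarrow> \<omega>' \<in> space M \<Longrightarrow> (\<And>m. m \<le> n \<Longrightarrow> Y m \<omega> = Y m \<omega>') \<Longrightarrow> X \<omega> = X \<omega>'"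
  unfolding adapted_def by blast

lemma adapted_mono: "adapted m X \<Longrightarrow> m \<le> n \<Longrightarrow> adapted n X"
  unfolding adapted_def by (meson le_trans)

lemma adapted_mult: "adapted n X \<Longrightarrow> adapted n X' \<Longrightarrow> adapted n (\<lambda>\<omega>. X \<omega> * X' \<omega>)"
  unfolding adapted_def by (intro ballI impI arg_cong2[of _ _ _ _ "(*)"]) blast+

lemma adapted_diff: "adapted n X \<Longrightarrow> adapted n X' \<Longrightarrow> adapted n (\<lambda>\<omega>. X \<omega> - X' \<omega>)"
  unfolding adapted_def by (intro ballI impI arg_cong2[of _ _ _ _ "(-)"]) blast+

lemma adapted_const: "adapted n (\<lambda>_. a)"
  by (simp add: adapted_def)

lemma adapted_sum: "(\<And>i. i \<in> I \<Longrightarrow> adapted n (X i)) \<Longrightarrow> adapted n (\<lambda>\<omega>. \<Sum>i\<in>I. X i \<omega>)"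
  by (rule adaptedI, rule sum.cong) (auto intro: adaptedD)

lemma adapted_of_Y: "m \<le> n \<Longrightarrow> adapted n (\<lambda>\<omega>. g (Y m \<omega>))"
  by (rule adaptedI) (rule arg_cong[of _ _ g], blast)

lemma adapted_of_Y2: "m \<le> n \<Longrightarrow> k \<le> n \<Longrightarrow> adapted n (\<lambda>\<omega>. g (Y m \<omega>) (Y k \<omega>))"
  by (rule adaptedI) (rule arg_cong2[of _ _ _ _ g], blast+)

definition histories :: "nat \<Rightarrow> (nat \<Rightarrow> 'e) set" where
  "histories n = (\<Pi>\<^sub>E m\<in>{..n}. E)"

lemma finite_histories [simp]: "finite (histories n)"
  by (auto simp: histories_def intro: finite_PiE)

lemma events_history [measurable]: "{\<omega>\<in>space M. \<forall>m\<le>n. Y m \<omega> = h m} \<in> events"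
proof -
  have "Measurable.pred M (\<lambda>\<omega>. Y m \<omega> = h m)" for m by (rule pred_of_Y)
  then show ?thesis by measurable
qed

lemma events_history_Suc [measurable]:
  "{\<omega>\<in>space M. (\<forall>m\<le>n. Y m \<omega> = h m) \<and> Y (Suc n) \<omega> = y} \<in> events"
proof -
  have "Measurable.pred M (\<lambda>\<omega>. Y m \<omega> = z)" for m z by (rule pred_of_Y)
  then show ?thesis by measurable
qed

lemma integrable_history:
  "integrable M (indicator {\<omega>\<in>space M. \<forall>m\<le>n. Y m \<omega> = h m} :: 'w \<Rightarrow> real)"
  "integrable M (indicator {\<omega>\<in>space M. (\<forall>m\<le>n. Y m \<omega> = h m) \<and> Y (Suc n) \<omega> = y} :: 'w \<Rightarrow> real)"
  by (rule integrable_real_indicator; simp add: events_history events_history_Suc less_top[symmetric])+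

lemma adapted_expand:
  assumes "adapted n X"
  obtains x where "\<And>\<omega>. \<omega> \<in> space M \<Longrightarrow>
    X \<omega> = (\<Sum>h\<in>histories n. x h * indicator {\<omega>\<in>space M. \<forall>m\<le>n. Y m \<omega> = h m} \<omega>)"
proof -
  \<comment> \<open>Any path with history \<open>h\<close> serves as representative, by adaptedness.
    If no path has this history, the arbitrary value is multiplied by a vanishing indicator.\<close>
  define x where "x h = X (SOME \<omega>. \<omega> \<in> space M \<and> (\<forall>m\<le>n. Y m \<omega> = h m))" for h
  have "X \<omega> = (\<Sum>h\<in>histories n. x h * indicator {\<omega>\<in>space M. \<forall>m\<le>n. Y m \<omega> = h m} \<omega>)"
    if \<omega>: "\<omega> \<in> space M" for \<omega>
  proof -
    define h0 where "h0 = restrict (\<lambda>m. Y m \<omega>) {..n}"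
    have h0: "h0 \<in> histories n" using Y_in_E[OF \<omega>] by (auto simp: h0_def histories_def)
    have "(\<forall>m\<le>n. Y m \<omega> = h m) \<longleftrightarrow> h = h0" if "h \<in> histories n" for h
      using that by (auto simp: h0_def histories_def PiE_iff extensional_def fun_eq_iff)
    then have "(\<Sum>h\<in>histories n. x h * indicator {\<omega>\<in>space M. \<forall>m\<le>n. Y m \<omega> = h m} \<omega>) =
        (\<Sum>h\<in>histories n. if h = h0 then x h else 0)"
      using \<omega> by (intro sum.cong) (auto simp: indicator_def)
    also have "\<dots> = x h0" using h0 by simp
    also have "\<dots> = X \<omega>"
    proof -
      have "\<omega> \<in> space M \<and> (\<forall>m\<le>n. Y m \<omega> = h0 m)" using \<omega> by (simp add: h0_def)
      from someI[of "\<lambda>\<omega>. \<omega> \<in> space M \<and> (\<forall>m\<le>n. Y m \<omega> = h0 m)", OF this]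
      show ?thesis unfolding x_def
        by (intro adaptedD[OF assms]) (use \<omega> in \<open>auto simp: h0_def\<close>)
    qed
    finally show ?thesis by simp
  qed
  then show ?thesis by (rule that)
qed

lemma adapted_integrable:
  assumes "adapted n X"
  shows "integrable M X"
proof -
  obtain x where x: "\<And>\<omega>. \<omega> \<in> space M \<Longrightarrow>
      X \<omega> = (\<Sum>h\<in>histories n. x h * indicator {\<omega>\<in>space M. \<forall>m\<le>n. Y m \<omega> = h m} \<omega>)"
    using adapted_expand[OF assms] by blast
  have "integrable M (\<lambda>\<omega>. \<Sum>h\<in>histories n. x h * indicator {\<omega>\<in>space M. \<forall>m\<le>n. Y m \<omega> = h m} \<omega>)"
    by (intro Bochner_Integration.integrable_sum integrable_mult_right integrable_history)
  moreover have "integrable M X \<longleftrightarrow>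
      integrable M (\<lambda>\<omega>. \<Sum>h\<in>histories n. x h * indicator {\<omega>\<in>space M. \<forall>m\<le>n. Y m \<omega> = h m} \<omega>)"
    by (rule Bochner_Integration.integrable_cong[OF refl]) (erule x)
  ultimately show ?thesis by simp
qed

lemma expectation_step:
  assumes "adapted n X"
  shows "expectation (\<lambda>\<omega>. X \<omega> * g (Y (Suc n) \<omega>)) = expectation (\<lambda>\<omega>. X \<omega> * T g (Y n \<omega>))"
proof -
  obtain x where x: "\<And>\<omega>. \<omega> \<in> space M \<Longrightarrow>
      X \<omega> = (\<Sum>h\<in>histories n. x h * indicator {\<omega>\<in>space M. \<forall>m\<le>n. Y m \<omega> = h m} \<omega>)"
    using adapted_expand[OF assms] by blast
  have 1: "g (Y (Suc n) \<omega>) = (\<Sum>y\<in>E. g y * indicator {\<omega>\<in>space M. Y (Suc n) \<omega> = y} \<omega>)"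
    if "\<omega> \<in> space M" for \<omega>
    using that Y_in_E[OF that] by (simp add: indicator_def if_distrib cong: if_cong)
  have "expectation (\<lambda>\<omega>. X \<omega> * g (Y (Suc n) \<omega>)) =
      expectation (\<lambda>\<omega>. \<Sum>h\<in>histories n. \<Sum>y\<in>E. (x h * g y) *
        indicator {\<omega>\<in>space M. (\<forall>m\<le>n. Y m \<omega> = h m) \<and> Y (Suc n) \<omega> = y} \<omega>)"
  proof (rule Bochner_Integration.integral_cong[OF refl])
    fix \<omega> assume \<omega>: "\<omega> \<in> space M"
    show "X \<omega> * g (Y (Suc n) \<omega>) = (\<Sum>h\<in>histories n. \<Sum>y\<in>E. (x h * g y) *
        indicator {\<omega>\<in>space M. (\<forall>m\<le>n. Y m \<omega> = h m) \<and> Y (Suc n) \<omega> = y} \<omega>)"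
      unfolding x[OF \<omega>] 1[OF \<omega>] sum_product
      by (intro sum.cong) (auto simp: indicator_def)
  qed
  also have "\<dots> = (\<Sum>h\<in>histories n. \<Sum>y\<in>E. (x h * g y) *
        prob {\<omega>\<in>space M. (\<forall>m\<le>n. Y m \<omega> = h m) \<and> Y (Suc n) \<omega> = y})"
    by (simp add: Bochner_Integration.integral_sum integrable_history del: sum_mult_indicator
          sum_indicator_mult)
  also have "\<dots> = (\<Sum>h\<in>histories n. x h * T g (h n) * prob {\<omega>\<in>space M. \<forall>m\<le>n. Y m \<omega> = h m})"
    by (intro sum.cong refl) (simp add: markov trans_op_def sum_distrib_left sum_distrib_right mult_ac)
  also have "\<dots> = expectation (\<lambda>\<omega>. \<Sum>h\<in>histories n. x h * T g (h n) *
        indicator {\<omega>\<in>space M. \<forall>m\<le>n. Y m \<omega> = h m} \<omega>)"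
    by (simp add: Bochner_Integration.integral_sum integrable_history del: sum_mult_indicator
          sum_indicator_mult)
  also have "\<dots> = expectation (\<lambda>\<omega>. X \<omega> * T g (Y n \<omega>))"
  proof (rule Bochner_Integration.integral_cong[OF refl])
    fix \<omega> assume \<omega>: "\<omega> \<in> space M"
    show "(\<Sum>h\<in>histories n. x h * T g (h n) * indicator {\<omega>\<in>space M. \<forall>m\<le>n. Y m \<omega> = h m} \<omega>) =
        X \<omega> * T g (Y n \<omega>)"
      unfolding x[OF \<omega>] sum_distrib_right by (intro sum.cong) (auto simp: indicator_def)
  qed
  finally show ?thesis .
qed

lemma expectation_steps:
  assumes "adapted n X"
  shows "expectation (\<lambda>\<omega>. X \<omega> * g (Y (n + k) \<omega>)) = expectation (\<lambda>\<omega>. X \<omega> * (T ^^ k) g (Y n \<omega>))"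
proof (induction k arbitrary: g)
  case (Suc k)
  have "adapted (n + k) X" using assms by (rule adapted_mono) simp
  then show ?case using Suc[of "T g"] by (simp add: expectation_step funpow_swap1)
qed simp

text \<open>Orthogonality of increments: the cross term vanishes because the earlier sum times
  \<open>X N\<close> is known at time \<open>N\<close> while the new increment has conditional mean
  zero. Each square adds at most \<open>4 G\<^sup>2 B\<close>, since an increment is at most
  \<open>2 G\<close> in absolute value.\<close>

lemma martingale_transform_L2:
  assumes X: "\<And>n. adapted n (X n)" and B: "\<And>n. expectation (\<lambda>\<omega>. (X n \<omega>)\<^sup>2) \<le> B"
    and G: "\<And>y. y \<in> E \<Longrightarrow> \<bar>g y\<bar> \<le> G"
  shows "expectation (\<lambda>\<omega>. (\<Sum>r<N. X r \<omega> * (g (Y (Suc r) \<omega>) - T g (Y r \<omega>)))\<^sup>2)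
    \<le> real N * (4 * G\<^sup>2 * B)"
proof (induction N)
  case (Suc N)
  define S where "S \<omega> = (\<Sum>r<N. X r \<omega> * (g (Y (Suc r) \<omega>) - T g (Y r \<omega>)))" for \<omega>
  define D where "D \<omega> = g (Y (Suc N) \<omega>) - T g (Y N \<omega>)" for \<omega>
  have D: "adapted (Suc N) D" unfolding D_def by (intro adapted_diff adapted_of_Y) auto
  have S: "adapted N S" unfolding S_def
    by (intro adapted_sum adapted_mult adapted_diff adapted_of_Y adapted_mono[OF X]) auto
  note SX = adapted_mult[OF S X[of N]] and S' = adapted_mono[OF S, of "Suc N"]
    and X' = adapted_mono[OF X[of N], of "Suc N"]
  have int: "integrable M (\<lambda>\<omega>. (S \<omega>)\<^sup>2)" "integrable M (\<lambda>\<omega>. 2 * (S \<omega> * X N \<omega> * D \<omega>))"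
      "integrable M (\<lambda>\<omega>. (X N \<omega>)\<^sup>2 * (D \<omega>)\<^sup>2)" "integrable M (\<lambda>\<omega>. (X N \<omega>)\<^sup>2)"
    by (rule adapted_integrable[of "Suc N"],
        simp add: power2_eq_square S' X' D adapted_mult adapted_const)+
  have "\<bar>D \<omega>\<bar> \<le> 2 * G" if "\<omega> \<in> space M" for \<omega>
  proof -
    have "\<bar>T g (Y N \<omega>)\<bar> \<le> G" by (rule T_abs_le) (use G Y_in_E that in auto)
    then show ?thesis using G[OF Y_in_E[OF that, of "Suc N"]] by (simp add: D_def abs_le_iff)
  qed
  then have D2: "(D \<omega>)\<^sup>2 \<le> 4 * G\<^sup>2" if "\<omega> \<in> space M" for \<omega>
    using that power_mono[of "\<bar>D \<omega>\<bar>" "2 * G" 2] by (simp add: power_mult_distrib)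
  have "expectation (\<lambda>\<omega>. (\<Sum>r<Suc N. X r \<omega> * (g (Y (Suc r) \<omega>) - T g (Y r \<omega>)))\<^sup>2) =
      expectation (\<lambda>\<omega>. (S \<omega>)\<^sup>2 + 2 * (S \<omega> * X N \<omega> * D \<omega>) + (X N \<omega>)\<^sup>2 * (D \<omega>)\<^sup>2)"
    by (simp add: S_def D_def power2_eq_square algebra_simps)
  also have "\<dots> = expectation (\<lambda>\<omega>. (S \<omega>)\<^sup>2) + expectation (\<lambda>\<omega>. 2 * (S \<omega> * X N \<omega> * D \<omega>)) +
      expectation (\<lambda>\<omega>. (X N \<omega>)\<^sup>2 * (D \<omega>)\<^sup>2)"
    using int by simp
  also have "expectation (\<lambda>\<omega>. 2 * (S \<omega> * X N \<omega> * D \<omega>)) = 0"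
  proof -
    have "expectation (\<lambda>\<omega>. S \<omega> * X N \<omega> * D \<omega>) =
        expectation (\<lambda>\<omega>. S \<omega> * X N \<omega> * g (Y (Suc N) \<omega>) - S \<omega> * X N \<omega> * T g (Y N \<omega>))"
      by (simp add: D_def algebra_simps)
    also have "\<dots> = 0"
      by (subst Bochner_Integration.integral_diff)
        (auto simp: expectation_step[OF SX] S' X'
          intro!: adapted_integrable[of "Suc N"] adapted_mult adapted_of_Y)
    finally show ?thesis by simp
  qed
  also have "expectation (\<lambda>\<omega>. (X N \<omega>)\<^sup>2 * (D \<omega>)\<^sup>2) \<le> expectation (\<lambda>\<omega>. (X N \<omega>)\<^sup>2 * (4 * G\<^sup>2))"
    using int D2 by (intro integral_mono) (auto intro: mult_left_mono)
  also have "\<dots> \<le> B * (4 * G\<^sup>2)" using B[of N] by (simp add: mult_right_mono)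
  finally show ?case using Suc by (simp add: S_def algebra_simps)
qed simp

end

section \<open>Chains with random targets\<close>

lemma finite_abs_bounded:
  fixes f :: "'e \<Rightarrow> real"
  assumes "finite E"
  obtains B where "B \<ge> 0" "\<And>z. z \<in> E \<Longrightarrow> \<bar>f z\<bar> \<le> B"
proof
  show "0 \<le> Max (insert 0 ((\<lambda>z. \<bar>f z\<bar>) ` E))" using assms by auto
  show "\<bar>f z\<bar> \<le> Max (insert 0 ((\<lambda>z. \<bar>f z\<bar>) ` E))" if "z \<in> E" for z
    using assms that by (intro Max_ge) auto
qed

lemma sum_power_reverse_le:
  fixes s :: real
  assumes "0 \<le> s" "s < 1"
  shows "(\<Sum>k=1..N. s ^ (N - k)) \<le> 1 / (1 - s)"
proof -
  have "(\<Sum>k=1..N. s ^ (N - k)) = (\<Sum>j<N. s ^ j)"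
    by (rule sum.reindex_bij_witness[of _ "\<lambda>j. N - j" "\<lambda>k. N - k"]) auto
  also have "\<dots> \<le> (\<Sum>j. s ^ j)"
    using assms by (intro sum_le_suminf summable_geometric) auto
  also have "\<dots> = 1 / (1 - s)" using assms by (simp add: suminf_geometric)
  finally show ?thesis .
qed

lemma measurable_random_sum:
  fixes \<phi> :: "nat \<Rightarrow> 'w \<Rightarrow> real"
  assumes h: "h \<in> M \<rightarrow>\<^sub>M count_space (UNIV :: nat set)"
    and \<phi>: "\<And>r. \<phi> r \<in> borel_measurable M"
  shows "(\<lambda>\<omega>. \<Sum>r\<in>I (h \<omega>). \<phi> r \<omega>) \<in> borel_measurable M"
  by (rule measurable_compose_countable[OF _ h, of "\<lambda>n \<omega>. \<Sum>r\<in>I n. \<phi> r \<omega>"])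
    (intro borel_measurable_sum \<phi>)

context prob_space
begin

lemma tendsto_zero_in_prob_average_L2:
  assumes "\<And>N. S N \<in> borel_measurable M" "\<And>N. integrable M (\<lambda>\<omega>. (S N \<omega>)\<^sup>2)"
    and B: "\<And>N. expectation (\<lambda>\<omega>. (S N \<omega>)\<^sup>2) \<le> real N * B"
  shows "tendsto_zero_in_prob M (\<lambda>N \<omega>. S N \<omega> / real N)"
proof (rule tendsto_zero_in_prob_L2)
  show "(\<lambda>\<omega>. S N \<omega> / real N) \<in> borel_measurable M" for N
    using assms(1)[of N] by measurable
  show "integrable M (\<lambda>\<omega>. (S N \<omega> / real N)\<^sup>2)" for N
    using assms(2)[of N] by (simp add: power_divide)
  show "(\<lambda>N. expectation (\<lambda>\<omega>. (S N \<omega> / real N)\<^sup>2)) \<longlonglongrightarrow> 0"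
  proof (rule tendsto_sandwich[OF _ _ tendsto_const])
    show "(\<lambda>N. B / real N) \<longlonglongrightarrow> 0" by (rule lim_const_over_n)
    show "\<forall>\<^sub>F N in sequentially. expectation (\<lambda>\<omega>. (S N \<omega> / real N)\<^sup>2) \<le> B / real N"
    proof (intro always_eventually allI)
      fix N
      show "expectation (\<lambda>\<omega>. (S N \<omega> / real N)\<^sup>2) \<le> B / real N"
        using B[of N] by (cases "N = 0") (auto simp: power_divide power2_eq_square field_simps)
    qed
  qed simp
qed

lemma tendsto_zero_in_prob_average_L1:
  assumes "\<And>N. S N \<in> borel_measurable M" "\<And>N. integrable M (W N)"
    and "\<And>N. AE \<omega> in M. \<bar>S N \<omega>\<bar> \<le> W N \<omega>" and B: "\<And>N. expectation (W N) \<le> B"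
  shows "tendsto_zero_in_prob M (\<lambda>N \<omega>. S N \<omega> / real N)"
proof (rule tendsto_zero_in_prob_L1[where W = "\<lambda>N \<omega>. W N \<omega> / real N"])
  show "(\<lambda>\<omega>. S N \<omega> / real N) \<in> borel_measurable M" for N
    using assms(1)[of N] by measurable
  show "integrable M (\<lambda>\<omega>. W N \<omega> / real N)" for N using assms(2)[of N] by simp
  show "AE \<omega> in M. \<bar>S N \<omega> / real N\<bar> \<le> W N \<omega> / real N" for N
    using assms(3)[of N] by eventually_elim (simp add: divide_right_mono)
  have nonneg: "0 \<le> expectation (W N)" for N
    by (rule integral_nonneg_AE) (use assms(3)[of N] in eventually_elim, auto)
  show "(\<lambda>N. expectation (\<lambda>\<omega>. W N \<omega> / real N)) \<longlonglongrightarrow> 0"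
  proof (rule tendsto_sandwich[OF _ _ tendsto_const])
    show "(\<lambda>N. B / real N) \<longlonglongrightarrow> 0" by (rule lim_const_over_n)
  qed (use B nonneg in \<open>auto intro!: always_eventually divide_right_mono\<close>)
qed

end

text \<open>A chain carrying a mark at each time: the mark is drawn from \<open>q\<close> at the
  current state, the next state depends on the state alone, and \<open>t\<close> sends a mark to the
  target that it designates. Letting \<open>q\<close> depend on the state allows both independent
  marks and marks that are functions of the state.\<close>

locale marked_chain = prob_space M + chain: primitive_matrix E P L \<epsilon> +
  ext: finite_markov_process M "E \<times> F" "\<lambda>y y'. P (fst y) (fst y') * q (fst y') (snd y')" Y
  for M :: "'w measure" and E :: "'e set" and P L \<epsilon> and F :: "'b set" and q :: "'e \<Rightarrow> 'b \<Rightarrow> real"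
    and Y :: "nat \<Rightarrow> 'w \<Rightarrow> 'e \<times> 'b" +
  fixes t :: "'b \<Rightarrow> 'e"
  assumes finite_F [simp]: "finite F" and q_sum: "\<And>z. z \<in> E \<Longrightarrow> (\<Sum>a\<in>F. q z a) = 1"
    and target_in_E: "\<And>a. a \<in> F \<Longrightarrow> t a \<in> E"
begin

abbreviation "Z n \<omega> \<equiv> fst (Y n \<omega>)"
abbreviation "U n \<omega> \<equiv> snd (Y n \<omega>)"

lemma Z_in_E: "\<omega> \<in> space M \<Longrightarrow> Z n \<omega> \<in> E" and U_in_F: "\<omega> \<in> space M \<Longrightarrow> U n \<omega> \<in> F"
  using ext.Y_in_E[of \<omega> n] by auto

lemma ext_T: "ext.T g y = chain.T (\<lambda>z. \<Sum>a\<in>F. q z a * g (z, a)) (fst y)"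
  by (simp add: trans_op_def sum.cartesian_product' sum_distrib_left mult.assoc)

lemma ext_T_fst: "ext.T (\<lambda>y. f (fst y)) = (\<lambda>y. chain.T f (fst y))"
  unfolding ext_T by (intro ext trans_op_cong) (simp add: sum_distrib_right[symmetric] q_sum)

lemma ext_T_funpow_fst: "(ext.T ^^ n) (\<lambda>y. f (fst y)) = (\<lambda>y. (chain.T ^^ n) f (fst y))"
  by (induction n) (simp_all add: ext_T_fst)

text \<open>Primitivity is assumed for the first component only, so the Poisson equation is solved
  on \<open>E\<close> for the mark average \<open>gb\<close>. What remains is a martingale of order
  \<open>sqrt N\<close> in mean square and a bounded telescoping remainder.\<close>

lemma law_of_large_numbers:
  "tendsto_zero_in_prob M (\<lambda>N \<omega>. (\<Sum>k=1..N. g (Y k \<omega>)) / real N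
     - of_bool (N > 0) * chain.mean (\<lambda>z. \<Sum>a\<in>F. q z a * g (z, a)))"
proof -
  define gb where "gb z = (\<Sum>a\<in>F. q z a * g (z, a))" for z
  obtain G where G: "\<And>z. z \<in> E \<Longrightarrow> G z - chain.T G z = gb z - chain.mean gb"
    using chain.poisson_equation by blast
  \<comment> \<open>The correction \<open>g - gb\<close> has mean zero over the mark, so averaging
    \<open>g'\<close> over the mark leaves \<open>G\<close>. The martingale increments of
    \<open>g'\<close> thus absorb the randomness of state and mark together.\<close>
  define g' where "g' y = g y - gb (fst y) + G (fst y)" for y
  have Tg': "ext.T g' y = chain.T G (fst y)" for y
  proof -
    have "(\<Sum>a\<in>F. q z a * g' (z, a)) = G z" if "z \<in> E" for z
      using q_sum[OF that]
      by (simp add: g'_def algebra_simps sum.distrib sum_subtractf flip: sum_distrib_left)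
        (simp add: gb_def algebra_simps)
    then show ?thesis unfolding ext_T by (intro trans_op_cong)
  qed
  define S where "S N \<omega> = (\<Sum>r<N. 1 * (g' (Y (Suc r) \<omega>) - ext.T g' (Y r \<omega>)))" for N \<omega>
  define R where "R N \<omega> = chain.T G (Z 0 \<omega>) - chain.T G (Z N \<omega>)" for N \<omega>
  have decomp: "(\<Sum>k=1..N. g (Y k \<omega>)) = real N * chain.mean gb + S N \<omega> + R N \<omega>"
    if "\<omega> \<in> space M" for N \<omega>
  proof (induction N)
    case (Suc N)
    then show ?case using G[OF Z_in_E[OF that, of "Suc N"]]
      by (simp add: S_def R_def Tg' g'_def algebra_simps)
  qed (simp add: S_def R_def)
  obtain Gb where Gb: "\<And>y. y \<in> E \<times> F \<Longrightarrow> \<bar>g' y\<bar> \<le> Gb"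
    by (rule finite_abs_bounded[of "E \<times> F" g']) auto
  have S_adapted: "ext.adapted N (S N)" for N
    unfolding S_def
    by (intro ext.adapted_sum ext.adapted_mult ext.adapted_diff ext.adapted_of_Y ext.adapted_const) auto
  have S: "tendsto_zero_in_prob M (\<lambda>N \<omega>. S N \<omega> / real N)"
  proof (rule tendsto_zero_in_prob_average_L2)
    show "S N \<in> borel_measurable M" for N
      using ext.adapted_integrable[OF S_adapted] by (rule borel_measurable_integrable)
    show "integrable M (\<lambda>\<omega>. (S N \<omega>)\<^sup>2)" for N
      unfolding power2_eq_square by (intro ext.adapted_integrable[of N] ext.adapted_mult S_adapted)
    show "expectation (\<lambda>\<omega>. (S N \<omega>)\<^sup>2) \<le> real N * (4 * Gb\<^sup>2 * 1)" for N
      unfolding S_def by (rule ext.martingale_transform_L2) (auto simp: Gb ext.adapted_const prob_space)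
  qed
  obtain Rb where Rb: "\<And>z. z \<in> E \<Longrightarrow> \<bar>chain.T G z\<bar> \<le> Rb"
    by (rule finite_abs_bounded[of E "chain.T G"]) auto
  have R: "tendsto_zero_in_prob M (\<lambda>N \<omega>. R N \<omega> / real N)"
  proof (rule tendsto_zero_in_prob_average_L1[where W = "\<lambda>_ _. 2 * Rb" and B = "2 * Rb"])
    show "R N \<in> borel_measurable M" for N
      unfolding R_def by measurable
    show "AE \<omega> in M. \<bar>R N \<omega>\<bar> \<le> 2 * Rb" for N
    proof (rule AE_I2)
      fix \<omega> assume "\<omega> \<in> space M"
      then show "\<bar>R N \<omega>\<bar> \<le> 2 * Rb"
        using Rb[OF Z_in_E, of \<omega> 0] Rb[OF Z_in_E, of \<omega> N] by (simp add: R_def abs_le_iff)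
    qed
  qed (auto simp: prob_space)
  show ?thesis
    unfolding gb_def[symmetric]
  proof (rule tendsto_zero_in_prob_cong_AE[OF tendsto_zero_in_prob_add[OF S R]])
    fix N
    \<comment> \<open>At \<open>N = 0\<close> the quotients are 0; the factor
      \<open>of_bool (N > 0)\<close> removes the mean there, so that the identity holds for every
      \<open>N\<close>.\<close>
    show "AE \<omega> in M. (\<Sum>k=1..N. g (Y k \<omega>)) / real N - of_bool (N > 0) * chain.mean gb =
        S N \<omega> / real N + R N \<omega> / real N"
      by (rule AE_I2) (subst decomp, auto simp: field_simps)
  qed measurable
qed

text \<open>For \<open>r = k\<close> the condition is void, so every window starts alive. Unlike
  \<open>hit\<close>, this is determined by the path up to time \<open>r\<close> and can serve as an
  adapted weight.\<close>

definition survives :: "nat \<Rightarrow> nat \<Rightarrow> 'w \<Rightarrow> bool" where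
  "survives k r \<omega> \<longleftrightarrow> (\<forall>j. k < j \<and> j \<le> r \<longrightarrow> Z j \<omega> \<noteq> t (U k \<omega>))"

abbreviation "sv k r \<omega> \<equiv> of_bool (survives k r \<omega>) :: real"

lemma adapted_sv: "k \<le> r \<Longrightarrow> ext.adapted r (sv k r)"
proof (rule ext.adaptedI)
  fix \<omega> \<omega>' assume "k \<le> r" "\<And>m. m \<le> r \<Longrightarrow> Y m \<omega> = Y m \<omega>'"
  then show "sv k r \<omega> = sv k r \<omega>'" by (auto simp: survives_def)
qed

lemma survives_mono: "survives k r' \<omega> \<Longrightarrow> r \<le> r' \<Longrightarrow> survives k r \<omega>"
  by (auto simp: survives_def)

text \<open>Splitting by the value \<open>a\<close> of the mark replaces the random target by the
  fixed state \<open>t a\<close>. Whatever the state at time \<open>r\<close>, that target is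
  occupied at time \<open>r + L\<close> with conditional probability at least
  \<open>\<epsilon>\<close>.\<close>

lemma expectation_sv_step:
  assumes k: "k \<le> r"
  shows "expectation (sv k (r + L)) \<le> (1 - \<epsilon>) * expectation (sv k r)"
proof -
  define X where "X a \<omega> = sv k r \<omega> * of_bool (U k \<omega> = a)" for a \<omega>
  have X: "ext.adapted r (X a)" for a
    unfolding X_def using k ext.adapted_of_Y[of k r "\<lambda>y. of_bool (snd y = a)"]
    by (intro ext.adapted_mult adapted_sv)
  have hit: "\<epsilon> * expectation (X a) \<le> expectation (\<lambda>\<omega>. X a \<omega> * of_bool (Z (r + L) \<omega> = t a))"
    if a: "a \<in> F" for a
  proof -
    have "\<epsilon> * expectation (X a) = expectation (\<lambda>\<omega>. X a \<omega> * \<epsilon>)" by simp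
    also have "\<dots> \<le> expectation (\<lambda>\<omega>. X a \<omega> * nstep E P L (Z r \<omega>) (t a))"
    proof (rule integral_mono)
      show "integrable M (\<lambda>\<omega>. X a \<omega> * \<epsilon>)"
        by (intro ext.adapted_integrable[of r] ext.adapted_mult X ext.adapted_const)
      show "integrable M (\<lambda>\<omega>. X a \<omega> * nstep E P L (Z r \<omega>) (t a))"
        using ext.adapted_of_Y[of r r "\<lambda>y. nstep E P L (fst y) (t a)"]
        by (intro ext.adapted_integrable[of r] ext.adapted_mult X) simp
      show "X a \<omega> * \<epsilon> \<le> X a \<omega> * nstep E P L (Z r \<omega>) (t a)" if "\<omega> \<in> space M" for \<omega>
        by (intro mult_left_mono chain.nstep_L Z_in_E target_in_E a that) (simp add: X_def)
    qed
    also have "\<dots> = expectation (\<lambda>\<omega>. X a \<omega> *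
        (ext.T ^^ L) (\<lambda>y. of_bool (fst y = t a)) (Y r \<omega>))"
    proof (rule Bochner_Integration.integral_cong[OF refl])
      fix \<omega> assume "\<omega> \<in> space M"
      then show "X a \<omega> * nstep E P L (Z r \<omega>) (t a) =
          X a \<omega> * (ext.T ^^ L) (\<lambda>y. of_bool (fst y = t a)) (Y r \<omega>)"
        unfolding ext_T_funpow_fst[of L "\<lambda>z. of_bool (z = t a)"]
        using nstep_trans_op[OF chain.finite_E Z_in_E, of \<omega> P L r "\<lambda>z. of_bool (z = t a)"]
          target_in_E[OF a]
        by (simp add: if_distrib cong: if_cong)
    qed
    also have "\<dots> = expectation (\<lambda>\<omega>. X a \<omega> * of_bool (Z (r + L) \<omega> = t a))"
      by (rule ext.expectation_steps[OF X, symmetric])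
    finally show ?thesis .
  qed
  have int: "integrable M (\<lambda>\<omega>. X a \<omega> * of_bool (Z (r + L) \<omega> = t a))" for a
    using ext.adapted_of_Y[of "r + L" "r + L" "\<lambda>y. of_bool (fst y = t a)"]
    by (intro ext.adapted_integrable[of "r + L"] ext.adapted_mult ext.adapted_mono[OF X]) auto
  have Xsum: "(\<Sum>a\<in>F. X a \<omega>) = sv k r \<omega>" if "\<omega> \<in> space M" for \<omega>
    using U_in_F[OF that] by (simp add: X_def sum_distrib_left[symmetric] if_distrib cong: if_cong)
  have "expectation (sv k (r + L)) \<le>
      expectation (\<lambda>\<omega>. sv k r \<omega> - (\<Sum>a\<in>F. X a \<omega> * of_bool (Z (r + L) \<omega> = t a)))"
  proof (rule integral_mono)
    show "integrable M (sv k (r + L))" using k by (intro ext.adapted_integrable[of "r + L"] adapted_sv) auto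
    show "integrable M (\<lambda>\<omega>. sv k r \<omega> - (\<Sum>a\<in>F. X a \<omega> * of_bool (Z (r + L) \<omega> = t a)))"
      using k by (intro Bochner_Integration.integrable_diff Bochner_Integration.integrable_sum int
        ext.adapted_integrable[OF adapted_sv]) auto
    fix \<omega> assume "\<omega> \<in> space M"
    then have "(\<Sum>a\<in>F. X a \<omega> * of_bool (Z (r + L) \<omega> = t a)) =
        sv k r \<omega> * of_bool (Z (r + L) \<omega> = t (U k \<omega>))"
      using U_in_F by (simp add: X_def if_distrib cong: if_cong)
    then show "sv k (r + L) \<omega> \<le> sv k r \<omega> - (\<Sum>a\<in>F. X a \<omega> * of_bool (Z (r + L) \<omega> = t a))"
      using survives_mono[of k "r + L" \<omega> r] k chain.L_pos
      by (auto simp: survives_def)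
  qed
  also have "\<dots> = expectation (sv k r) - (\<Sum>a\<in>F. expectation (\<lambda>\<omega>. X a \<omega> * of_bool (Z (r + L) \<omega> = t a)))"
    by (simp only: Bochner_Integration.integral_diff[OF ext.adapted_integrable[OF adapted_sv[OF k]]
          Bochner_Integration.integrable_sum[OF int]] Bochner_Integration.integral_sum[OF int])
  also have "\<dots> \<le> expectation (sv k r) - (\<Sum>a\<in>F. \<epsilon> * expectation (X a))"
    using hit by (intro diff_left_mono sum_mono)
  also have "(\<Sum>a\<in>F. \<epsilon> * expectation (X a)) = \<epsilon> * expectation (\<lambda>\<omega>. \<Sum>a\<in>F. X a \<omega>)"
    by (simp add: sum_distrib_left Bochner_Integration.integral_sum ext.adapted_integrable[OF X])
  also have "expectation (\<lambda>\<omega>. \<Sum>a\<in>F. X a \<omega>) = expectation (sv k r)"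
    by (rule Bochner_Integration.integral_cong) (auto simp: Xsum)
  finally show ?thesis by (simp add: algebra_simps)
qed

lemma expectation_sv_le: "expectation (sv k (k + m)) \<le> (1 - \<epsilon>) ^ (m div L)"
proof -
  have *: "expectation (sv k (k + L * j)) \<le> (1 - \<epsilon>) ^ j" for j
  proof (induction j)
    case 0
    have "survives k k \<omega>" for \<omega> by (auto simp: survives_def)
    then show ?case by (simp add: prob_space)
  next
    case (Suc j)
    have "expectation (sv k (k + L * j + L)) \<le> (1 - \<epsilon>) * expectation (sv k (k + L * j))"
      by (rule expectation_sv_step) simp
    also have "\<dots> \<le> (1 - \<epsilon>) * (1 - \<epsilon>) ^ j"
      using Suc chain.eps_lt_1 by (intro mult_left_mono) auto
    finally show ?case by (simp add: algebra_simps)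
  qed
  have "expectation (sv k (k + m)) \<le> expectation (sv k (k + L * (m div L)))"
  proof (rule integral_mono)
    show "sv k (k + m) \<omega> \<le> sv k (k + L * (m div L)) \<omega>" for \<omega>
      using survives_mono[of k "k + m" \<omega> "k + L * (m div L)"] by auto
  qed (auto intro!: ext.adapted_integrable adapted_sv)
  also note *
  finally show ?thesis .
qed

text \<open>The rate is written as a square so that a bound for two windows jointly can be split
  into one factor for each; see \<open>alive_weights_L2\<close>.\<close>

lemma survival_geometric:
  obtains C s where "C \<ge> 0" "0 < s" "s < 1" "\<And>k m. expectation (sv k (k + m)) \<le> C * (s ^ m)\<^sup>2"
proof -
  obtain C r where r: "C \<ge> 0" "0 < r" "r < 1" "\<And>n. (1 - \<epsilon>) ^ (n div L) \<le> C * r ^ n"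
    using power_div_le_geometric[of "1 - \<epsilon>" L] chain.eps_pos chain.eps_lt_1 chain.L_pos by auto
  show ?thesis
  proof (rule that[of C "sqrt r"])
    fix k m
    have "(sqrt r ^ m)\<^sup>2 = r ^ m" using r by (simp add: power_mult[symmetric] mult.commute[of m] power_mult)
    then show "expectation (sv k (k + m)) \<le> C * (sqrt r ^ m)\<^sup>2"
      using order_trans[OF expectation_sv_le r(4), of k m] by simp
  qed (use r in auto)
qed

definition hit :: "nat \<Rightarrow> 'w \<Rightarrow> nat" where
  "hit k \<omega> = (LEAST n. n > 0 \<and> Z (k + n) \<omega> = t (U k \<omega>))"

lemma pred_target: "Measurable.pred M (\<lambda>\<omega>. Z n \<omega> = t (U k \<omega>))"
proof -
  let ?f = "\<lambda>\<omega>. of_bool (Z n \<omega> = t (U k \<omega>)) :: real"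
  have "?f \<in> borel_measurable M"
    using ext.adapted_of_Y2[of n "max n k" k "\<lambda>y y'. of_bool (fst y = t (snd y'))"]
    by (intro borel_measurable_integrable ext.adapted_integrable[of "max n k"]) auto
  then have "Measurable.pred M (\<lambda>\<omega>. ?f \<omega> = 1)" by measurable
  then show ?thesis by simp
qed

lemma measurable_hit [measurable]: "hit k \<in> M \<rightarrow>\<^sub>M count_space UNIV"
  unfolding hit_def
proof (rule measurable_Least)
  note [measurable] = pred_target
  show "Measurable.pred M (\<lambda>\<omega>. 0 < n \<and> Z (k + n) \<omega> = t (U k \<omega>))" for n by measurable
qed

lemma integrable_sv: "integrable M (sv k (k + m))"
  by (rule ext.adapted_integrable[of "k + m"]) (simp add: adapted_sv)

lemmas measurable_sv = borel_measurable_integrable[OF integrable_sv]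

text \<open>Missing the target forever is contained in surviving \<open>m\<close> steps for every
  \<open>m\<close>. Off this null set the \<open>LEAST\<close> in \<open>hit\<close> has a
  witness.\<close>

lemma AE_hits: "AE \<omega> in M. \<forall>k. \<exists>n>0. Z (k + n) \<omega> = t (U k \<omega>)"
  unfolding AE_all_countable
proof
  fix k
  obtain C s where s: "C \<ge> 0" "0 < s" "s < 1" "\<And>k m. expectation (sv k (k + m)) \<le> C * (s ^ m)\<^sup>2"
    using survival_geometric by blast
  note [measurable] = pred_target
  let ?A = "{\<omega>\<in>space M. \<forall>n>0. Z (k + n) \<omega> \<noteq> t (U k \<omega>)}"
  have "prob ?A \<le> C * (s ^ m)\<^sup>2" for m
  proof -
    have "prob ?A = expectation (indicator ?A)" by simp
    also have "\<dots> \<le> expectation (sv k (k + m))"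
    proof (rule integral_mono)
      show "indicator ?A \<omega> \<le> sv k (k + m) \<omega>" for \<omega>
      proof (cases "\<omega> \<in> ?A")
        case True
        have "survives k (k + m) \<omega>"
          unfolding survives_def
        proof (intro allI impI, elim conjE)
          fix j assume "k < j"
          then show "Z j \<omega> \<noteq> t (U k \<omega>)" using True by (auto dest!: spec[of _ "j - k"])
        qed
        then show ?thesis by (simp add: indicator_def)
      qed simp
    qed (auto intro!: ext.adapted_integrable adapted_sv simp: integrable_indicator_iff less_top[symmetric])
    also note s(4)
    finally show ?thesis .
  qed
  moreover have "(\<lambda>m. C * (s ^ m)\<^sup>2) \<longlonglongrightarrow> C * 0\<^sup>2"
    using s by (intro tendsto_intros LIMSEQ_realpow_zero) auto
  ultimately have "prob ?A \<le> 0"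
    by (intro LIMSEQ_le_const[of "\<lambda>m. C * (s ^ m)\<^sup>2"]) auto
  then have "prob ?A = 0" by (simp add: measure_le_0_iff)
  then have "AE \<omega> in M. \<not> (\<forall>n>0. Z (k + n) \<omega> \<noteq> t (U k \<omega>))"
    by (subst (asm) prob_eq_0) auto
  then show "AE \<omega> in M. \<exists>n>0. Z (k + n) \<omega> = t (U k \<omega>)" by simp
qed

lemma survives_iff_less_hit:
  assumes "\<exists>n>0. Z (k + n) \<omega> = t (U k \<omega>)"
  shows "survives k (k + m) \<omega> \<longleftrightarrow> m < hit k \<omega>"
proof -
  have h: "hit k \<omega> > 0" "Z (k + hit k \<omega>) \<omega> = t (U k \<omega>)"
    using LeastI_ex[OF assms] by (auto simp: hit_def)
  have l: "Z (k + n) \<omega> \<noteq> t (U k \<omega>)" if "n > 0" "n < hit k \<omega>" for n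
    using not_less_Least[of n "\<lambda>n. n > 0 \<and> Z (k + n) \<omega> = t (U k \<omega>)"] that by (simp add: hit_def)
  show ?thesis
  proof
    assume "survives k (k + m) \<omega>"
    then show "m < hit k \<omega>" using h unfolding survives_def
      by (meson add_le_cancel_left less_add_same_cancel1 not_less)
  next
    assume m: "m < hit k \<omega>"
    show "survives k (k + m) \<omega>"
      unfolding survives_def
    proof (intro allI impI, elim conjE)
      fix j assume "k < j" "j \<le> k + m"
      then show "Z j \<omega> \<noteq> t (U k \<omega>)" using l[of "j - k"] m by auto
    qed
  qed
qed

text \<open>The subtraction is on naturals, so this is the overshoot of the hitting time beyond
  \<open>j\<close>. By the tail-sum formula its mean is the sum of the survival probabilities from
  \<open>j\<close> on, a geometric tail. With \<open>j = N - k\<close> it measures how far the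
  window of \<open>k\<close> extends beyond \<open>N\<close>; with \<open>j = 0\<close> it bounds
  the mean hitting time.\<close>

lemma expectation_hit_diff:
  obtains C s where "C \<ge> 0" "0 < s" "s < 1"
    "\<And>k j. integrable M (\<lambda>\<omega>. real (hit k \<omega> - j))"
    "\<And>k j. expectation (\<lambda>\<omega>. real (hit k \<omega> - j)) \<le> C * s ^ j"
proof -
  obtain C s where s: "C \<ge> 0" "0 < s" "s < 1" "\<And>k m. expectation (sv k (k + m)) \<le> C * (s ^ m)\<^sup>2"
    using survival_geometric by blast
  have sv': "expectation (sv k (k + m)) \<le> C * s ^ m" for k m
  proof -
    have "s ^ m \<le> 1" using s by (intro power_le_one) auto
    then have "(s ^ m)\<^sup>2 \<le> s ^ m" using s by (simp add: power2_eq_square mult_left_le)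
    then show ?thesis using order_trans[OF s(4) mult_left_mono] s(1) by blast
  qed
  have nn: "(\<integral>\<^sup>+\<omega>. ennreal (real (hit k \<omega> - j)) \<partial>M) \<le> ennreal (C / (1 - s) * s ^ j)" for k j
  proof -
    have "(\<integral>\<^sup>+\<omega>. ennreal (real (hit k \<omega> - j)) \<partial>M) =
        (\<integral>\<^sup>+\<omega>. (\<Sum>m. ennreal (sv k (k + (j + m)) \<omega>)) \<partial>M)"
    proof (rule nn_integral_cong_AE)
      show "AE \<omega> in M. ennreal (real (hit k \<omega> - j)) = (\<Sum>m. ennreal (sv k (k + (j + m)) \<omega>))"
        using AE_hits
      proof eventually_elim
        case (elim \<omega>)
        have "(\<Sum>m. ennreal (sv k (k + (j + m)) \<omega>)) =
            (\<Sum>m. if m \<in> {..<hit k \<omega> - j} then 1 else 0)"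
          using elim by (intro suminf_cong) (auto simp: survives_iff_less_hit)
        also have "\<dots> = (\<Sum>m\<in>{..<hit k \<omega> - j}. 1)"
          by (rule sums_unique[symmetric], rule sums_If_finite_set) simp
        finally show ?case by (simp add: ennreal_of_nat_eq_real_of_nat)
      qed
    qed
    also have "\<dots> = (\<Sum>m. \<integral>\<^sup>+\<omega>. ennreal (sv k (k + (j + m)) \<omega>) \<partial>M)"
      by (intro nn_integral_suminf measurable_compose[OF measurable_sv measurable_ennreal])
    also have "\<dots> = (\<Sum>m. ennreal (expectation (sv k (k + (j + m)))))"
      by (intro suminf_cong nn_integral_eq_integral integrable_sv) auto
    also have "\<dots> \<le> (\<Sum>m. ennreal (C * s ^ j * s ^ m))"
      using sv'[of k "j + m" for m] by (intro suminf_le) (auto simp: power_add mult.assoc intro!: ennreal_leI)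
    also have "\<dots> = ennreal (\<Sum>m. C * s ^ j * s ^ m)"
      using s by (intro suminf_ennreal2 summable_mult summable_geometric) auto
    also have "(\<Sum>m. C * s ^ j * s ^ m) = C / (1 - s) * s ^ j"
      using s by (simp add: suminf_mult suminf_geometric)
    finally show ?thesis .
  qed
  have meas: "(\<lambda>\<omega>. real (hit k \<omega> - j)) \<in> borel_measurable M" for k j by measurable
  show ?thesis
  proof (rule that[of "C / (1 - s)" s])
    show "integrable M (\<lambda>\<omega>. real (hit k \<omega> - j))" for k j
    proof (rule integrableI_bounded[OF meas])
      have "(\<integral>\<^sup>+\<omega>. ennreal (norm (real (hit k \<omega> - j))) \<partial>M) \<le> ennreal (C / (1 - s) * s ^ j)"
        using nn[of k j] by simp
      also have "\<dots> < \<infinity>" by simp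
      finally show "(\<integral>\<^sup>+\<omega>. ennreal (norm (real (hit k \<omega> - j))) \<partial>M) < \<infinity>" .
    qed
    show "expectation (\<lambda>\<omega>. real (hit k \<omega> - j)) \<le> C / (1 - s) * s ^ j" for k j
      using s nn[of k j] by (intro integral_real_bounded) auto
  qed (use s in auto)
qed

text \<open>A pathwise identity for every length \<open>h\<close>, hence also for a random one;
  optional stopping is not invoked.\<close>

lemma sum_until_hit:
  assumes \<omega>: "\<omega> \<in> space M" and V: "\<And>z. z \<in> E \<Longrightarrow> V z - chain.T V z = f z - m"
  shows "(\<Sum>n=k+1..k+h. f (Z n \<omega>) - m) = chain.T V (Z k \<omega>) - chain.T V (Z (k + h) \<omega>)
    + (\<Sum>r\<in>{k..<k+h}. V (Z (Suc r) \<omega>) - chain.T V (Z r \<omega>))"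
proof (induction h)
  case (Suc h)
  then show ?case using V[OF Z_in_E[OF \<omega>, of "Suc (k + h)"]] by simp
qed simp

text \<open>Although \<open>r\<close> windows have been opened by time \<open>r\<close>, old ones
  are unlikely to be still alive. The second moment is dominated by a double sum of joint survival
  probabilities, each at most \<open>C\<close> times a product of two geometric factors, so the
  double sum is bounded by the square of a geometric series.\<close>

lemma alive_weights_L2:
  assumes Kb: "\<And>z. z \<in> E \<Longrightarrow> \<bar>\<kappa> z\<bar> \<le> Kb"
  obtains B where "\<And>r. expectation (\<lambda>\<omega>. (\<Sum>k=1..r. \<kappa> (Z k \<omega>) * sv k r \<omega>)\<^sup>2) \<le> B"
proof -
  obtain C s where s: "C \<ge> 0" "0 < s" "s < 1" "\<And>k m. expectation (sv k (k + m)) \<le> C * (s ^ m)\<^sup>2"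
    using survival_geometric by blast
  have sv: "expectation (sv k r) \<le> C * (s ^ (r - k))\<^sup>2" if "k \<le> r" for k r
    using s(4)[of k "r - k"] that by simp
  have int: "integrable M (\<lambda>\<omega>. sv k r \<omega> * sv l r \<omega>)" if "k \<le> r" "l \<le> r" for k l r
    using that by (intro ext.adapted_integrable[of r] ext.adapted_mult adapted_sv)
  have int1: "integrable M (sv k r)" if "k \<le> r" for k r
    using that by (intro ext.adapted_integrable[of r] adapted_sv)
  have pair: "expectation (\<lambda>\<omega>. sv k r \<omega> * sv l r \<omega>) \<le> C * (s ^ (r - k) * s ^ (r - l))"
    if k: "k \<le> r" and l: "l \<le> r" for k l r
  proof -
    let ?e = "expectation (\<lambda>\<omega>. sv k r \<omega> * sv l r \<omega>)"
    have "?e \<le> expectation (sv k r)" "?e \<le> expectation (sv l r)"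
      using int[OF k l] int1[OF k] int1[OF l] by (intro integral_mono; simp)+
    then have 1: "?e \<le> C * (s ^ (r - k))\<^sup>2" "?e \<le> C * (s ^ (r - l))\<^sup>2"
      using sv[OF k] sv[OF l] by linarith+
    show ?thesis
    \<comment> \<open>Joint survival is bounded by the survival of the older window, whose squared
      factor is at most the product of the factors for \<open>k\<close> and
      \<open>l\<close>.\<close>
    proof (cases "k \<le> l")
      case True
      then have "s ^ (r - k) \<le> s ^ (r - l)" using s by (intro power_decreasing) auto
      then have "C * (s ^ (r - k))\<^sup>2 \<le> C * (s ^ (r - k) * s ^ (r - l))"
        using s by (auto simp: power2_eq_square intro!: mult_left_mono)
      then show ?thesis using 1 by linarith
    next
      case False
      then have "s ^ (r - l) \<le> s ^ (r - k)" using s by (intro power_decreasing) auto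
      then have "C * (s ^ (r - l))\<^sup>2 \<le> C * (s ^ (r - k) * s ^ (r - l))"
        using s by (auto simp: power2_eq_square intro!: mult_left_mono mult_right_mono)
      then show ?thesis using 1 by linarith
    qed
  qed
  have "expectation (\<lambda>\<omega>. (\<Sum>k=1..r. \<kappa> (Z k \<omega>) * sv k r \<omega>)\<^sup>2) \<le> Kb\<^sup>2 * (C * (1 / (1 - s))\<^sup>2)" for r
  proof -
    have "expectation (\<lambda>\<omega>. (\<Sum>k=1..r. \<kappa> (Z k \<omega>) * sv k r \<omega>)\<^sup>2) \<le>
        expectation (\<lambda>\<omega>. Kb\<^sup>2 * (\<Sum>k=1..r. \<Sum>l=1..r. sv k r \<omega> * sv l r \<omega>))"
    proof (rule integral_mono)
      show "integrable M (\<lambda>\<omega>. (\<Sum>k=1..r. \<kappa> (Z k \<omega>) * sv k r \<omega>)\<^sup>2)"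
        unfolding power2_eq_square
        using ext.adapted_of_Y[of _ r "\<lambda>y. \<kappa> (fst y)"]
        by (intro ext.adapted_integrable[of r] ext.adapted_mult ext.adapted_sum adapted_sv) auto
      show "integrable M (\<lambda>\<omega>. Kb\<^sup>2 * (\<Sum>k=1..r. \<Sum>l=1..r. sv k r \<omega> * sv l r \<omega>))"
        by (intro integrable_mult_right Bochner_Integration.integrable_sum int) auto
      fix \<omega> assume \<omega>: "\<omega> \<in> space M"
      have "\<bar>\<Sum>k=1..r. \<kappa> (Z k \<omega>) * sv k r \<omega>\<bar> \<le> (\<Sum>k=1..r. Kb * sv k r \<omega>)"
        using Kb[OF Z_in_E[OF \<omega>]]
        by (intro order_trans[OF sum_abs] sum_mono) (auto simp: abs_mult)
      also have "\<dots> = Kb * (\<Sum>k=1..r. sv k r \<omega>)" by (simp only: sum_distrib_left)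
      finally have "(\<Sum>k=1..r. \<kappa> (Z k \<omega>) * sv k r \<omega>)\<^sup>2 \<le> (Kb * (\<Sum>k=1..r. sv k r \<omega>))\<^sup>2"
        by (rule power2_le_iff_abs_le[THEN iffD2, rotated])
          (use Kb[OF Z_in_E[OF \<omega>, of 0]] in \<open>auto intro!: mult_nonneg_nonneg sum_nonneg\<close>)
      also have "\<dots> = Kb\<^sup>2 * (\<Sum>k=1..r. \<Sum>l=1..r. sv k r \<omega> * sv l r \<omega>)"
        unfolding power_mult_distrib by (simp only: power2_eq_square sum_product)
      finally show "(\<Sum>k=1..r. \<kappa> (Z k \<omega>) * sv k r \<omega>)\<^sup>2 \<le>
          Kb\<^sup>2 * (\<Sum>k=1..r. \<Sum>l=1..r. sv k r \<omega> * sv l r \<omega>)" .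
    qed
    also have "\<dots> = Kb\<^sup>2 * (\<Sum>k=1..r. expectation (\<lambda>\<omega>. \<Sum>l=1..r. sv k r \<omega> * sv l r \<omega>))"
      unfolding integral_mult_right_zero
      by (intro arg_cong2[of _ _ _ _ "(*)"] refl Bochner_Integration.integral_sum
          Bochner_Integration.integrable_sum int) auto
    also have "\<dots> = Kb\<^sup>2 * (\<Sum>k=1..r. \<Sum>l=1..r. expectation (\<lambda>\<omega>. sv k r \<omega> * sv l r \<omega>))"
      by (intro arg_cong2[of _ _ _ _ "(*)"] sum.cong refl Bochner_Integration.integral_sum int) auto
    also have "\<dots> \<le> Kb\<^sup>2 * (\<Sum>k=1..r. \<Sum>l=1..r. C * (s ^ (r - k) * s ^ (r - l)))"
      by (intro mult_left_mono sum_mono pair) auto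
    also have "\<dots> = Kb\<^sup>2 * (C * (\<Sum>k=1..r. s ^ (r - k))\<^sup>2)"
      unfolding power2_eq_square sum_product by (simp only: sum_distrib_left)
    also have "\<dots> \<le> Kb\<^sup>2 * (C * (1 / (1 - s))\<^sup>2)"
      using s by (intro mult_left_mono power_mono sum_power_reverse_le sum_nonneg) auto
    finally show ?thesis .
  qed
  then show ?thesis by (rule that)
qed

text \<open>
  Solving the Poisson equation \<open>V - T V = f - mean f\<close> turns the sum up to the hitting time into
  increments of a martingale; after exchanging the two sums, each increment carries a predictable
  weight, namely the sum of \<open>\<kappa>\<close> over those \<open>k\<close> whose target has not been hit yet, and geometric
  tails of the hitting times bound this weight in mean square.
\<close>

lemma consistency:
  assumes V: "\<And>z. z \<in> E \<Longrightarrow> V z - chain.T V z = f z - chain.mean f"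
    and \<Gamma>_meas: "\<And>N. \<Gamma> N \<in> borel_measurable M"
    and \<Gamma>: "AE \<omega> in M. (\<lambda>N. \<Gamma> N \<omega>) \<longlonglongrightarrow> chain.mean f"
  shows "tendsto_zero_in_prob M (\<lambda>N \<omega>. (\<Sum>k=1..N. \<kappa> (Z k \<omega>) *
      ((f (Z k \<omega>) - f (t (U k \<omega>))) + (\<Sum>n=k+1..k+hit k \<omega>. f (Z n \<omega>)) - real (hit k \<omega>) * \<Gamma> N \<omega>)) / real N
    - of_bool (N > 0) * chain.mean (\<lambda>z. \<kappa> z * (V z - (\<Sum>a\<in>F. q z a * V (t a)))))"
proof -
  let ?m = "chain.mean f"
  obtain Kb where Kb: "Kb \<ge> 0" "\<And>z. z \<in> E \<Longrightarrow> \<bar>\<kappa> z\<bar> \<le> Kb"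
    using finite_abs_bounded[OF chain.finite_E] by blast
  obtain Vb where Vb: "Vb \<ge> 0" "\<And>z. z \<in> E \<Longrightarrow> \<bar>V z\<bar> \<le> Vb"
    using finite_abs_bounded[OF chain.finite_E] by blast
  obtain C s where s: "C \<ge> 0" "0 < s" "s < 1"
    and int_hit: "\<And>k j. integrable M (\<lambda>\<omega>. real (hit k \<omega> - j))"
    and E_hit: "\<And>k j. expectation (\<lambda>\<omega>. real (hit k \<omega> - j)) \<le> C * s ^ j"
    using expectation_hit_diff by blast
  obtain B where B: "\<And>r. expectation (\<lambda>\<omega>. (\<Sum>k=1..r. \<kappa> (Z k \<omega>) * sv k r \<omega>)\<^sup>2) \<le> B"
    using alive_weights_L2[of \<kappa> Kb] Kb(2) by blast
  define D where "D r \<omega> = V (Z (Suc r) \<omega>) - chain.T V (Z r \<omega>)" for r \<omega>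
  have D_le: "\<bar>D r \<omega>\<bar> \<le> 2 * Vb" if "\<omega> \<in> space M" for r \<omega>
  proof -
    have "\<bar>chain.T V (Z r \<omega>)\<bar> \<le> Vb" by (rule chain.T_abs_le) (use Vb Z_in_E that in auto)
    then show ?thesis using Vb(2)[OF Z_in_E[OF that, of "Suc r"]] by (simp add: D_def abs_le_iff)
  qed
  have D_meas: "D r \<in> borel_measurable M" for r
    unfolding D_def by measurable
  \<comment> \<open>What is left of the \<open>k\<close>-th summand without increments and centring
    error. The cost difference of the estimator is exactly what upgrades
    \<open>T V (Z k) - T V (t (U k))\<close> to \<open>V (Z k) - V (t (U k))\<close> through the
    Poisson equation.\<close>
  define g where "g y = \<kappa> (fst y) * (V (fst y) - V (t (snd y)))" for y
  have gb: "(\<Sum>a\<in>F. q z a * g (z, a)) = \<kappa> z * (V z - (\<Sum>a\<in>F. q z a * V (t a)))" if "z \<in> E" for z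
  proof -
    have "(\<Sum>a\<in>F. q z a * g (z, a)) = (\<Sum>a\<in>F. q z a) * (\<kappa> z * V z) - \<kappa> z * (\<Sum>a\<in>F. q z a * V (t a))"
      by (simp add: g_def algebra_simps sum_subtractf sum_distrib_left sum_distrib_right)
    then show ?thesis using q_sum[OF that] by (simp add: algebra_simps)
  qed
  define W where "W r \<omega> = (\<Sum>k=1..r. \<kappa> (Z k \<omega>) * sv k r \<omega>)" for r \<omega>
  have W_adapted: "ext.adapted r (W r)" for r
    unfolding W_def using ext.adapted_of_Y[of _ r "\<lambda>y. \<kappa> (fst y)"]
    by (intro ext.adapted_sum ext.adapted_mult adapted_sv) auto
  define S where "S N \<omega> = (\<Sum>r<N. W r \<omega> * D r \<omega>)" for N \<omega>
  \<comment> \<open>The parts of the windows lying after time \<open>N\<close>. By the overshoot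
    bound, the window of \<open>k\<close> contributes at most a multiple of
    \<open>s ^ (N - k)\<close> in mean, so the total is bounded independently of
    \<open>N\<close>.\<close>
  define R where "R N \<omega> = (\<Sum>k=1..N. \<kappa> (Z k \<omega>) * (\<Sum>r\<in>{N..<k+hit k \<omega>}. D r \<omega>))" for N \<omega>
  define H where "H N \<omega> = (\<Sum>k=1..N. \<kappa> (Z k \<omega>) * real (hit k \<omega>))" for N \<omega>

  have A_lim: "tendsto_zero_in_prob M (\<lambda>N \<omega>. (\<Sum>k=1..N. g (Y k \<omega>)) / real N
      - of_bool (N > 0) * chain.mean (\<lambda>z. \<kappa> z * (V z - (\<Sum>a\<in>F. q z a * V (t a)))))"
    using law_of_large_numbers[of g] by (simp add: chain.mean_def gb cong: sum.cong)

  have S_adapted: "ext.adapted N (S N)" for N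
  proof -
    have "ext.adapted N (D r)" if "r < N" for r
      unfolding D_def using that ext.adapted_of_Y[of "Suc r" N "\<lambda>y. V (fst y)"]
        ext.adapted_of_Y[of r N "\<lambda>y. chain.T V (fst y)"]
      by (intro ext.adapted_diff) auto
    then show ?thesis
      unfolding S_def
      by (intro ext.adapted_sum ext.adapted_mult ext.adapted_mono[OF W_adapted]) auto
  qed
  have S_lim: "tendsto_zero_in_prob M (\<lambda>N \<omega>. S N \<omega> / real N)"
  proof (rule tendsto_zero_in_prob_average_L2)
    show "S N \<in> borel_measurable M" for N
      using ext.adapted_integrable[OF S_adapted] by (rule borel_measurable_integrable)
    show "integrable M (\<lambda>\<omega>. (S N \<omega>)\<^sup>2)" for N
      unfolding power2_eq_square by (intro ext.adapted_integrable[of N] ext.adapted_mult S_adapted)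
    have "expectation (\<lambda>\<omega>. (\<Sum>r<N. W r \<omega> * (V (fst (Y (Suc r) \<omega>)) - ext.T (\<lambda>y. V (fst y)) (Y r \<omega>)))\<^sup>2)
        \<le> real N * (4 * Vb\<^sup>2 * B)" for N
      by (rule ext.martingale_transform_L2[where g = "\<lambda>y. V (fst y)"])
        (rule W_adapted, rule B[folded W_def], use Vb in auto)
    then show "expectation (\<lambda>\<omega>. (S N \<omega>)\<^sup>2) \<le> real N * (4 * Vb\<^sup>2 * B)" for N
      by (simp add: S_def D_def ext_T_fst)
  qed

  have R_lim: "tendsto_zero_in_prob M (\<lambda>N \<omega>. R N \<omega> / real N)"
  proof (rule tendsto_zero_in_prob_average_L1)
    show "R N \<in> borel_measurable M" for N
    proof -
      have "(\<lambda>\<omega>. \<Sum>r\<in>{N..<k+hit k \<omega>}. D r \<omega>) \<in> borel_measurable M" for k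
        by (rule measurable_random_sum[where I = "\<lambda>h. {N..<k+h}", OF measurable_hit D_meas])
      then show ?thesis
        unfolding R_def using ext.measurable_of_Y[of "\<lambda>y. \<kappa> (fst y)"]
        by (intro borel_measurable_sum borel_measurable_times) auto
    qed
    show "integrable M (\<lambda>\<omega>. \<Sum>k=1..N. (Kb * (2 * Vb)) * real (hit k \<omega> - (N - k)))" for N
      by (intro Bochner_Integration.integrable_sum integrable_mult_right int_hit)
    show "AE \<omega> in M. \<bar>R N \<omega>\<bar> \<le> (\<Sum>k=1..N. (Kb * (2 * Vb)) * real (hit k \<omega> - (N - k)))" for N
    proof (rule AE_I2)
      fix \<omega> assume \<omega>: "\<omega> \<in> space M"
      show "\<bar>R N \<omega>\<bar> \<le> (\<Sum>k=1..N. (Kb * (2 * Vb)) * real (hit k \<omega> - (N - k)))"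
        unfolding R_def
      proof (rule order_trans[OF sum_abs], rule sum_mono)
        fix k assume k: "k \<in> {1..N}"
        have "\<bar>\<Sum>r\<in>{N..<k+hit k \<omega>}. D r \<omega>\<bar> \<le> (\<Sum>r\<in>{N..<k+hit k \<omega>}. 2 * Vb)"
          by (rule order_trans[OF sum_abs]) (intro sum_mono D_le \<omega>)
        also have "\<dots> = 2 * Vb * real (hit k \<omega> - (N - k))"
          using k by (simp add: algebra_simps)
        finally have "\<bar>\<kappa> (Z k \<omega>)\<bar> * \<bar>\<Sum>r\<in>{N..<k+hit k \<omega>}. D r \<omega>\<bar> \<le>
            Kb * (2 * Vb * real (hit k \<omega> - (N - k)))"
          using Kb Z_in_E[OF \<omega>] by (intro mult_mono) auto
        then show "\<bar>\<kappa> (Z k \<omega>) * (\<Sum>r\<in>{N..<k+hit k \<omega>}. D r \<omega>)\<bar> \<le>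
            Kb * (2 * Vb) * real (hit k \<omega> - (N - k))"
          by (simp add: abs_mult mult.assoc)
      qed
    qed
    show "expectation (\<lambda>\<omega>. \<Sum>k=1..N. (Kb * (2 * Vb)) * real (hit k \<omega> - (N - k))) \<le>
        (Kb * (2 * Vb)) * (C * (1 / (1 - s)))" for N
    proof -
      have "expectation (\<lambda>\<omega>. \<Sum>k=1..N. (Kb * (2 * Vb)) * real (hit k \<omega> - (N - k))) =
          (\<Sum>k=1..N. expectation (\<lambda>\<omega>. (Kb * (2 * Vb)) * real (hit k \<omega> - (N - k))))"
        by (rule Bochner_Integration.integral_sum) (intro integrable_mult_right int_hit)
      also have "\<dots> = (Kb * (2 * Vb)) * (\<Sum>k=1..N. expectation (\<lambda>\<omega>. real (hit k \<omega> - (N - k))))"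
        by (simp only: integral_mult_right_zero sum_distrib_left)
      also have "\<dots> \<le> (Kb * (2 * Vb)) * (\<Sum>k=1..N. C * s ^ (N - k))"
        using Kb(1) Vb(1) by (intro mult_left_mono sum_mono E_hit) auto
      also have "\<dots> \<le> (Kb * (2 * Vb)) * (C * (1 / (1 - s)))"
        unfolding sum_distrib_left[symmetric]
        using Kb(1) Vb(1) s by (intro mult_left_mono sum_power_reverse_le) auto
      finally show ?thesis .
    qed
  qed

  \<comment> \<open>The price of centring by \<open>\<Gamma> N\<close> instead of the stationary
    mean. No independence between \<open>\<Gamma> N\<close> and the hitting times is available, but
    a factor tending to zero in probability times one bounded in mean suffices.\<close>
  have H_lim: "tendsto_zero_in_prob M (\<lambda>N \<omega>. (?m - \<Gamma> N \<omega>) * (H N \<omega> / real N))"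
  proof (rule tendsto_zero_in_prob_mult_L1_bounded)
    show "tendsto_zero_in_prob M (\<lambda>N \<omega>. ?m - \<Gamma> N \<omega>)"
    proof (rule tendsto_zero_in_prob_AE)
      show "(\<lambda>\<omega>. ?m - \<Gamma> N \<omega>) \<in> borel_measurable M" for N using \<Gamma>_meas[of N] by measurable
      show "AE \<omega> in M. (\<lambda>N. ?m - \<Gamma> N \<omega>) \<longlonglongrightarrow> 0"
        using \<Gamma> by eventually_elim (auto intro!: tendsto_eq_intros)
    qed
    have int: "integrable M (\<lambda>\<omega>. real (hit k \<omega>))" for k using int_hit[of k 0] by simp
    have \<kappa>_meas: "(\<lambda>\<omega>. \<kappa> (Z k \<omega>)) \<in> borel_measurable M" for k
      by (rule ext.measurable_of_Y)
    have "integrable M (H N)" for N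
      unfolding H_def
    proof (rule Bochner_Integration.integrable_sum)
      fix k
      show "integrable M (\<lambda>\<omega>. \<kappa> (Z k \<omega>) * real (hit k \<omega>))"
      proof (rule Bochner_Integration.integrable_bound[OF integrable_mult_right[OF int[of k], of Kb]])
        show "(\<lambda>\<omega>. \<kappa> (Z k \<omega>) * real (hit k \<omega>)) \<in> borel_measurable M"
          using \<kappa>_meas[of k] by measurable
        show "AE \<omega> in M. norm (\<kappa> (Z k \<omega>) * real (hit k \<omega>)) \<le> norm (Kb * real (hit k \<omega>))"
          by (rule AE_I2) (use Kb Z_in_E in \<open>auto simp: abs_mult intro!: mult_right_mono\<close>)
      qed
    qed
    then show int_H: "integrable M (\<lambda>\<omega>. H N \<omega> / real N)" for N by simp
    show "expectation (\<lambda>\<omega>. \<bar>H N \<omega> / real N\<bar>) \<le> Kb * C" for N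
    proof -
      have "expectation (\<lambda>\<omega>. \<bar>H N \<omega> / real N\<bar>) \<le>
          expectation (\<lambda>\<omega>. Kb * (\<Sum>k=1..N. real (hit k \<omega>)) / real N)"
      proof (rule integral_mono)
        show "integrable M (\<lambda>\<omega>. Kb * (\<Sum>k=1..N. real (hit k \<omega>)) / real N)"
          using int by (intro integrable_divide integrable_mult_right Bochner_Integration.integrable_sum)
        fix \<omega> assume \<omega>: "\<omega> \<in> space M"
        have "\<bar>H N \<omega>\<bar> \<le> (\<Sum>k=1..N. Kb * real (hit k \<omega>))"
          unfolding H_def using Kb(2)[OF Z_in_E[OF \<omega>]]
          by (intro order_trans[OF sum_abs] sum_mono) (auto simp: abs_mult intro!: mult_right_mono)
        then show "\<bar>H N \<omega> / real N\<bar> \<le> Kb * (\<Sum>k=1..N. real (hit k \<omega>)) / real N"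
          by (auto simp: sum_distrib_left intro!: divide_right_mono)
      qed (rule integrable_abs[OF int_H])
      also have "\<dots> = Kb * (\<Sum>k=1..N. expectation (\<lambda>\<omega>. real (hit k \<omega>))) / real N"
        using int by (simp add: Bochner_Integration.integral_sum)
      also have "\<dots> \<le> Kb * (\<Sum>k=1..N. C) / real N"
        using E_hit[of _ 0] Kb(1) by (intro divide_right_mono mult_left_mono sum_mono) auto
      also have "\<dots> \<le> Kb * C" using Kb(1) s(1) by (cases "N = 0") auto
      finally show ?thesis .
    qed
  qed

  have decomp: "(\<Sum>k=1..N. \<kappa> (Z k \<omega>) *
      ((f (Z k \<omega>) - f (t (U k \<omega>))) + (\<Sum>n=k+1..k+hit k \<omega>. f (Z n \<omega>)) - real (hit k \<omega>) * \<Gamma> N \<omega>)) =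
      (\<Sum>k=1..N. g (Y k \<omega>)) + (S N \<omega> + (R N \<omega> + (?m - \<Gamma> N \<omega>) * H N \<omega>))"
    if \<omega>: "\<omega> \<in> space M" and hits: "\<forall>k. \<exists>n>0. Z (k + n) \<omega> = t (U k \<omega>)" for N \<omega>
  proof -
    have summand: "\<kappa> (Z k \<omega>) *
        ((f (Z k \<omega>) - f (t (U k \<omega>))) + (\<Sum>n=k+1..k+hit k \<omega>. f (Z n \<omega>)) - real (hit k \<omega>) * \<Gamma> N \<omega>) =
        g (Y k \<omega>) + ((\<Sum>r\<in>{k..<N}. \<kappa> (Z k \<omega>) * sv k r \<omega> * D r \<omega>)
          + (\<kappa> (Z k \<omega>) * (\<Sum>r\<in>{N..<k+hit k \<omega>}. D r \<omega>) + (?m - \<Gamma> N \<omega>) * (\<kappa> (Z k \<omega>) * real (hit k \<omega>))))"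
      if k: "k \<in> {1..N}" for k
    proof -
      let ?h = "hit k \<omega>"
      have hit: "Z (k + ?h) \<omega> = t (U k \<omega>)"
        using LeastI_ex[OF hits[rule_format, of k]] by (simp add: hit_def)
      have tE: "t (U k \<omega>) \<in> E" using target_in_E[OF U_in_F[OF \<omega>]] .
      \<comment> \<open>The window is cut at \<open>N\<close>. If the target is hit by time
        \<open>N\<close>, the second range is empty; before the cut, membership in the window is the
        same as survival.\<close>
      have "(\<Sum>r\<in>{k..<k+?h}. D r \<omega>) = (\<Sum>r\<in>{k..<min N (k+?h)}. D r \<omega>) + (\<Sum>r\<in>{N..<k+?h}. D r \<omega>)"
        using k by (subst sum.union_disjoint[symmetric]) (auto intro!: sum.cong)
      also have "(\<Sum>r\<in>{k..<min N (k+?h)}. D r \<omega>) = (\<Sum>r\<in>{k..<N}. sv k r \<omega> * D r \<omega>)"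
      proof (rule sum.mono_neutral_cong_left)
        have "survives k r \<omega> \<longleftrightarrow> r < k + ?h" if "k \<le> r" for r
          using survives_iff_less_hit[OF hits[rule_format, of k], of "r - k"] that by auto
        then show "\<forall>r\<in>{k..<N} - {k..<min N (k+?h)}. sv k r \<omega> * D r \<omega> = 0"
          "\<And>r. r \<in> {k..<min N (k+?h)} \<Longrightarrow> D r \<omega> = sv k r \<omega> * D r \<omega>" by auto
      qed auto
      finally have split: "(\<Sum>r\<in>{k..<k+?h}. D r \<omega>) =
          (\<Sum>r\<in>{k..<N}. sv k r \<omega> * D r \<omega>) + (\<Sum>r\<in>{N..<k+?h}. D r \<omega>)" .
      have "(\<Sum>n=k+1..k+?h. f (Z n \<omega>)) = (\<Sum>n=k+1..k+?h. f (Z n \<omega>) - ?m) + real ?h * ?m"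
        by (simp add: sum_subtractf)
      also have "(\<Sum>n=k+1..k+?h. f (Z n \<omega>) - ?m) = chain.T V (Z k \<omega>) - chain.T V (t (U k \<omega>))
          + (\<Sum>r\<in>{k..<k+?h}. D r \<omega>)"
        using sum_until_hit[OF \<omega> V, of k ?h] by (simp add: hit D_def)
      finally have *: "(f (Z k \<omega>) - f (t (U k \<omega>))) + (\<Sum>n=k+1..k+?h. f (Z n \<omega>)) - real ?h * \<Gamma> N \<omega> =
          (V (Z k \<omega>) - V (t (U k \<omega>))) + ((\<Sum>r\<in>{k..<N}. sv k r \<omega> * D r \<omega>)
          + ((\<Sum>r\<in>{N..<k+?h}. D r \<omega>) + (?m - \<Gamma> N \<omega>) * real ?h))"
        using V[OF Z_in_E[OF \<omega>, of k]] V[OF tE] unfolding split by (simp add: algebra_simps)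
      show ?thesis
        unfolding * g_def by (simp add: distrib_left sum_distrib_left mult.assoc mult.left_commute
            del: sum_of_bool_mult_eq sum_mult_of_bool_eq)
    qed
    \<comment> \<open>Regrouping by time \<open>r\<close> collects all windows still alive into the
      weight \<open>W r\<close>, turning the double sum into a martingale transform.\<close>
    have "(\<Sum>k=1..N. \<Sum>r\<in>{k..<N}. \<kappa> (Z k \<omega>) * sv k r \<omega> * D r \<omega>) =
        (\<Sum>k\<in>{1..N}. \<Sum>r | r \<in> {..<N} \<and> k \<le> r. \<kappa> (Z k \<omega>) * sv k r \<omega> * D r \<omega>)"
      by (intro sum.cong refl) auto
    also have "\<dots> = (\<Sum>r\<in>{..<N}. \<Sum>k | k \<in> {1..N} \<and> k \<le> r. \<kappa> (Z k \<omega>) * sv k r \<omega> * D r \<omega>)"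
      by (rule sum.swap_restrict) auto
    also have "\<dots> = S N \<omega>"
      unfolding S_def W_def sum_distrib_right by (intro sum.cong refl) auto
    finally show ?thesis
      by (simp only: summand sum.distrib R_def H_def sum_distrib_left cong: sum.cong)
  qed

  show ?thesis
  proof (rule tendsto_zero_in_prob_cong_AE[OF tendsto_zero_in_prob_add[OF A_lim
        tendsto_zero_in_prob_add[OF S_lim tendsto_zero_in_prob_add[OF R_lim H_lim]]]])
    fix N
    have "(\<lambda>\<omega>. \<Sum>n=k+1..k+hit k \<omega>. f (Z n \<omega>)) \<in> borel_measurable M" for k
      by (rule measurable_random_sum[where I = "\<lambda>h. {k+1..k+h}", OF measurable_hit
            ext.measurable_of_Y[of "\<lambda>y. f (fst y)"]])
    note [measurable] = this \<Gamma>_meas ext.measurable_of_Y[of "\<lambda>y. f (fst y)"]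
      ext.measurable_of_Y[of "\<lambda>y. \<kappa> (fst y)"] ext.measurable_of_Y[of "\<lambda>y. f (t (snd y))"]
    show "(\<lambda>\<omega>. (\<Sum>k=1..N. \<kappa> (Z k \<omega>) *
      ((f (Z k \<omega>) - f (t (U k \<omega>))) + (\<Sum>n=k+1..k+hit k \<omega>. f (Z n \<omega>)) - real (hit k \<omega>) * \<Gamma> N \<omega>)) / real N
      - of_bool (N > 0) * chain.mean (\<lambda>z. \<kappa> z * (V z - (\<Sum>a\<in>F. q z a * V (t a))))) \<in> borel_measurable M"
      by measurable
    show "AE \<omega> in M. (\<Sum>k=1..N. \<kappa> (Z k \<omega>) *
      ((f (Z k \<omega>) - f (t (U k \<omega>))) + (\<Sum>n=k+1..k+hit k \<omega>. f (Z n \<omega>)) - real (hit k \<omega>) * \<Gamma> N \<omega>)) / real N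
      - of_bool (N > 0) * chain.mean (\<lambda>z. \<kappa> z * (V z - (\<Sum>a\<in>F. q z a * V (t a)))) =
      (\<Sum>k=1..N. g (Y k \<omega>)) / real N
      - of_bool (N > 0) * chain.mean (\<lambda>z. \<kappa> z * (V z - (\<Sum>a\<in>F. q z a * V (t a)))) +
      (S N \<omega> / real N + (R N \<omega> / real N + (?m - \<Gamma> N \<omega>) * (H N \<omega> / real N)))"
      using AE_hits AE_space
    proof eventually_elim
      case (elim \<omega>)
      show ?case unfolding decomp[OF elim(2) elim(1)] by (simp add: add_divide_distrib)
    qed
  qed
qed

end

section \<open>Derivatives of the transition probabilities\<close>

text \<open>\<open>D n\<close> plays the derivative of the \<open>n\<close>-th iterate, with the
  product rule as recursion. Its partial sums obey the same recursion with input \<open>P'\<close>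
  applied to the partial sums of \<open>T^n f\<close>. These converge only after centring, but
  \<open>P'\<close> annihilates constants, so the input converges geometrically to
  \<open>P' V\<close>.\<close>

lemma (in primitive_matrix) derivative_sums_bound:
  assumes V: "\<And>z. z \<in> E \<Longrightarrow> V z - T V z = f z - mean f"
    and P'_sum: "\<And>z. z \<in> E \<Longrightarrow> (\<Sum>w\<in>E. P' z w) = 0"
    and D_0: "\<And>z. z \<in> E \<Longrightarrow> D 0 z = 0"
    and D_Suc: "\<And>n z. z \<in> E \<Longrightarrow> D (Suc n) z = T (D n) z + (\<Sum>w\<in>E. P' z w * (T ^^ n) f w)"
  shows "\<exists>B. \<forall>N. \<forall>z\<in>E. \<bar>(\<Sum>n=1..N. D n z) - real N * mean (\<lambda>z. \<Sum>w\<in>E. P' z w * V w)\<bar> \<le> B"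
proof -
  obtain C r where r: "0 < r" "r < 1"
    and conv: "\<And>n z. z \<in> E \<Longrightarrow> \<bar>(T ^^ n) V z - mean V\<bar> \<le> C * r ^ n"
    using geometric_convergence[of V] by blast
  have "C \<ge> 0"
    using E_nonempty conv[of _ 0] by (metis abs_ge_zero ex_in_conv mult.right_neutral order_trans power_0)
  have telescope: "(\<Sum>n\<le>N. (T ^^ n) f z - mean f) = V z - (T ^^ Suc N) V z" if "z \<in> E" for N z
  proof -
    have step: "(T ^^ n) f z - mean f = (T ^^ n) V z - (T ^^ Suc n) V z" if "z \<in> E" for n z
      using that
    proof (induction n arbitrary: z)
      case 0
      then show ?case using V by simp
    next
      case (Suc n)
      have "(T ^^ Suc n) f z - mean f = T (\<lambda>w. (T ^^ n) f w - mean f) z"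
        using Suc.prems by (simp add: trans_op_diff T_const)
      also have "\<dots> = T (\<lambda>w. (T ^^ n) V w - (T ^^ Suc n) V w) z"
        using Suc.IH by (rule trans_op_cong)
      finally show ?case by (simp add: trans_op_diff)
    qed
    show ?thesis
    proof (induction N)
      case 0
      show ?case by (simp add: V[OF that])
    next
      case (Suc N)
      then show ?case unfolding sum.atMost_Suc using step[OF that, of "Suc N"] by linarith
    qed
  qed
  define S where "S N z = (\<Sum>n\<le>N. D n z)" for N z
  define b where "b N z = (\<Sum>w\<in>E. P' z w * (\<Sum>n\<le>N. (T ^^ n) f w))" for N z
  obtain Q where Q: "Q \<ge> 0" "\<And>y. y \<in> E \<times> E \<Longrightarrow> \<bar>P' (fst y) (snd y)\<bar> \<le> Q"
    by (rule finite_abs_bounded[of "E \<times> E" "\<lambda>y. P' (fst y) (snd y)"]) auto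
  \<comment> \<open>Both the growing constant \<open>(N + 1) mean f\<close> and the constant
    \<open>mean V\<close> are invisible to \<open>P'\<close>. Inserting the latter exhibits the
    geometrically small factor.\<close>
  have b_eq: "b N z - (\<Sum>w\<in>E. P' z w * V w) = (\<Sum>w\<in>E. P' z w * (mean V - (T ^^ Suc N) V w))"
    if z: "z \<in> E" for N z
  proof -
    have *: "(\<Sum>n\<le>N. (T ^^ n) f w) = V w - (T ^^ Suc N) V w + real (Suc N) * mean f" if "w \<in> E" for w
      using telescope[OF that, of N] by (simp add: sum_subtractf)
    have "b N z - (\<Sum>w\<in>E. P' z w * V w) =
        (\<Sum>w\<in>E. P' z w * (mean V - (T ^^ Suc N) V w)) + (\<Sum>w\<in>E. P' z w) * (real (Suc N) * mean f - mean V)"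
      unfolding b_def sum_distrib_right sum_subtractf[symmetric] sum.distrib[symmetric]
      by (intro sum.cong refl) (subst *, auto simp: algebra_simps)
    then show ?thesis by (simp add: P'_sum[OF z])
  qed
  have b_bound: "\<bar>b N z - (\<Sum>w\<in>E. P' z w * V w)\<bar> \<le> (real (card E) * (Q * C)) * r ^ N"
    if z: "z \<in> E" for N z
  proof -
    have "\<bar>b N z - (\<Sum>w\<in>E. P' z w * V w)\<bar> \<le> (\<Sum>w\<in>E. Q * (C * r ^ N))"
      unfolding b_eq[OF z]
    proof (rule order_trans[OF sum_abs], rule sum_mono)
      fix w assume w: "w \<in> E"
      have "\<bar>mean V - (T ^^ Suc N) V w\<bar> \<le> C * r ^ Suc N"
        using conv[OF w, of "Suc N"] by (simp add: abs_minus_commute)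
      also have "\<dots> \<le> C * r ^ N"
        using r \<open>C \<ge> 0\<close> by (intro mult_left_mono power_decreasing) auto
      finally have "\<bar>P' z w\<bar> * \<bar>mean V - (T ^^ Suc N) V w\<bar> \<le> Q * (C * r ^ N)"
        using Q(1) Q(2)[of "(z, w)"] z w by (intro mult_mono) auto
      then show "\<bar>P' z w * (mean V - (T ^^ Suc N) V w)\<bar> \<le> Q * (C * r ^ N)" by (simp add: abs_mult)
    qed
    then show ?thesis by simp
  qed
  have S_Suc: "S (Suc N) z = T (S N) z + b N z" if z: "z \<in> E" for N z
  proof -
    have "S (Suc N) z = (\<Sum>n\<le>N. D (Suc n) z)"
      unfolding S_def by (subst sum.atMost_Suc_shift) (simp add: D_0 z)
    also have "\<dots> = (\<Sum>n\<le>N. T (D n) z) + (\<Sum>n\<le>N. \<Sum>w\<in>E. P' z w * (T ^^ n) f w)"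
      by (simp add: D_Suc z sum.distrib)
    also have "(\<Sum>n\<le>N. T (D n) z) = T (S N) z"
      unfolding S_def by (simp add: trans_op_sum)
    also have "(\<Sum>n\<le>N. \<Sum>w\<in>E. P' z w * (T ^^ n) f w) = b N z"
      unfolding b_def by (subst sum.swap) (simp add: sum_distrib_left)
    finally show ?thesis .
  qed
  have S0: "S 0 z = 0" if "z \<in> E" for z using that by (simp add: S_def D_0)
  have "(\<Sum>n=1..N. D n z) = S N z" if "z \<in> E" for N z
    using D_0[OF that] by (simp add: S_def atMost_atLeast0 sum.atLeast_Suc_atMost)
  with forced_iteration_bound[of S b "\<lambda>z. \<Sum>w\<in>E. P' z w * V w", OF S0 S_Suc b_bound r]
  show ?thesis by simp
qed

text \<open>Conditional probabilities are fixed only on histories of positive probability. In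
  product form the Markov property holds on null histories too, as both sides vanish.\<close>

lemma markov_chain_imp_finite_markov_process:
  assumes "markov_chain M E P Z" "stochastic_matrix E P"
  shows "finite_markov_process M E P Z"
proof -
  interpret prob_space M using assms(1) by (simp add: markov_chain_def)
  have Z: "Z n \<in> M \<rightarrow>\<^sub>M count_space E" for n using assms(1) by (simp add: markov_chain_def)
  have [measurable]: "Measurable.pred M (\<lambda>\<omega>. Z n \<omega> = y)" for n y
    by (rule measurable_compose[OF Z]) simp
  have "prob {\<omega>\<in>space M. (\<forall>m\<le>n. Z m \<omega> = h m) \<and> Z (Suc n) \<omega> = y} =
      prob {\<omega>\<in>space M. \<forall>m\<le>n. Z m \<omega> = h m} * P (h n) y" if y: "y \<in> E" for n h y
  proof (cases "prob {\<omega>\<in>space M. \<forall>m\<le>n. Z m \<omega> = h m} > 0")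
    case True
    with assms(1) y have "cond_prob M (\<lambda>\<omega>. Z (Suc n) \<omega> = y) (\<lambda>\<omega>. \<forall>m\<le>n. Z m \<omega> = h m) = P (h n) y"
      unfolding markov_chain_def by blast
    then show ?thesis using True by (simp add: cond_prob_def field_simps conj_commute)
  next
    case False
    then have 0: "prob {\<omega>\<in>space M. \<forall>m\<le>n. Z m \<omega> = h m} = 0" by (simp add: zero_less_measure_iff)
    have "prob {\<omega>\<in>space M. (\<forall>m\<le>n. Z m \<omega> = h m) \<and> Z (Suc n) \<omega> = y} \<le>
        prob {\<omega>\<in>space M. \<forall>m\<le>n. Z m \<omega> = h m}"
      by (rule finite_measure_mono) auto
    then have "prob {\<omega>\<in>space M. (\<forall>m\<le>n. Z m \<omega> = h m) \<and> Z (Suc n) \<omega> = y} = 0"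
      using 0 by (simp add: measure_le_0_iff)
    then show ?thesis using 0 by simp
  qed
  with Z show ?thesis
    using assms(2) prob_space_axioms
    by (intro finite_markov_process.intro finite_markov_process_axioms.intro)
qed

text \<open>An action below \<open>p - 1\<close> is decided before \<alpha>(i,p) is consulted,
  action \<open>p - 1\<close> carries its squared cosine and later actions its squared sine. The
  last case is kept as a multiple of \<open>\<theta>\<close> because these probabilities, once
  normalised, are the law of the replacement action.\<close>

definition theta_deriv :: "('s \<Rightarrow> nat) \<Rightarrow> ('s \<Rightarrow> nat \<Rightarrow> real) \<Rightarrow> 's \<Rightarrow> nat \<Rightarrow> nat \<Rightarrow> real" where
  "theta_deriv d \<alpha> i p a =
    (if a < p - 1 then 0
     else if a = p - 1 then - 2 * cos (\<alpha> i p) * sin (\<alpha> i p) * (\<Prod>m=1..p - 1. (sin (\<alpha> i m))\<^sup>2)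
     else 2 * sin (\<alpha> i p) * cos (\<alpha> i p) * (\<theta> d \<alpha> i a / (sin (\<alpha> i p))\<^sup>2))"

definition trans_deriv ::
  "('s \<Rightarrow> nat) \<Rightarrow> ('s \<Rightarrow> nat \<Rightarrow> 's pmf) \<Rightarrow> ('s \<Rightarrow> nat \<Rightarrow> real) \<Rightarrow> 's \<Rightarrow> nat \<Rightarrow> 's \<times> nat \<Rightarrow> 's \<times> nat \<Rightarrow> real" where
  "trans_deriv d A \<alpha> i p z w =
    pmf (A (fst z) (snd z)) (fst w) * (if fst w = i then theta_deriv d \<alpha> i p (snd w) else 0)"

primrec iterate_deriv :: "('s \<Rightarrow> nat) \<Rightarrow> ('s \<Rightarrow> nat \<Rightarrow> 's pmf) \<Rightarrow> ('s \<times> nat \<Rightarrow> real) \<Rightarrow> ('s \<Rightarrow> nat \<Rightarrow> real) \<Rightarrow>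
    's \<Rightarrow> nat \<Rightarrow> nat \<Rightarrow> 's \<times> nat \<Rightarrow> real" where
  "iterate_deriv d A c \<alpha> i p 0 = (\<lambda>z. 0)"
| "iterate_deriv d A c \<alpha> i p (Suc n) = (\<lambda>z. trans_op (states d) (trans_prob d A \<alpha>) (iterate_deriv d A c \<alpha> i p n) z
    + (\<Sum>w\<in>states d. trans_deriv d A \<alpha> i p z w * (trans_op (states d) (trans_prob d A \<alpha>) ^^ n) c w))"

section \<open>Dependence of policy, transition matrix and mean cost on one coordinate\<close>

context
  fixes d :: "'s::finite \<Rightarrow> nat"
  assumes d_ge_1: "\<And>j. d j \<ge> 1"
begin

lemma states_Sigma: "states d = Sigma UNIV (\<lambda>j. {..d j})"
  by (auto simp: states_def)

lemma finite_states: "finite (states d)"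
  by (auto simp: states_Sigma)

lemma sum_states: "(\<Sum>z\<in>states d. f z) = (\<Sum>j\<in>UNIV. \<Sum>a\<le>d j. f (j, a))"
  unfolding states_Sigma by (subst sum.Sigma) auto

lemma theta_nonneg: "\<theta> d \<beta> j a \<ge> 0"
  by (auto simp: \<theta>_def intro!: mult_nonneg_nonneg prod_nonneg)

text \<open>Descending from \<open>p = d j\<close>, each step merges a squared cosine with the
  matching squared sine. The case \<open>p = 0\<close> says that \<open>\<theta>\<close> is a
  distribution; the general case supplies the normalising constant for the replacement
  action.\<close>

lemma theta_tail_sum:
  assumes "p \<le> d j"
  shows "(\<Sum>a=p..d j. \<theta> d \<beta> j a) = (\<Prod>m=1..p. (sin (\<beta> j m))\<^sup>2)"
  using assms
proof (induction rule: inc_induct)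
  case base
  have "d j \<noteq> 0" using d_ge_1[of j] by simp
  then show ?case by (simp add: \<theta>_def)
next
  case (step p)
  have "\<theta> d \<beta> j p = (cos (\<beta> j (Suc p)))\<^sup>2 * (\<Prod>m=1..p. (sin (\<beta> j m))\<^sup>2)"
    using step by (auto simp: \<theta>_def)
  moreover have "(\<Sum>a=p..d j. \<theta> d \<beta> j a) = \<theta> d \<beta> j p + (\<Sum>a=Suc p..d j. \<theta> d \<beta> j a)"
    using step by (intro sum.atLeast_Suc_atMost) auto
  ultimately show ?case using step.IH
    by (simp add: sin_squared_eq algebra_simps)
qed

lemma theta_sum: "(\<Sum>a\<le>d j. \<theta> d \<beta> j a) = 1"
  using theta_tail_sum[of 0 j \<beta>] by (simp add: atMost_atLeast0)

lemma stochastic_trans_prob: "stochastic_matrix (states d) (trans_prob d A \<beta>)"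
proof
  show "states d \<noteq> {}" by (auto simp: states_def)
  show "(\<Sum>w\<in>states d. trans_prob d A \<beta> z w) = 1" for z
  proof -
    have "(\<Sum>w\<in>states d. trans_prob d A \<beta> z w) =
        (\<Sum>j\<in>UNIV. pmf (A (fst z) (snd z)) j * (\<Sum>a\<le>d j. \<theta> d \<beta> j a))"
      by (simp add: sum_states trans_prob_def sum_distrib_left)
    then show ?thesis by (simp add: theta_sum sum_pmf_eq_1)
  qed
qed (auto simp: finite_states trans_prob_def theta_nonneg)

lemma prod_sin_set_coord:
  "(\<Prod>m=1..n. (sin (set_coord \<alpha> i p x i m))\<^sup>2) =
    (if p \<in> {1..n} then (sin x)\<^sup>2 * (\<Prod>m\<in>{1..n} - {p}. (sin (\<alpha> i m))\<^sup>2)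
     else (\<Prod>m=1..n. (sin (\<alpha> i m))\<^sup>2))"
proof (cases "p \<in> {1..n}")
  case True
  have "(\<Prod>m=1..n. (sin (set_coord \<alpha> i p x i m))\<^sup>2) =
      (sin (set_coord \<alpha> i p x i p))\<^sup>2 * (\<Prod>m\<in>{1..n} - {p}. (sin (set_coord \<alpha> i p x i m))\<^sup>2)"
    using True by (intro prod.remove) auto
  also have "(\<Prod>m\<in>{1..n} - {p}. (sin (set_coord \<alpha> i p x i m))\<^sup>2) = (\<Prod>m\<in>{1..n} - {p}. (sin (\<alpha> i m))\<^sup>2)"
    by (intro prod.cong) (auto simp: set_coord_def)
  finally show ?thesis using True by (simp add: set_coord_def)
qed (auto simp: set_coord_def intro!: prod.cong)

lemma set_coord_same: "set_coord \<alpha> i p (\<alpha> i p) = \<alpha>"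
  by (simp add: set_coord_def)

lemma theta_set_coord_other: "j \<noteq> i \<Longrightarrow> \<theta> d (set_coord \<alpha> i p x) j a = \<theta> d \<alpha> j a"
  by (simp add: \<theta>_def set_coord_def)

lemma theta_pred: "1 \<le> p \<Longrightarrow> p \<le> d i \<Longrightarrow>
    \<theta> d \<alpha> i (p - 1) = (cos (\<alpha> i p))\<^sup>2 * (\<Prod>m=1..p - 1. (sin (\<alpha> i m))\<^sup>2)"
  by (auto simp: \<theta>_def)

lemma theta_set_coord:
  assumes p: "p \<in> {1..d i}" and a: "a \<le> d i" and s: "sin (\<alpha> i p) \<noteq> 0"
  shows "\<theta> d (set_coord \<alpha> i p x) i a =
    (if a < p - 1 then \<theta> d \<alpha> i a
     else if a = p - 1 then (cos x)\<^sup>2 * (\<Prod>m=1..p - 1. (sin (\<alpha> i m))\<^sup>2)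
     else (sin x)\<^sup>2 * (\<theta> d \<alpha> i a / (sin (\<alpha> i p))\<^sup>2))"
proof -
  consider "a < p - 1" | "a = p - 1" | "p \<le> a" by linarith
  then show ?thesis
  proof cases
    case 1
    then have "p \<notin> {1..a}" "a < d i" "a + 1 \<noteq> p" using p by auto
    then show ?thesis using 1
      by (auto simp: \<theta>_def prod_sin_set_coord simp del: One_nat_def) (auto simp: set_coord_def)
  next
    case 2
    have np: "p \<notin> {1..p - 1}" using p by auto
    show ?thesis
      using theta_pred[of p i "set_coord \<alpha> i p x"] p 2
      unfolding prod_sin_set_coord if_not_P[OF np] by (simp add: set_coord_def)
  next
    case 3
    \<comment> \<open>All factors of \<open>\<theta>\<close> that do not involve the coordinate
      \<open>p\<close>. Evaluating at the old value of the coordinate expresses \<open>r\<close> as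
      \<open>\<theta>\<close> divided by the squared sine.\<close>
    define r where "r = (if a < d i then (cos (\<alpha> i (a + 1)))\<^sup>2 else 1) * (\<Prod>m\<in>{1..a} - {p}. (sin (\<alpha> i m))\<^sup>2)"
    have eq: "\<theta> d (set_coord \<alpha> i p y) i a = (sin y)\<^sup>2 * r" for y
    proof -
      have "\<theta> d (set_coord \<alpha> i p y) i a = (if a < d i then (cos (\<alpha> i (a + 1)))\<^sup>2 else 1) *
          (\<Prod>m=1..a. (sin (set_coord \<alpha> i p y i m))\<^sup>2)"
        using 3 p a by (auto simp: \<theta>_def set_coord_def)
      then show ?thesis using 3 p unfolding prod_sin_set_coord r_def by auto
    qed
    moreover have "\<not> a < p - 1" "a \<noteq> p - 1" using 3 p by auto
    ultimately show ?thesis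
      using eq[of x] eq[of "\<alpha> i p"] s by (simp add: set_coord_same)
  qed
qed

lemma theta_has_derivative:
  assumes p: "p \<in> {1..d i}" and a: "a \<le> d j" and s: "sin (\<alpha> i p) \<noteq> 0"
  shows "((\<lambda>x. \<theta> d (set_coord \<alpha> i p x) j a) has_real_derivative
    (if j = i then theta_deriv d \<alpha> i p a else 0)) (at (\<alpha> i p))"
proof (cases "j = i")
  case True
  have c: "((\<lambda>x. (cos x)\<^sup>2 * r) has_real_derivative - 2 * cos y * sin y * r) (at y)" for r y :: real
    by (auto intro!: derivative_eq_intros)
  have s': "((\<lambda>x. (sin x)\<^sup>2 * r) has_real_derivative 2 * sin y * cos y * r) (at y)" for r y :: real
    by (auto intro!: derivative_eq_intros)
  show ?thesis
    using True a c s' by (simp add: theta_set_coord[of p i _ \<alpha>, OF p _ s] theta_deriv_def del: times_divide_eq_right)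
next
  case False
  then show ?thesis by (simp add: theta_set_coord_other)
qed

lemma trans_prob_has_derivative:
  assumes "p \<in> {1..d i}" "w \<in> states d" "sin (\<alpha> i p) \<noteq> 0"
  shows "((\<lambda>x. trans_prob d A (set_coord \<alpha> i p x) z w) has_real_derivative trans_deriv d A \<alpha> i p z w)
    (at (\<alpha> i p))"
  unfolding trans_prob_def trans_deriv_def
  by (rule DERIV_cmult, rule theta_has_derivative) (use assms in \<open>auto simp: states_def\<close>)

text \<open>The row sums are the constant 1 for all values of the parameter. Hence the gradient
  formula is unaffected by the additive constant left free in \<open>V\<close>.\<close>

lemma trans_deriv_sum:
  assumes "p \<in> {1..d i}" "sin (\<alpha> i p) \<noteq> 0"
  shows "(\<Sum>w\<in>states d. trans_deriv d A \<alpha> i p z w) = 0"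
proof -
  have sum1: "(\<Sum>w\<in>states d. trans_prob d A \<beta> z w) = 1" for \<beta>
  proof -
    have "(\<Sum>w\<in>states d. trans_prob d A \<beta> z w) =
        (\<Sum>j\<in>UNIV. pmf (A (fst z) (snd z)) j * (\<Sum>a\<le>d j. \<theta> d \<beta> j a))"
      by (simp add: sum_states trans_prob_def sum_distrib_left)
    then show ?thesis by (simp add: theta_sum sum_pmf_eq_1)
  qed
  have "((\<lambda>x. \<Sum>w\<in>states d. trans_prob d A (set_coord \<alpha> i p x) z w) has_real_derivative
      (\<Sum>w\<in>states d. trans_deriv d A \<alpha> i p z w)) (at (\<alpha> i p))"
    by (intro DERIV_sum trans_prob_has_derivative assms)
  moreover have "((\<lambda>x. \<Sum>w\<in>states d. trans_prob d A (set_coord \<alpha> i p x) z w) has_real_derivative 0) (at (\<alpha> i p))"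
    unfolding sum1 by simp
  ultimately show ?thesis by (rule DERIV_unique)
qed

lemma iterate_has_derivative:
  assumes "p \<in> {1..d i}" "sin (\<alpha> i p) \<noteq> 0"
  shows "((\<lambda>x. (trans_op (states d) (trans_prob d A (set_coord \<alpha> i p x)) ^^ n) c z) has_real_derivative
    iterate_deriv d A c \<alpha> i p n z) (at (\<alpha> i p))"
proof (induction n arbitrary: z)
  case (Suc n)
  have "((\<lambda>x. \<Sum>w\<in>states d. trans_prob d A (set_coord \<alpha> i p x) z w *
        (trans_op (states d) (trans_prob d A (set_coord \<alpha> i p x)) ^^ n) c w) has_real_derivative
      (\<Sum>w\<in>states d. trans_deriv d A \<alpha> i p z w *
          (trans_op (states d) (trans_prob d A (set_coord \<alpha> i p (\<alpha> i p))) ^^ n) c w +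
        iterate_deriv d A c \<alpha> i p n w * trans_prob d A (set_coord \<alpha> i p (\<alpha> i p)) z w)) (at (\<alpha> i p))"
    by (intro DERIV_sum DERIV_mult trans_prob_has_derivative assms Suc)
  moreover have "(trans_op (states d) (trans_prob d A (set_coord \<alpha> i p x)) ^^ Suc n) c z =
      (\<Sum>w\<in>states d. trans_prob d A (set_coord \<alpha> i p x) z w *
        (trans_op (states d) (trans_prob d A (set_coord \<alpha> i p x)) ^^ n) c w)" for x
    unfolding funpow.simps comp_apply by (rule trans_op_def)
  moreover have "iterate_deriv d A c \<alpha> i p (Suc n) z = (\<Sum>w\<in>states d. trans_deriv d A \<alpha> i p z w *
          (trans_op (states d) (trans_prob d A (set_coord \<alpha> i p (\<alpha> i p))) ^^ n) c w +
        iterate_deriv d A c \<alpha> i p n w * trans_prob d A (set_coord \<alpha> i p (\<alpha> i p)) z w)"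
    unfolding iterate_deriv.simps trans_op_def[of _ _ "iterate_deriv d A c \<alpha> i p n"] set_coord_same
      sum.distrib by (simp add: mult.commute)
  ultimately show ?case by simp
qed simp

text \<open>The measure enters the right-hand side only through the law of \<open>Z 0\<close>. As
  that law is common to all parameters, the remaining dependence lies in the transition
  matrix.\<close>

lemma mean_cost_eq:
  assumes "finite_markov_process M (states d) P Z"
  shows "prob_space.expectation M (\<lambda>\<omega>. 1 / real N * (\<Sum>n=1..N. c (Z n \<omega>))) =
    1 / real N * (\<Sum>n=1..N. \<integral>z. (trans_op (states d) P ^^ n) c z
      \<partial>distr M (count_space (states d)) (Z 0))"
proof -
  interpret finite_markov_process M "states d" P Z by (rule assms)
  have int: "integrable M (\<lambda>\<omega>. c (Z n \<omega>))" for n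
    by (rule adapted_integrable[of n]) (simp add: adapted_of_Y)
  have "expectation (\<lambda>\<omega>. c (Z n \<omega>)) = (\<integral>z. (T ^^ n) c z \<partial>distr M (count_space (states d)) (Z 0))" for n
    using expectation_steps[of 0 "\<lambda>_. 1" c n]
    by (subst integral_distr[OF Y_measurable]) (auto simp: adapted_const)
  then show ?thesis using int by (simp add: Bochner_Integration.integral_sum)
qed

lemma integral_distr_states:
  assumes "finite_markov_process M (states d) P Z"
  shows "(\<integral>z. f z \<partial>distr M (count_space (states d)) (Z 0)) =
    (\<Sum>z\<in>states d. measure M {\<omega>\<in>space M. Z 0 \<omega> = z} * f z)"
proof -
  interpret finite_markov_process M "states d" P Z by (rule assms)
  have "(\<integral>z. f z \<partial>distr M (count_space (states d)) (Z 0)) = expectation (\<lambda>\<omega>. f (Z 0 \<omega>))"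
    by (rule integral_distr[OF Y_measurable]) simp
  also have "\<dots> = expectation (\<lambda>\<omega>. \<Sum>z\<in>states d. f z * indicator {\<omega>\<in>space M. Z 0 \<omega> = z} \<omega>)"
    by (rule Bochner_Integration.integral_cong[OF refl])
      (use Y_in_E in \<open>simp add: indicator_def finite_states if_distrib cong: if_cong\<close>)
  also have "\<dots> = (\<Sum>z\<in>states d. expectation (\<lambda>\<omega>. f z * indicator {\<omega>\<in>space M. Z 0 \<omega> = z} \<omega>))"
    using pred_of_Y[of "\<lambda>y. y = z" 0 for z]
    by (intro Bochner_Integration.integral_sum integrable_mult_right integrable_real_indicator)
      (auto simp: pred_def less_top[symmetric])
  finally show ?thesis by (simp add: mult.commute)
qed

end

text \<open>For \<open>p < d i\<close> the state is ignored, reflecting independence of the chain.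
  For \<open>p = d i\<close> this is the point mass at the exchanged action, and at 0 if the current
  action is neither of the last two.\<close>

definition mark_law :: "('s \<Rightarrow> nat) \<Rightarrow> ('s \<Rightarrow> nat \<Rightarrow> real) \<Rightarrow> 's \<Rightarrow> nat \<Rightarrow> 's \<times> nat \<Rightarrow> nat \<Rightarrow> real" where
  "mark_law d \<alpha> i p z a =
    (if p < d i then (if p \<le> a then \<theta> d \<alpha> i a / (\<Prod>m=1..p. (sin (\<alpha> i m))\<^sup>2) else 0)
     else of_bool (a = d i * of_bool (snd z = d i - 1) + (d i - 1) * of_bool (snd z = d i)))"

section \<open>The gradient expressed through the Poisson solution\<close>

context
  fixes d :: "'s::finite \<Rightarrow> nat"
  assumes d_ge_1: "\<And>j. d j \<ge> 1"
begin

lemma interior_sin_cos_pos: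
  assumes "interior_param d \<alpha>" "m \<in> {1..d i}"
  shows "sin (\<alpha> i m) > 0" "cos (\<alpha> i m) > 0"
  using assms by (auto simp: interior_param_def intro!: sin_gt_zero cos_gt_zero dest!: spec[of _ i] bspec[of _ _ m])

lemma prod_sin_pos:
  assumes "interior_param d \<alpha>" "n \<le> d i"
  shows "(\<Prod>m=1..n. (sin (\<alpha> i m))\<^sup>2) > 0"
proof (rule prod_pos)
  fix m assume "m \<in> {1..n}"
  then have "sin (\<alpha> i m) > 0" using assms by (intro interior_sin_cos_pos(1)) auto
  then show "0 < (sin (\<alpha> i m))\<^sup>2" by simp
qed

lemma mark_law_sum:
  assumes int: "interior_param d \<alpha>" and p: "p \<in> {1..d i}"
  shows "(\<Sum>a\<in>{..d i}. mark_law d \<alpha> i p z a) = 1"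
proof (cases "p < d i")
  case True
  have "(\<Sum>a\<in>{..d i}. mark_law d \<alpha> i p z a) = (\<Sum>a=p..d i. \<theta> d \<alpha> i a / (\<Prod>m=1..p. (sin (\<alpha> i m))\<^sup>2))"
    by (rule sum.mono_neutral_cong_right) (use True in \<open>auto simp: mark_law_def\<close>)
  also have "\<dots> = (\<Sum>a=p..d i. \<theta> d \<alpha> i a) / (\<Prod>m=1..p. (sin (\<alpha> i m))\<^sup>2)"
    by (simp add: sum_divide_distrib)
  also have "\<dots> = 1"
    unfolding theta_tail_sum[where d = d and p = p and j = i, OF d_ge_1 less_imp_le[OF True]]
    by (rule divide_self[OF less_imp_neq[OF prod_sin_pos[OF int less_imp_le[OF True]], symmetric]])
  finally show ?thesis .
next
  case False
  have "d i * of_bool (snd z = d i - 1) + (d i - 1) * of_bool (snd z = d i) \<in> {..d i}"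
    using d_ge_1[of i] by auto
  then show ?thesis using False by (simp add: mark_law_def of_bool_def)
qed

text \<open>With \<open>s\<close>, \<open>k\<close> the sine and cosine of \<alpha>(i,p) and
  \<open>R\<close> the preceding product, the left side is \<open>2 \<rho> k s R\<close> times the
  mean of \<open>V\<close> over the replacement action minus \<open>V (i, p - 1)\<close>. If
  \<open>p < d i\<close>, then \<open>K\<close> sees only \<open>(i, p - 1)\<close>, whose
  stationary weight \<open>\<rho> k\<^sup>2 R\<close> times \<open>- s / k\<close> gives the same up
  to the factor 2. If \<open>p = d i\<close>, the two visited states contribute in proportion to
  \<open>k\<^sup>2\<close> and \<open>s\<^sup>2\<close>, which add to 1.\<close>

lemma gradient_identity:
  assumes int: "interior_param d \<alpha>" and p: "p \<in> {1..d i}"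
    and prim: "primitive_matrix (states d) (trans_prob d A \<alpha>) L \<epsilon>"
  shows "primitive_matrix.mean (states d) (trans_prob d A \<alpha>)
      (\<lambda>z. \<Sum>w\<in>states d. trans_deriv d A \<alpha> i p z w * V w) =
    2 * primitive_matrix.mean (states d) (trans_prob d A \<alpha>)
      (\<lambda>z. K d i p \<alpha> z * (V z - (\<Sum>a\<in>{..d i}. mark_law d \<alpha> i p z a * V (i, a))))"
proof -
  interpret primitive_matrix "states d" "trans_prob d A \<alpha>" L \<epsilon> by (rule prim)
  define s where "s = sin (\<alpha> i p)"
  define k where "k = cos (\<alpha> i p)"
  define R where "R = (\<Prod>m=1..p - 1. (sin (\<alpha> i m))\<^sup>2)"
  have sk: "s > 0" "k > 0" using interior_sin_cos_pos[OF int p] by (auto simp: s_def k_def)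
  have sk1: "s\<^sup>2 + k\<^sup>2 = 1" by (simp add: s_def k_def)
  have R: "R > 0" unfolding R_def using p by (intro prod_sin_pos[OF int]) auto
  have prod_p: "(\<Prod>m=1..p. (sin (\<alpha> i m))\<^sup>2) = s\<^sup>2 * R"
    using p by (cases p) (auto simp: s_def R_def)
  have theta_pm: "\<theta> d \<alpha> i (p - 1) = k\<^sup>2 * R"
    using p theta_pred[OF d_ge_1, where p = p and i = i and \<alpha> = \<alpha>] by (simp add: k_def R_def)
  \<comment> \<open>The stationary probability of entering state \<open>i\<close>. Invariance makes
    the stationary weights at \<open>i\<close> proportional to the policy, as the action is drawn
    afresh on arrival.\<close>
  define \<rho> where "\<rho> = (\<Sum>z\<in>states d. st z * pmf (A (fst z) (snd z)) i)"
  have st: "st (i, a) = \<rho> * \<theta> d \<alpha> i a" if "a \<le> d i" for a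
  proof -
    have "(i, a) \<in> states d" using that by (simp add: states_def)
    then have "st (i, a) = (\<Sum>z\<in>states d. st z * trans_prob d A \<alpha> z (i, a))"
      using stationary_invariant by (auto simp: invariant_dist_def)
    then show ?thesis by (simp add: trans_prob_def \<rho>_def sum_distrib_right mult.assoc)
  qed
  have inner: "(\<Sum>w\<in>states d. trans_deriv d A \<alpha> i p z w * V w) =
      pmf (A (fst z) (snd z)) i * (\<Sum>a\<le>d i. theta_deriv d \<alpha> i p a * V (i, a))" for z
  proof -
    have "(\<Sum>w\<in>states d. trans_deriv d A \<alpha> i p z w * V w) =
        (\<Sum>j\<in>UNIV. if j = i then pmf (A (fst z) (snd z)) j *
          (\<Sum>a\<le>d j. theta_deriv d \<alpha> i p a * V (j, a)) else 0)"
      unfolding sum_states[OF d_ge_1]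
      by (intro sum.cong refl) (auto simp: trans_deriv_def sum_distrib_left mult.assoc)
    then show ?thesis by simp
  qed
  have "(\<Sum>a\<le>d i. theta_deriv d \<alpha> i p a * V (i, a)) = (\<Sum>a=p-1..d i. theta_deriv d \<alpha> i p a * V (i, a))"
    by (rule sum.mono_neutral_right) (auto simp: theta_deriv_def)
  also have "\<dots> = theta_deriv d \<alpha> i p (p - 1) * V (i, p - 1) + (\<Sum>a=p..d i. theta_deriv d \<alpha> i p a * V (i, a))"
    using p by (subst sum.atLeast_Suc_atMost) auto
  also have "theta_deriv d \<alpha> i p (p - 1) = - 2 * k * s * R"
    by (simp add: theta_deriv_def k_def s_def R_def)
  also have "(\<Sum>a=p..d i. theta_deriv d \<alpha> i p a * V (i, a)) = 2 * k / s * (\<Sum>a=p..d i. \<theta> d \<alpha> i a * V (i, a))"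
    unfolding sum_distrib_left
  proof (rule sum.cong[OF refl])
    fix a assume "a \<in> {p..d i}"
    then have "\<not> a < p - 1" "a \<noteq> p - 1" using p by auto
    then show "theta_deriv d \<alpha> i p a * V (i, a) = 2 * k / s * (\<theta> d \<alpha> i a * V (i, a))"
      using sk by (simp add: theta_deriv_def k_def s_def power2_eq_square)
  qed
  finally have lhs: "mean (\<lambda>z. \<Sum>w\<in>states d. trans_deriv d A \<alpha> i p z w * V w) =
      \<rho> * (- 2 * k * s * R * V (i, p - 1) + 2 * k / s * (\<Sum>a=p..d i. \<theta> d \<alpha> i a * V (i, a)))"
    unfolding mean_def inner by (simp add: \<rho>_def sum_distrib_right mult.assoc)
  have pick: "(\<Sum>z\<in>states d. h z * of_bool (z = (i, a))) = h (i, a)" if "a \<le> d i" for h :: "'s \<times> nat \<Rightarrow> real" and a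
    using that by (simp add: states_def finite_states[OF d_ge_1, unfolded states_def] of_bool_def if_distrib cong: if_cong)
  let ?G = "\<lambda>z. V z - (\<Sum>a\<in>{..d i}. mark_law d \<alpha> i p z a * V (i, a))"
  show ?thesis
  proof (cases "p < d i")
    case True
    have "mean (\<lambda>z. K d i p \<alpha> z * ?G z) = (\<Sum>z\<in>states d. (st z * (- tan (\<alpha> i p)) * ?G z) * of_bool (z = (i, p - 1)))"
      unfolding mean_def using True by (intro sum.cong refl) (simp add: K_def \<delta>_def)
    also have "\<dots> = st (i, p - 1) * (- tan (\<alpha> i p)) * ?G (i, p - 1)"
      using True by (intro pick) auto
    also have "(\<Sum>a\<in>{..d i}. mark_law d \<alpha> i p (i, p - 1) a * V (i, a)) =
        (\<Sum>a=p..d i. \<theta> d \<alpha> i a * V (i, a) / (s\<^sup>2 * R))"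
      by (rule sum.mono_neutral_cong_right) (use True in \<open>auto simp: mark_law_def prod_p[symmetric]\<close>)
    also have "\<dots> = (\<Sum>a=p..d i. \<theta> d \<alpha> i a * V (i, a)) / (s\<^sup>2 * R)"
      by (simp add: sum_divide_distrib)
    also have "st (i, p - 1) = \<rho> * (k\<^sup>2 * R)" using st[of "p - 1"] p theta_pm by auto
    also have "tan (\<alpha> i p) = s / k" by (simp add: tan_def s_def k_def)
    finally have rhs: "mean (\<lambda>z. K d i p \<alpha> z * ?G z) = \<rho> * (k\<^sup>2 * R) * - (s / k) *
        (V (i, p - 1) - (\<Sum>a=p..d i. \<theta> d \<alpha> i a * V (i, a)) / (s\<^sup>2 * R))" .
    show ?thesis
      unfolding lhs rhs using sk R by (simp add: field_simps power2_eq_square)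
  next
    case False
    then have pd: "p = d i" using p by auto
    have dd: "d i - 1 \<noteq> d i" using d_ge_1[of i] by simp
    have "mean (\<lambda>z. K d i p \<alpha> z * ?G z) =
        (\<Sum>z\<in>states d. (st z * (- k * s) * ?G z) * of_bool (z = (i, d i - 1))) -
        (\<Sum>z\<in>states d. (st z * (- k * s) * ?G z) * of_bool (z = (i, d i)))"
      unfolding mean_def sum_subtractf[symmetric] using pd
      by (intro sum.cong refl) (simp add: K_def \<delta>_def k_def s_def algebra_simps)
    also have "\<dots> = st (i, d i - 1) * (- k * s) * ?G (i, d i - 1) - st (i, d i) * (- k * s) * ?G (i, d i)"
      by (subst (1 2) pick) auto
    also have "(\<Sum>a\<in>{..d i}. mark_law d \<alpha> i p (i, d i - 1) a * V (i, a)) =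
        (\<Sum>a\<in>{..d i}. if a = d i then V (i, a) else 0)"
      using False dd by (intro sum.cong refl) (simp add: mark_law_def)
    also have "\<dots> = V (i, d i)" by simp
    also have "(\<Sum>a\<in>{..d i}. mark_law d \<alpha> i p (i, d i) a * V (i, a)) =
        (\<Sum>a\<in>{..d i}. if a = d i - 1 then V (i, a) else 0)"
      using False dd by (intro sum.cong refl) (simp add: mark_law_def)
    also have "\<dots> = V (i, d i - 1)" by simp
    also have "st (i, d i - 1) = \<rho> * (k\<^sup>2 * R)" using st[of "p - 1"] p theta_pm pd by auto
    also have "st (i, d i) = \<rho> * (s\<^sup>2 * R)"
      using st[of "d i"] theta_tail_sum[where d = d and p = "d i" and j = i and \<beta> = \<alpha>, OF d_ge_1] prod_p pd by simp
    finally have "mean (\<lambda>z. K d i p \<alpha> z * ?G z) = \<rho> * (- k * s * R * (s\<^sup>2 + k\<^sup>2)) * (V (i, d i - 1) - V (i, d i))"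
      by (simp add: algebra_simps)
    then have rhs: "mean (\<lambda>z. K d i p \<alpha> z * ?G z) = \<rho> * (- k * s * R) * (V (i, d i - 1) - V (i, d i))"
      by (simp add: sk1)
    have "(\<Sum>a=p..d i. \<theta> d \<alpha> i a * V (i, a)) = s\<^sup>2 * R * V (i, d i)"
      using theta_tail_sum[where d = d and p = "d i" and j = i and \<beta> = \<alpha>, OF d_ge_1] prod_p pd by simp
    then show ?thesis
      unfolding lhs rhs using sk pd by (simp add: field_simps power2_eq_square)
  qed
qed

text \<open>At a finite horizon the mean cost is a finite sum of iterates weighted by the initial
  law, so termwise differentiation is legitimate. Since the initial weights sum to 1, a bound
  uniform in the starting state gives an error of order \<open>1 / N\<close>.\<close>

lemma mean_cost_derivative:
  assumes mc: "\<And>\<beta>. interior_param d \<beta> \<Longrightarrow> markov_chain (M \<beta>) (states d) (trans_prob d A \<beta>) Z"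
    and init: "\<And>\<beta>. interior_param d \<beta> \<Longrightarrow> distr (M \<beta>) (count_space (states d)) (Z 0) = \<mu>"
    and int: "interior_param d \<alpha>" and p: "p \<in> {1..d i}"
    and prim: "primitive_matrix (states d) (trans_prob d A \<alpha>) L \<epsilon>"
    and V: "\<And>z. z \<in> states d \<Longrightarrow> V z - trans_op (states d) (trans_prob d A \<alpha>) V z =
      c z - primitive_matrix.mean (states d) (trans_prob d A \<alpha>) c"
  shows "(\<lambda>x. mean_cost M Z c N (set_coord \<alpha> i p x)) differentiable (at (\<alpha> i p))"
    and "(\<lambda>N. deriv (\<lambda>x. mean_cost M Z c N (set_coord \<alpha> i p x)) (\<alpha> i p)
      - of_bool (N > 0) * primitive_matrix.mean (states d) (trans_prob d A \<alpha>)
          (\<lambda>z. \<Sum>w\<in>states d. trans_deriv d A \<alpha> i p z w * V w)) \<longlonglongrightarrow> 0"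
proof -
  interpret primitive_matrix "states d" "trans_prob d A \<alpha>" L \<epsilon> by (rule prim)
  let ?m = "mean (\<lambda>z. \<Sum>w\<in>states d. trans_deriv d A \<alpha> i p z w * V w)"
  have fmp: "finite_markov_process (M \<beta>) (states d) (trans_prob d A \<beta>) Z" if "interior_param d \<beta>" for \<beta>
    by (intro markov_chain_imp_finite_markov_process mc that stochastic_trans_prob d_ge_1)
  interpret fm: finite_markov_process "M \<alpha>" "states d" "trans_prob d A \<alpha>" Z by (rule fmp[OF int])
  have sin_pos: "sin (\<alpha> i p) \<noteq> 0" using interior_sin_cos_pos[OF int p] by simp
  define v where "v z = fm.prob {\<omega>\<in>space (M \<alpha>). Z 0 \<omega> = z}" for z
  have v_nonneg: "v z \<ge> 0" for z by (simp add: v_def)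
  have v_sum: "(\<Sum>z\<in>states d. v z) = 1"
  proof -
    have "(\<integral>z. (1::real) \<partial>distr (M \<alpha>) (count_space (states d)) (Z 0)) = (\<Sum>z\<in>states d. v z * 1)"
      unfolding v_def by (rule integral_distr_states[OF d_ge_1 fmp[OF int]])
    then show ?thesis
      using prob_space.prob_space[OF fm.prob_space_distr[OF fm.Y_measurable[of 0]]] by simp
  qed
  have \<mu>: "(\<integral>z. f z \<partial>\<mu>) = (\<Sum>z\<in>states d. v z * f z)" for f :: "'s \<times> nat \<Rightarrow> real"
    unfolding init[OF int, symmetric] v_def by (rule integral_distr_states[OF d_ge_1 fmp[OF int]])
  have cost: "mean_cost M Z c N \<beta> = 1 / real N * (\<Sum>n=1..N. \<Sum>z\<in>states d. v z *
      (trans_op (states d) (trans_prob d A \<beta>) ^^ n) c z)" if "interior_param d \<beta>" for N \<beta>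
    unfolding mean_cost_def mean_cost_eq[OF d_ge_1 fmp[OF that]] init[OF that] \<mu> ..
  define D where "D = iterate_deriv d A c \<alpha> i p"
  have deriv: "((\<lambda>x. mean_cost M Z c N (set_coord \<alpha> i p x)) has_real_derivative
      1 / real N * (\<Sum>n=1..N. \<Sum>z\<in>states d. v z * D n z)) (at (\<alpha> i p))" for N
  \<comment> \<open>\<open>M \<beta>\<close> is known to carry the chain only for interior
    parameters, so the formula for the mean cost is available only while the varied coordinate stays
    in the open interval.\<close>
  proof (rule has_field_derivative_transform_within_open)
    show "((\<lambda>x. 1 / real N * (\<Sum>n=1..N. \<Sum>z\<in>states d. v z *
        (trans_op (states d) (trans_prob d A (set_coord \<alpha> i p x)) ^^ n) c z)) has_real_derivative
        1 / real N * (\<Sum>n=1..N. \<Sum>z\<in>states d. v z * D n z)) (at (\<alpha> i p))"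
      unfolding D_def
      by (intro DERIV_cmult DERIV_sum iterate_has_derivative d_ge_1 p sin_pos)
    show "open {0<..<pi/2}" by simp
    show "\<alpha> i p \<in> {0<..<pi/2}" using int p by (auto simp: interior_param_def)
    fix x :: real assume "x \<in> {0<..<pi/2}"
    then have "interior_param d (set_coord \<alpha> i p x)"
      using int by (auto simp: interior_param_def set_coord_def)
    then show "1 / real N * (\<Sum>n=1..N. \<Sum>z\<in>states d. v z *
        (trans_op (states d) (trans_prob d A (set_coord \<alpha> i p x)) ^^ n) c z) =
        mean_cost M Z c N (set_coord \<alpha> i p x)"
      by (simp add: cost)
  qed
  show "(\<lambda>x. mean_cost M Z c N (set_coord \<alpha> i p x)) differentiable (at (\<alpha> i p))"
    using deriv[of N] by (auto simp: real_differentiable_def)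
  obtain B where B: "\<And>N z. z \<in> states d \<Longrightarrow> \<bar>(\<Sum>n=1..N. D n z) - real N * ?m\<bar> \<le> B"
  proof -
    have "\<exists>B. \<forall>N. \<forall>z\<in>states d. \<bar>(\<Sum>n=1..N. D n z) - real N * ?m\<bar> \<le> B"
      by (rule derivative_sums_bound[OF V])
        (simp_all add: D_def iterate_deriv.simps
          trans_deriv_sum[where d = d and \<alpha> = \<alpha> and A = A, OF d_ge_1 p sin_pos])
    then show ?thesis using that by blast
  qed
  have "\<bar>1 / real N * (\<Sum>n=1..N. \<Sum>z\<in>states d. v z * D n z) - of_bool (N > 0) * ?m\<bar> \<le> B / real N" for N
  proof (cases "N = 0")
    case False
    have "(\<Sum>n=1..N. \<Sum>z\<in>states d. v z * D n z) - real N * ?m =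
        (\<Sum>z\<in>states d. v z * (\<Sum>n=1..N. D n z)) - (\<Sum>z\<in>states d. v z) * (real N * ?m)"
      by (subst sum.swap) (simp add: sum_distrib_left v_sum)
    also have "\<dots> = (\<Sum>z\<in>states d. v z * ((\<Sum>n=1..N. D n z) - real N * ?m))"
      by (simp add: sum_distrib_right sum_subtractf right_diff_distrib)
    finally have "\<bar>(\<Sum>n=1..N. \<Sum>z\<in>states d. v z * D n z) - real N * ?m\<bar> \<le> (\<Sum>z\<in>states d. v z * B)"
      using B v_nonneg
      by (auto intro!: order_trans[OF sum_abs] sum_mono mult_left_mono simp: abs_mult simp del: One_nat_def)
    then have *: "\<bar>(\<Sum>n=1..N. \<Sum>z\<in>states d. v z * D n z) - real N * ?m\<bar> \<le> B"
      by (simp add: sum_distrib_right[symmetric] v_sum)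
    have "1 / real N * (\<Sum>n=1..N. \<Sum>z\<in>states d. v z * D n z) - of_bool (N > 0) * ?m =
        ((\<Sum>n=1..N. \<Sum>z\<in>states d. v z * D n z) - real N * ?m) / real N"
      using False by (simp add: diff_divide_distrib)
    with * show ?thesis by (simp only: abs_divide abs_of_nat) (rule divide_right_mono, auto)
  qed simp
  then have bound: "\<bar>deriv (\<lambda>x. mean_cost M Z c N (set_coord \<alpha> i p x)) (\<alpha> i p) - of_bool (N > 0) * ?m\<bar> \<le> B / real N" for N
    unfolding DERIV_imp_deriv[OF deriv] .
  show "(\<lambda>N. deriv (\<lambda>x. mean_cost M Z c N (set_coord \<alpha> i p x)) (\<alpha> i p) - of_bool (N > 0) * ?m) \<longlonglongrightarrow> 0"
  proof (rule tendsto_rabs_zero_cancel, rule tendsto_sandwich[OF _ _ tendsto_const])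
    show "(\<lambda>N. B / real N) \<longlonglongrightarrow> 0" by (rule lim_const_over_n)
  qed (use bound in \<open>auto intro!: always_eventually\<close>)
qed

end

section \<open>The extended chain and the estimator\<close>

text \<open>
  Both kinds of replacement actions are covered by one extended chain: given \<open>Z k\<close>, the mark
  \<open>min (u k) (d i)\<close> has law \<open>mark_law\<close> and does not influence the future of \<open>Z\<close>. The truncation
  keeps the marks in a finite set and changes them on a null set only; \<open>u 0\<close> is unconstrained,
  hence replaced by \<open>0\<close>.
\<close>

lemma extended_chain:
  fixes d :: "'s::finite \<Rightarrow> nat" and M :: "'w measure"
  assumes d_ge_1: "\<And>j. d j \<ge> 1"
    and mc: "markov_chain M (states d) (trans_prob d A \<alpha>) Z"
    and int: "interior_param d \<alpha>" and p: "p \<in> {1..d i}"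
    and prim: "primitive_matrix (states d) (trans_prob d A \<alpha>) L \<epsilon>"
    and u_indep: "p < d i \<Longrightarrow>
      prob_space.indep_vars M (\<lambda>_. count_space UNIV) u {1..} \<and>
      independent_rvs M
        (Pi\<^sub>M {1..} (\<lambda>_. count_space UNIV)) (\<lambda>\<omega>. \<lambda>k\<in>{1..}. u k \<omega>)
        (Pi\<^sub>M UNIV (\<lambda>_. count_space (states d))) (\<lambda>\<omega> n. Z n \<omega>) \<and>
      (\<forall>k\<ge>1. \<forall>a\<in>{p..d i}.
        \<P>(\<omega> in M. u k \<omega> = a) = \<theta> d \<alpha> i a / (\<Prod>m=1..p. (sin (\<alpha> i m))\<^sup>2))"
    and u_swap: "p = d i \<Longrightarrow>
      \<forall>k\<ge>1. \<forall>\<omega>\<in>space M.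
        u k \<omega> = d i * of_bool (snd (Z k \<omega>) = d i - 1) + (d i - 1) * of_bool (snd (Z k \<omega>) = d i)"
  defines "U \<equiv> \<lambda>k \<omega>. if k = 0 then 0 else min (u k \<omega>) (d i)"
  shows "\<And>k. k \<ge> 1 \<Longrightarrow> u k \<in> M \<rightarrow>\<^sub>M count_space UNIV"
    and "AE \<omega> in M. \<forall>k\<ge>1. u k \<omega> = U k \<omega>"
    and "marked_chain M (states d) (trans_prob d A \<alpha>) L \<epsilon> {..d i} (mark_law d \<alpha> i p)
      (\<lambda>k \<omega>. (Z k \<omega>, U k \<omega>)) (\<lambda>a. (i, a))"
proof -
  let ?E = "states d" and ?P = "trans_prob d A \<alpha>"
  interpret fm: finite_markov_process M ?E ?P Z
    by (intro markov_chain_imp_finite_markov_process mc stochastic_trans_prob d_ge_1)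
  let ?\<phi> = "\<lambda>z::'s \<times> nat. d i * of_bool (snd z = d i - 1) + (d i - 1) * of_bool (snd z = d i)"
  have \<phi>_le: "?\<phi> z \<le> d i" for z using d_ge_1[of i] by auto
  show u_meas: "u k \<in> M \<rightarrow>\<^sub>M count_space UNIV" if k: "k \<ge> 1" for k
  proof (cases "p < d i")
    case True
    then show ?thesis using u_indep k by (auto simp: fm.indep_vars_def)
  next
    case False
    then have "p = d i" using p by simp
    then have "u k \<omega> = ?\<phi> (Z k \<omega>)" if "\<omega> \<in> space M" for \<omega> using u_swap k that by blast
    then have "u k \<in> M \<rightarrow>\<^sub>M count_space UNIV \<longleftrightarrow> (\<lambda>\<omega>. ?\<phi> (Z k \<omega>)) \<in> M \<rightarrow>\<^sub>M count_space UNIV"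
      by (rule measurable_cong)
    moreover have "(\<lambda>\<omega>. ?\<phi> (Z k \<omega>)) \<in> M \<rightarrow>\<^sub>M count_space UNIV"
      by (rule measurable_compose[OF fm.Y_measurable[of k], of ?\<phi>]) simp
    ultimately show ?thesis by simp
  qed
  have U_events: "{\<omega>\<in>space M. U k \<omega> = a} \<in> fm.events" for k a
  proof (cases "k = 0")
    case False
    then have "(\<lambda>\<omega>. min (u k \<omega>) (d i)) \<in> M \<rightarrow>\<^sub>M count_space UNIV"
      by (intro measurable_compose[OF u_meas]) auto
    then have "Measurable.pred M (\<lambda>\<omega>. min (u k \<omega>) (d i) = a)" by measurable
    then show ?thesis using False by (simp add: U_def pred_def)
  qed (auto simp: U_def)
  \<comment> \<open>The prescribed probabilities of the values \<open>p..d i\<close> already add up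
    to 1, so any other value has probability zero.\<close>
  have AE_range: "AE \<omega> in M. p \<le> u k \<omega> \<and> u k \<omega> \<le> d i" if pd: "p < d i" and k: "k \<ge> 1" for k
  proof -
    note [measurable] = u_meas[OF k]
    have "fm.prob (\<Union>a\<in>{p..d i}. {\<omega>\<in>space M. u k \<omega> = a}) = (\<Sum>a\<in>{p..d i}. fm.prob {\<omega>\<in>space M. u k \<omega> = a})"
      by (rule fm.finite_measure_finite_Union) (auto simp: disjoint_family_on_def)
    also have "\<dots> = (\<Sum>a\<in>{p..d i}. \<theta> d \<alpha> i a / (\<Prod>m=1..p. (sin (\<alpha> i m))\<^sup>2))"
      using u_indep[OF pd] k by (intro sum.cong refl) blast
    also have "\<dots> = (\<Sum>a\<in>{..d i}. mark_law d \<alpha> i p z a)" for z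
      by (rule sum.mono_neutral_cong_left) (use pd in \<open>auto simp: mark_law_def\<close>)
    also have "\<dots> z = 1" for z by (rule mark_law_sum[OF d_ge_1 int p])
    finally have "AE \<omega> in M. \<omega> \<in> (\<Union>a\<in>{p..d i}. {\<omega>\<in>space M. u k \<omega> = a})"
      by (intro fm.AE_prob_1) blast
    then show ?thesis by eventually_elim auto
  qed
  show AE_eq: "AE \<omega> in M. \<forall>k\<ge>1. u k \<omega> = U k \<omega>"
  proof -
    have "AE \<omega> in M. k \<ge> 1 \<longrightarrow> u k \<omega> = U k \<omega>" for k
    proof (cases "k \<ge> 1")
      case k: True
      show ?thesis
      proof (cases "p < d i")
        case True
        show ?thesis using AE_range[OF True k] by eventually_elim (auto simp: U_def)
      next
        case False
        then have "u k \<omega> = ?\<phi> (Z k \<omega>)" if "\<omega> \<in> space M" for \<omega>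
          using u_swap k that p by auto
        then show ?thesis using \<phi>_le by (intro AE_I2) (auto simp: U_def)
      qed
    qed simp
    then show ?thesis unfolding AE_all_countable by blast
  qed
  have U_le: "U k \<omega> \<le> d i" for k \<omega> by (simp add: U_def)

  have markov: "fm.prob {\<omega>\<in>space M. (\<forall>m\<le>n. (Z m \<omega>, U m \<omega>) = h m) \<and> (Z (Suc n) \<omega>, U (Suc n) \<omega>) = y} =
      fm.prob {\<omega>\<in>space M. \<forall>m\<le>n. (Z m \<omega>, U m \<omega>) = h m} *
        (?P (fst (h n)) (fst y) * mark_law d \<alpha> i p (fst y) (snd y))"
    if y: "y \<in> ?E \<times> {..d i}" for n h y
  proof -
    have y1: "fst y \<in> ?E" and y2: "snd y \<le> d i" using y by auto
    show ?thesis
    proof (cases "p < d i")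
      case pd: True
      \<comment> \<open>Histories of the pair are split into a chain event and a mark event. Time 0
        is left out of the mark event because \<open>U 0\<close> is the constant 0, whereas
        independence concerns the marks from time 1 on.\<close>
      define AZ where "AZ n g = {\<omega>\<in>space M. \<forall>m\<le>n. Z m \<omega> = g m}" for n :: nat and g
      define AU where "AU n b = {\<omega>\<in>space M. \<forall>m\<in>{1..n}. U m \<omega> = b m}" for n :: nat and b
      have law: "fm.prob {\<omega>\<in>space M. U (Suc n) \<omega> = a} = mark_law d \<alpha> i p z a" if "a \<le> d i" for n a z
      proof -
        note [measurable] = u_meas[of "Suc n"]
        have "AE \<omega> in M. p \<le> u (Suc n) \<omega> \<and> u (Suc n) \<omega> \<le> d i" by (rule AE_range[OF pd]) simp
        then have "AE \<omega> in M. U (Suc n) \<omega> = a \<longleftrightarrow> u (Suc n) \<omega> = a"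
          by eventually_elim (simp add: U_def)
        moreover have u_events: "{\<omega>\<in>space M. u (Suc n) \<omega> = a} \<in> fm.events" by measurable
        ultimately have "fm.prob {\<omega>\<in>space M. U (Suc n) \<omega> = a} = fm.prob {\<omega>\<in>space M. u (Suc n) \<omega> = a}"
          by (intro fm.prob_eq_AE U_events)
        also have "\<dots> = mark_law d \<alpha> i p z a"
        proof (cases "p \<le> a")
          case True
          then have "fm.prob {\<omega>\<in>space M. u (Suc n) \<omega> = a} = \<theta> d \<alpha> i a / (\<Prod>m=1..p. (sin (\<alpha> i m))\<^sup>2)"
            using u_indep[OF pd] \<open>a \<le> d i\<close> by auto
          then show ?thesis using pd True by (simp add: mark_law_def)
        next
          case False
          have "AE \<omega> in M. p \<le> u (Suc n) \<omega> \<and> u (Suc n) \<omega> \<le> d i" by (rule AE_range[OF pd]) simp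
          then have "AE \<omega> in M. \<not> u (Suc n) \<omega> = a"
            by eventually_elim (use False in auto)
          then have "AE \<omega> in M. \<omega> \<notin> {\<omega>\<in>space M. u (Suc n) \<omega> = a}" by eventually_elim simp
          then have "fm.prob {\<omega>\<in>space M. u (Suc n) \<omega> = a} = 0"
            using fm.prob_eq_0[OF u_events] by blast
          then show ?thesis using pd False by (simp add: mark_law_def)
        qed
        finally show ?thesis .
      qed
      have indep: "fm.prob (AU n' b \<inter> AZ n g) = fm.prob (AU n' b) * fm.prob (AZ n g)" for n n' g b
      proof (rule fm.indep_setD)
        let ?MU = "Pi\<^sub>M {1..} (\<lambda>_. count_space (UNIV :: nat set))"
        let ?MZ = "Pi\<^sub>M UNIV (\<lambda>_. count_space ?E)"
        let ?fU = "\<lambda>\<omega>. \<lambda>k\<in>{1..}. u k \<omega>"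
        let ?fZ = "\<lambda>\<omega> n. Z n \<omega>"
        have ind: "independent_rvs M ?MU ?fU ?MZ ?fZ" using u_indep[OF pd] by blast
        then show "fm.indep_set (sets (vimage_algebra (space M) ?fU ?MU)) (sets (vimage_algebra (space M) ?fZ ?MZ))"
          by (simp add: independent_rvs_def)
        have fU: "?fU \<in> M \<rightarrow>\<^sub>M ?MU" and fZ: "?fZ \<in> M \<rightarrow>\<^sub>M ?MZ" using ind by (auto simp: independent_rvs_def)
        have "Measurable.pred ?MU (\<lambda>x. min (x m) (d i) = b m)" if "m \<in> {1..n'}" for m
          by (rule measurable_compose[OF measurable_component_singleton]) (use that in auto)
        then have "{x \<in> space ?MU. \<forall>m\<in>{1..n'}. min (x m) (d i) = b m} \<in> sets ?MU"
          by (intro sets.sets_Collect_finite_All) (auto simp: pred_def)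
        then have "?fU -` {x \<in> space ?MU. \<forall>m\<in>{1..n'}. min (x m) (d i) = b m} \<inter> space M
            \<in> sets (vimage_algebra (space M) ?fU ?MU)"
          by (rule in_vimage_algebra)
        also have "?fU -` {x \<in> space ?MU. \<forall>m\<in>{1..n'}. min (x m) (d i) = b m} \<inter> space M = AU n' b"
          using measurable_space[OF fU] by (auto simp: AU_def U_def)
        finally show "AU n' b \<in> sets (vimage_algebra (space M) ?fU ?MU)" .
        have "Measurable.pred ?MZ (\<lambda>x. x m = g m)" for m
          by (rule measurable_compose[OF measurable_component_singleton[of m UNIV]]) auto
        then have "{x \<in> space ?MZ. \<forall>m\<in>{..n}. x m = g m} \<in> sets ?MZ"
          by (intro sets.sets_Collect_finite_All) (auto simp: pred_def)
        then have "?fZ -` {x \<in> space ?MZ. \<forall>m\<in>{..n}. x m = g m} \<inter> space M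
            \<in> sets (vimage_algebra (space M) ?fZ ?MZ)"
          by (rule in_vimage_algebra)
        also have "?fZ -` {x \<in> space ?MZ. \<forall>m\<in>{..n}. x m = g m} \<inter> space M = AZ n g"
          using measurable_space[OF fZ] by (auto simp: AZ_def)
        finally show "AZ n g \<in> sets (vimage_algebra (space M) ?fZ ?MZ)" .
      qed
      have AU_prod: "fm.prob (AU n b) = (\<Prod>m\<in>{1..n}. fm.prob {\<omega>\<in>space M. U m \<omega> = b m})" for n b
      \<comment> \<open>The product rule for independent sets is applied to a nonempty index set, so
        the empty history is treated apart.\<close>
      proof (cases "n = 0")
        case True
        then show ?thesis by (simp add: AU_def fm.prob_space)
      next
        case False
        have "fm.indep_sets (\<lambda>k. {u k -` B \<inter> space M |B. B \<in> sets (count_space UNIV)}) {1..}"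
          using u_indep[OF pd] by (simp add: fm.indep_vars_def2)
        then have "fm.prob (\<Inter>m\<in>{1..n}. {\<omega>\<in>space M. U m \<omega> = b m}) =
            (\<Prod>m\<in>{1..n}. fm.prob {\<omega>\<in>space M. U m \<omega> = b m})"
        proof (rule fm.indep_setsD)
          show "\<forall>m\<in>{1..n}. {\<omega>\<in>space M. U m \<omega> = b m} \<in> {u m -` B \<inter> space M |B. B \<in> sets (count_space UNIV)}"
          proof
            fix m assume "m \<in> {1..n}"
            then have eq: "{\<omega>\<in>space M. U m \<omega> = b m} = u m -` {x. min x (d i) = b m} \<inter> space M"
              by (auto simp: U_def)
            show "{\<omega>\<in>space M. U m \<omega> = b m} \<in> {u m -` B \<inter> space M |B. B \<in> sets (count_space UNIV)}"
              by (rule CollectI, rule exI, rule conjI, rule eq) simp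
          qed
        qed (use False in auto)
        also have "(\<Inter>m\<in>{1..n}. {\<omega>\<in>space M. U m \<omega> = b m}) = AU n b"
        proof -
          have "n \<in> {1..n}" using False by simp
          then show ?thesis unfolding AU_def by blast
        qed
        finally show ?thesis .
      qed
      show ?thesis
      \<comment> \<open>As \<open>U 0 = 0\<close>, a history starting with another mark is the empty
        event and both sides vanish.\<close>
      proof (cases "snd (h 0) = 0")
        case h0: True
        define g where "g = (\<lambda>m. if m = Suc n then fst y else fst (h m))"
        define b where "b = (\<lambda>m. if m = Suc n then snd y else snd (h m))"
        have 1: "{\<omega>\<in>space M. \<forall>m\<le>n. (Z m \<omega>, U m \<omega>) = h m} = AU n b \<inter> AZ n g"
        proof (intro set_eqI iffI)
          fix \<omega> assume \<omega>: "\<omega> \<in> AU n b \<inter> AZ n g"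
          have "U m \<omega> = snd (h m)" "Z m \<omega> = fst (h m)" if "m \<le> n" for m
            using \<omega> that h0 by (cases "m = 0"; force simp: AU_def AZ_def b_def g_def U_def)+
          then show "\<omega> \<in> {\<omega>\<in>space M. \<forall>m\<le>n. (Z m \<omega>, U m \<omega>) = h m}"
            using \<omega> by (simp add: prod_eq_iff AU_def)
        qed (auto simp: AU_def AZ_def b_def g_def prod_eq_iff)
        have 2: "{\<omega>\<in>space M. (\<forall>m\<le>n. (Z m \<omega>, U m \<omega>) = h m) \<and> (Z (Suc n) \<omega>, U (Suc n) \<omega>) = y} =
            AU (Suc n) b \<inter> AZ (Suc n) g"
        proof -
          have "{\<omega>\<in>space M. (\<forall>m\<le>n. (Z m \<omega>, U m \<omega>) = h m) \<and> (Z (Suc n) \<omega>, U (Suc n) \<omega>) = y} =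
              (AU n b \<inter> AZ n g) \<inter> {\<omega>\<in>space M. U (Suc n) \<omega> = b (Suc n) \<and> Z (Suc n) \<omega> = g (Suc n)}"
            unfolding 1[symmetric] by (auto simp: g_def b_def)
          also have "\<dots> = AU (Suc n) b \<inter> AZ (Suc n) g"
            by (auto simp: AU_def AZ_def le_Suc_eq)
          finally show ?thesis .
        qed
        have "AZ (Suc n) g = {\<omega>\<in>space M. (\<forall>m\<le>n. Z m \<omega> = g m) \<and> Z (Suc n) \<omega> = fst y}"
          by (auto simp: AZ_def g_def le_Suc_eq)
        then have "fm.prob (AZ (Suc n) g) = fm.prob (AZ n g) * ?P (g n) (fst y)"
          using fm.markov[OF y1, of n g] by (simp add: AZ_def)
        moreover have "fm.prob (AU (Suc n) b) = fm.prob (AU n b) * mark_law d \<alpha> i p (fst y) (snd y)"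
          using law[OF y2] by (simp add: AU_prod b_def)
        ultimately show ?thesis
          unfolding 1 2 indep by (simp add: g_def)
      next
        case False
        then have "(Z 0 \<omega>, U 0 \<omega>) \<noteq> h 0" for \<omega> by (auto simp: U_def prod_eq_iff)
        then have "{\<omega>\<in>space M. \<forall>m\<le>n. (Z m \<omega>, U m \<omega>) = h m} = {}"
          "{\<omega>\<in>space M. (\<forall>m\<le>n. (Z m \<omega>, U m \<omega>) = h m) \<and> (Z (Suc n) \<omega>, U (Suc n) \<omega>) = y} = {}"
          by blast+
        then show ?thesis by (simp only: measure_empty mult_zero_left)
      qed
    next
      case False
      then have pd: "p = d i" using p by simp
      have U_eq: "U m \<omega> = (if m = 0 then 0 else ?\<phi> (Z m \<omega>))" if "\<omega> \<in> space M" for m \<omega>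
        using u_swap[OF pd] that \<phi>_le[of "Z m \<omega>"] by (simp add: U_def)
      have law: "mark_law d \<alpha> i p z a = of_bool (a = ?\<phi> z)" for z a
        using False by (simp add: mark_law_def)
      show ?thesis
      \<comment> \<open>Here the marks are functions of the chain. A history of pairs is therefore
        either determined by its first components, reducing to the Markov property of
        \<open>Z\<close>, or impossible.\<close>
      proof (cases "\<forall>m\<le>n. snd (h m) = (if m = 0 then 0 else ?\<phi> (fst (h m)))")
        case True
        then have 1: "{\<omega>\<in>space M. \<forall>m\<le>n. (Z m \<omega>, U m \<omega>) = h m} = {\<omega>\<in>space M. \<forall>m\<le>n. Z m \<omega> = fst (h m)}"
          by (auto simp: prod_eq_iff U_eq)
        have "{\<omega>\<in>space M. (\<forall>m\<le>n. (Z m \<omega>, U m \<omega>) = h m) \<and> (Z (Suc n) \<omega>, U (Suc n) \<omega>) = y} =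
            {\<omega>\<in>space M. \<forall>m\<le>n. (Z m \<omega>, U m \<omega>) = h m} \<inter> {\<omega>\<in>space M. (Z (Suc n) \<omega>, U (Suc n) \<omega>) = y}"
          by auto
        also have "\<dots> = (if snd y = ?\<phi> (fst y)
            then {\<omega>\<in>space M. (\<forall>m\<le>n. Z m \<omega> = fst (h m)) \<and> Z (Suc n) \<omega> = fst y} else {})"
          unfolding 1 by (auto simp: prod_eq_iff U_eq)
        finally have 2: "{\<omega>\<in>space M. (\<forall>m\<le>n. (Z m \<omega>, U m \<omega>) = h m) \<and> (Z (Suc n) \<omega>, U (Suc n) \<omega>) = y} =
            (if snd y = ?\<phi> (fst y)
            then {\<omega>\<in>space M. (\<forall>m\<le>n. Z m \<omega> = fst (h m)) \<and> Z (Suc n) \<omega> = fst y} else {})" .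
        show ?thesis unfolding 1 2 law using fm.markov[OF y1, of n "\<lambda>m. fst (h m)"] by simp
      next
        case False
        then have empty: "\<not> (\<forall>m\<le>n. (Z m \<omega>, U m \<omega>) = h m)" if "\<omega> \<in> space M" for \<omega>
          using U_eq[OF that] by (metis fst_conv snd_conv)
        then have "{\<omega>\<in>space M. \<forall>m\<le>n. (Z m \<omega>, U m \<omega>) = h m} = {}"
          "{\<omega>\<in>space M. (\<forall>m\<le>n. (Z m \<omega>, U m \<omega>) = h m) \<and> (Z (Suc n) \<omega>, U (Suc n) \<omega>) = y} = {}"
          by blast+
        then show ?thesis by (simp only: measure_empty mult_zero_left)
      qed
    qed
  qed

  have law_sum: "(\<Sum>a\<in>{..d i}. mark_law d \<alpha> i p z a) = 1" for z
    by (rule mark_law_sum[OF d_ge_1 int p])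
  have law_nonneg: "mark_law d \<alpha> i p z a \<ge> 0" for z a
    by (auto simp: mark_law_def theta_nonneg[OF d_ge_1] intro!: divide_nonneg_nonneg prod_nonneg)
  show "marked_chain M ?E ?P L \<epsilon> {..d i} (mark_law d \<alpha> i p) (\<lambda>k \<omega>. (Z k \<omega>, U k \<omega>)) (\<lambda>a. (i, a))"
  proof (intro marked_chain.intro finite_markov_process.intro stochastic_matrix.intro
      finite_markov_process_axioms.intro marked_chain_axioms.intro)
    show "finite (?E \<times> {..d i})" "?E \<times> {..d i} \<noteq> {}" using fm.E_nonempty by auto
    show "0 \<le> ?P (fst z) (fst w) * mark_law d \<alpha> i p (fst w) (snd w)"
      if "z \<in> ?E \<times> {..d i}" "w \<in> ?E \<times> {..d i}" for z w
      using that by (auto intro!: mult_nonneg_nonneg fm.P_nonneg law_nonneg)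
    show "(\<Sum>w\<in>?E \<times> {..d i}. ?P (fst z) (fst w) * mark_law d \<alpha> i p (fst w) (snd w)) = 1"
      if "z \<in> ?E \<times> {..d i}" for z
    proof -
      have "(\<Sum>w\<in>?E \<times> {..d i}. ?P (fst z) (fst w) * mark_law d \<alpha> i p (fst w) (snd w)) =
          (\<Sum>w\<in>?E. ?P (fst z) w * (\<Sum>a\<in>{..d i}. mark_law d \<alpha> i p w a))"
        by (simp add: sum.cartesian_product' sum_distrib_left)
      then show ?thesis unfolding law_sum using fm.P_sum[of "fst z"] that by auto
    qed
    show "(\<lambda>\<omega>. (Z n \<omega>, U n \<omega>)) \<in> M \<rightarrow>\<^sub>M count_space (?E \<times> {..d i})" for n
    proof (subst measurable_count_space_eq2)
      have "(\<lambda>\<omega>. (Z n \<omega>, U n \<omega>)) -` {y} \<inter> space M = {\<omega>\<in>space M. Z n \<omega> = fst y} \<inter> {\<omega>\<in>space M. U n \<omega> = snd y}" for y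
        by (auto simp: prod_eq_iff)
      moreover have "{\<omega>\<in>space M. Z n \<omega> = z} \<in> fm.events" for z
        using fm.pred_of_Y[of "\<lambda>y. y = z" n] by (simp add: pred_def)
      ultimately show "(\<lambda>\<omega>. (Z n \<omega>, U n \<omega>)) \<in> space M \<rightarrow> ?E \<times> {..d i} \<and>
          (\<forall>y\<in>?E \<times> {..d i}. (\<lambda>\<omega>. (Z n \<omega>, U n \<omega>)) -` {y} \<inter> space M \<in> fm.events)"
        using fm.Y_in_E U_le U_events by auto
    qed (simp add: finite_states[OF d_ge_1])
    show "(i, a) \<in> ?E" if "a \<in> {..d i}" for a using that by (simp add: states_def)
  qed (use prim fm.prob_space_axioms law_sum in \<open>simp_all only: markov finite_atMost\<close>)
qed

theorem theorem3:
  fixes d :: "'s::finite \<Rightarrow> nat"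
    and A :: "'s \<Rightarrow> nat \<Rightarrow> 's pmf"
    and c :: "'s \<times> nat \<Rightarrow> real"
    and \<alpha> :: "'s \<Rightarrow> nat \<Rightarrow> real"
    and M :: "('s \<Rightarrow> nat \<Rightarrow> real) \<Rightarrow> 'w measure"
    and Z :: "nat \<Rightarrow> 'w \<Rightarrow> 's \<times> nat"
    and \<mu> :: "('s \<times> nat) measure"
    and i :: 's and p :: nat
    and u :: "nat \<Rightarrow> 'w \<Rightarrow> nat"
    and \<Gamma> :: "nat \<Rightarrow> 'w \<Rightarrow> real"
  assumes "\<And>j. d j \<ge> 1"
    and "\<And>\<beta>. interior_param d \<beta> \<Longrightarrow> irreducible_chain (states d) (trans_prob d A \<beta>)"
    and "\<And>\<beta>. interior_param d \<beta> \<Longrightarrow> aperiodic_chain (states d) (trans_prob d A \<beta>)"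
    and "\<And>\<beta>. interior_param d \<beta> \<Longrightarrow> markov_chain (M \<beta>) (states d) (trans_prob d A \<beta>) Z"
    and "\<And>\<beta>. interior_param d \<beta> \<Longrightarrow> distr (M \<beta>) (count_space (states d)) (Z 0) = \<mu>"
    and "interior_param d \<alpha>"
    and "p \<in> {1..d i}"
    and "p < d i \<Longrightarrow>
      prob_space.indep_vars (M \<alpha>) (\<lambda>_. count_space UNIV) u {1..} \<and>
      independent_rvs (M \<alpha>)
        (Pi\<^sub>M {1..} (\<lambda>_. count_space UNIV)) (\<lambda>\<omega>. \<lambda>k\<in>{1..}. u k \<omega>)
        (Pi\<^sub>M UNIV (\<lambda>_. count_space (states d))) (\<lambda>\<omega> n. Z n \<omega>) \<and>
      (\<forall>k\<ge>1. \<forall>a\<in>{p..d i}.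
        \<P>(\<omega> in M \<alpha>. u k \<omega> = a) = \<theta> d \<alpha> i a / (\<Prod>m=1..p. (sin (\<alpha> i m))\<^sup>2))"
    and "p = d i \<Longrightarrow>
      \<forall>k\<ge>1. \<forall>\<omega>\<in>space (M \<alpha>).
        u k \<omega> = d i * of_bool (snd (Z k \<omega>) = d i - 1) + (d i - 1) * of_bool (snd (Z k \<omega>) = d i)"
    and "\<And>N. \<Gamma> N \<in> borel_measurable (M \<alpha>)"
    and "AE \<omega> in M \<alpha>. (\<lambda>N. \<Gamma> N \<omega>) \<longlonglongrightarrow> long_run_cost d A c \<alpha>"
  shows "(\<forall>N. (\<lambda>x. mean_cost M Z c N (set_coord \<alpha> i p x)) differentiable (at (\<alpha> i p))) \<and>
    tendsto_zero_in_prob (M \<alpha>)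
      (\<lambda>N \<omega>. G_hat d c \<alpha> i p Z u \<Gamma> N \<omega>
        - deriv (\<lambda>x. mean_cost M Z c N (set_coord \<alpha> i p x)) (\<alpha> i p))"
proof -
  note d_ge_1 = assms(1) and int = assms(6) and p = assms(7)
  let ?E = "states d" and ?P = "trans_prob d A \<alpha>"
  obtain L \<epsilon> where prim: "primitive_matrix ?E ?P L \<epsilon>"
    using stochastic_matrix.primitive_matrixI[OF stochastic_trans_prob[OF d_ge_1]
        assms(2)[OF int] assms(3)[OF int]] by blast
  define U where "U k \<omega> = (if k = 0 then 0 else min (u k \<omega>) (d i))" for k \<omega>
  note extended = extended_chain[OF d_ge_1 assms(4)[OF int] int p prim assms(8,9), folded U_def]
  interpret marked_chain "M \<alpha>" ?E ?P L \<epsilon> "{..d i}" "mark_law d \<alpha> i p"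
    "\<lambda>k \<omega>. (Z k \<omega>, U k \<omega>)" "\<lambda>a. (i, a)"
    by (rule extended(3))
  have u_meas: "u k \<in> M \<alpha> \<rightarrow>\<^sub>M count_space UNIV" if "k \<ge> 1" for k
    by (rule extended(1)) (assumption | rule that)+
  have AE_u: "AE \<omega> in M \<alpha>. \<forall>k\<ge>1. u k \<omega> = U k \<omega>"
    by (rule extended(2))
  obtain V where V: "\<And>z. z \<in> ?E \<Longrightarrow> V z - chain.T V z = c z - chain.mean c"
    using chain.poisson_equation by blast
  have cost: "long_run_cost d A c \<alpha> = chain.mean c"
    by (simp add: long_run_cost_def chain.mean_def)
  note deriv = mean_cost_derivative[OF d_ge_1 assms(4,5) int p prim V]
  let ?g = "chain.mean (\<lambda>z. K d i p \<alpha> z * (V z - (\<Sum>a\<in>{..d i}. mark_law d \<alpha> i p z a * V (i, a))))"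
  define X where "X N \<omega> = (\<Sum>k=1..N. K d i p \<alpha> (Z k \<omega>) *
      ((c (Z k \<omega>) - c (i, U k \<omega>)) + (\<Sum>n=k+1..k+hit k \<omega>. c (Z n \<omega>)) - real (hit k \<omega>) * \<Gamma> N \<omega>)) / real N
    - of_bool (N > 0) * ?g" for N \<omega>
  define e where "e N = 2 * of_bool (N > 0) * ?g
    - deriv (\<lambda>x. mean_cost M Z c N (set_coord \<alpha> i p x)) (\<alpha> i p)" for N
  have X: "tendsto_zero_in_prob (M \<alpha>) X"
    using consistency[OF V assms(10) assms(11)[unfolded cost], of "K d i p \<alpha>"]
    unfolding X_def[abs_def] fst_conv snd_conv .
  have "(\<lambda>N. - (deriv (\<lambda>x. mean_cost M Z c N (set_coord \<alpha> i p x)) (\<alpha> i p)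
      - of_bool (N > 0) * (2 * ?g))) \<longlonglongrightarrow> - 0"
    using deriv(2) unfolding gradient_identity[OF d_ge_1 int p prim] by (rule tendsto_minus)
  then have e: "tendsto_zero_in_prob (M \<alpha>) (\<lambda>N _. e N)"
    by (intro tendsto_zero_in_prob_const) (simp add: e_def algebra_simps)
  have G: "tendsto_zero_in_prob (M \<alpha>) (\<lambda>N \<omega>. G_hat d c \<alpha> i p Z u \<Gamma> N \<omega>
      - deriv (\<lambda>x. mean_cost M Z c N (set_coord \<alpha> i p x)) (\<alpha> i p))"
  \<comment> \<open>The factor 2 of the estimator is realised by adding \<open>X\<close> to itself;
    \<open>e\<close> is the deterministic distance between twice the stationary mean and the
    gradient.\<close>
  proof (rule tendsto_zero_in_prob_cong_AE[OF tendsto_zero_in_prob_add[OF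
        tendsto_zero_in_prob_add[OF X X] e]])
    fix N
    have of_Z: "(\<lambda>\<omega>. f (Z n \<omega>)) \<in> borel_measurable (M \<alpha>)" for f :: "'s \<times> nat \<Rightarrow> real" and n
      using ext.measurable_of_Y[of "\<lambda>y. f (fst y)" n] unfolding fst_conv .
    have pred_Z: "Measurable.pred (M \<alpha>) (\<lambda>\<omega>. Z n \<omega> = z)" for n z
      using ext.pred_of_Y[of "\<lambda>y. fst y = z" n] unfolding fst_conv .
    \<comment> \<open>\<open>\<nu>\<close> and \<open>hit\<close> agree only almost everywhere, and
      \<open>M \<alpha>\<close> need not be complete, so measurability of \<open>\<nu>\<close> is
      shown directly. Listing the countably many values of \<open>u k\<close> turns the random
      target into fixed ones.\<close>
    have \<nu>_meas: "\<nu> i Z u k \<in> M \<alpha> \<rightarrow>\<^sub>M count_space UNIV" if "k \<ge> 1" for k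
      unfolding \<nu>_def
    proof (rule measurable_Least)
      fix n
      note [measurable] = u_meas[OF that] pred_Z
      have "Measurable.pred (M \<alpha>) (\<lambda>\<omega>. \<exists>a. u k \<omega> = a \<and> 0 < n \<and> Z (k + n) \<omega> = (i, a))" by measurable
      then show "Measurable.pred (M \<alpha>) (\<lambda>\<omega>. 0 < n \<and> Z (k + n) \<omega> = (i, u k \<omega>))" by simp
    qed
    have "(\<lambda>\<omega>. \<Sum>k=1..N. K d i p \<alpha> (Z k \<omega>) *
      ((c (i, snd (Z k \<omega>)) - c (i, u k \<omega>))
       + (\<Sum>n=k+1..k + \<nu> i Z u k \<omega>. c (Z n \<omega>))
       - real (\<nu> i Z u k \<omega>) * \<Gamma> N \<omega>)) \<in> borel_measurable (M \<alpha>)"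
    proof (rule borel_measurable_sum)
      fix k assume "k \<in> {1..N}"
      then have k: "k \<ge> 1" by simp
      have "(\<lambda>\<omega>. \<Sum>n=k+1..k + \<nu> i Z u k \<omega>. c (Z n \<omega>)) \<in> borel_measurable (M \<alpha>)"
        by (rule measurable_random_sum[where I = "\<lambda>h. {k+1..k+h}", OF \<nu>_meas[OF k] of_Z])
      note [measurable] = this assms(10) \<nu>_meas[OF k] of_Z[of "K d i p \<alpha>"]
        of_Z[of "\<lambda>z. c (i, snd z)"] measurable_compose[OF u_meas[OF k], of "\<lambda>a. c (i, a)" borel]
      show "(\<lambda>\<omega>. K d i p \<alpha> (Z k \<omega>) *
        ((c (i, snd (Z k \<omega>)) - c (i, u k \<omega>))
         + (\<Sum>n=k+1..k + \<nu> i Z u k \<omega>. c (Z n \<omega>))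
         - real (\<nu> i Z u k \<omega>) * \<Gamma> N \<omega>)) \<in> borel_measurable (M \<alpha>)"
        by measurable
    qed
    then show "(\<lambda>\<omega>. G_hat d c \<alpha> i p Z u \<Gamma> N \<omega>
        - deriv (\<lambda>x. mean_cost M Z c N (set_coord \<alpha> i p x)) (\<alpha> i p)) \<in> borel_measurable (M \<alpha>)"
      unfolding G_hat_def by measurable
    show "AE \<omega> in M \<alpha>. G_hat d c \<alpha> i p Z u \<Gamma> N \<omega>
        - deriv (\<lambda>x. mean_cost M Z c N (set_coord \<alpha> i p x)) (\<alpha> i p) = X N \<omega> + X N \<omega> + e N"
      using AE_u
    proof eventually_elim
      case (elim \<omega>)
      \<comment> \<open>\<open>K\<close> vanishes away from state \<open>i\<close>, and at state
        \<open>i\<close> the costs \<open>c (i, snd z)\<close> and \<open>c z\<close>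
        coincide.\<close>
      have K_c: "K d i p \<alpha> z * ((c (i, snd z) - x) + y) = K d i p \<alpha> z * ((c z - x) + y)" for z x y
        by (cases "fst z = i") (auto simp: K_def \<delta>_def)
      have "K d i p \<alpha> (Z k \<omega>) *
          ((c (i, snd (Z k \<omega>)) - c (i, u k \<omega>)) + (\<Sum>n=k+1..k + \<nu> i Z u k \<omega>. c (Z n \<omega>))
           - real (\<nu> i Z u k \<omega>) * \<Gamma> N \<omega>) =
          K d i p \<alpha> (Z k \<omega>) *
          ((c (Z k \<omega>) - c (i, U k \<omega>)) + (\<Sum>n=k+1..k+hit k \<omega>. c (Z n \<omega>)) - real (hit k \<omega>) * \<Gamma> N \<omega>)"
        if "k \<in> {1..N}" for k
      proof -
        have "\<nu> i Z u k \<omega> = hit k \<omega>" "u k \<omega> = U k \<omega>" using elim that by (auto simp: \<nu>_def hit_def)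
        then show ?thesis using K_c by (simp add: add_diff_eq[symmetric])
      qed
      then have sum_eq: "(\<Sum>k=1..N. K d i p \<alpha> (Z k \<omega>) *
          ((c (i, snd (Z k \<omega>)) - c (i, u k \<omega>)) + (\<Sum>n=k+1..k + \<nu> i Z u k \<omega>. c (Z n \<omega>))
           - real (\<nu> i Z u k \<omega>) * \<Gamma> N \<omega>)) =
          (\<Sum>k=1..N. K d i p \<alpha> (Z k \<omega>) *
          ((c (Z k \<omega>) - c (i, U k \<omega>)) + (\<Sum>n=k+1..k+hit k \<omega>. c (Z n \<omega>)) - real (hit k \<omega>) * \<Gamma> N \<omega>))"
        by (rule sum.cong[OF refl])
      have "G_hat d c \<alpha> i p Z u \<Gamma> N \<omega> = 2 * (X N \<omega> + of_bool (N > 0) * ?g)"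
        unfolding G_hat_def X_def sum_eq by simp
      then show ?case by (simp add: e_def algebra_simps)
    qed
  qed
  show ?thesis using deriv(1) G by blast
qed

end
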